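(* Let $\pi$ be a discrete group, let $A$ be a left $\mathbb{Z}[\pi\times\pi]$-module, let $k$ and $n$ be integers with $0<k\le n$, and let $\alpha\in H^n(\pi\times\pi,A)=D_0^{n,0}$. With the modules $D_p^{r,s}$, $E_p^{r,s}$ and the homomorphisms $j_p:D_p^{r,s}\to E_p^{r-p,s+p}$ of the derived couples: (1) $\alpha$ lies in the group $D_k^{n,0}=\mathrm{Im}\,[\,i_0^k:D_0^{n-k,k}\to D_0^{n,0}]$ if and only if the following $k$ (successively defined) obstructions vanish: $$j_s(\alpha)\in E_s^{n-s,s},\qquad s=0,1,\dots,k-1.$$ (2) The condition $j_0(\alpha)=0$ is equivalent to $\alpha$ being a zero-divisor. (3) Each obstruction $j_s(\alpha)$, $s\ge 1$, is defined (i.e. $\alpha\in D_s^{n,0}$) once the previous obstruction $j_{s-1}(\alpha)$ is defined and vanishes. (4) The triviality of all obstructions $j_0(\alpha),j_1(\alpha),\dots,j_{n-1}(\alpha)$ is necessary and sufficient for the cohomology class $\alpha$ to be essential.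
   Context: Left $\mathbb{Z}[\pi\times\pi]$-modules are viewed as $\pi$-$\pi$-bimodules via $(g,h)\cdot m=gmh^{-1}$. $\mathbb{Z}[\pi]$ is a $\mathbb{Z}[\pi\times\pi]$-module via $(g,h)\cdot a=gah^{-1}$, $\epsilon:\mathbb{Z}[\pi]\to\mathbb{Z}$ is the augmentation, $I=\ker\epsilon$, $i:I\to\mathbb{Z}[\pi]$ the inclusion, and $I^s$ is the $s$-fold tensor power over $\mathbb{Z}$ ($I^0=\mathbb{Z}$). Tensor products over $\mathbb Z$ carry the diagonal action of $\pi\times\pi$. The canonical class $\mathfrak v\in H^1(\pi\times\pi,I)$ is represented by the crossed homomorphism $(g,h)\mapsto gh^{-1}-1$; $\mathfrak v^n\in H^n(\pi\times\pi,I^n)$ is its $n$-fold cup power. A class $\alpha\in H^n(\pi\times\pi,A)$ is essential if there is a $\mathbb{Z}[\pi\times\pi]$-homomorphism $\mu:I^n\to A$ with $\mu_*(\mathfrak v^n)=\alpha$. It is a zero-divisor if its restriction to the diagonal subgroup $\Delta_\pi=\{(g,g)\}\cong\pi$ vanishes in $H^n(\pi,\tilde A)$, where $\tilde A$ is $A$ with the conjugation action $g\cdot a=gag^{-1}$. For $r,s\ge 0$ put $D_0^{r,s}=\mathrm{Ext}^r_{\mathbb{Z}[\pi\times\pi]}(I^s,A)$ and $E_0^{r,s}=\mathrm{Ext}^r_{\mathbb{Z}[\pi\times\pi]}(\mathbb{Z}[\pi]\otimes_{\mathbb Z}I^s,A)$ (zero for $r<0$ or $s<0$). Thus $D_0^{n,0}=H^n(\pi\times\pi,A)$.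 The short exact sequence $0\to I^{s+1}\xrightarrow{i\otimes1}\mathbb{Z}[\pi]\otimes_{\mathbb Z}I^s\xrightarrow{\epsilon\otimes1}I^s\to0$ gives the long exact sequence $$\cdots\to E_0^{r,s}\xrightarrow{k_0}D_0^{r,s+1}\xrightarrow{i_0}D_0^{r+1,s}\xrightarrow{j_0}E_0^{r+1,s}\to\cdots$$ with $i_0$ the connecting homomorphism. The $p$-th derived couple ($p\ge1$) is obtained in the usual way: $D_p^{r,s}=\mathrm{Im}[i_{p-1}:D_{p-1}^{r-1,s+1}\to D_{p-1}^{r,s}]$ (equivalently the image of $i_0^p:D_0^{r-p,s+p}\to D_0^{r,s}$); $E_p$ is the homology of $E_{p-1}$ with respect to $d_{p-1}=j_{p-1}\circ k_{p-1}$; $i_p$ is the restriction of $i_{p-1}$, mapping $D_p^{r,s+1}\to D_p^{r+1,s}$ for $s\ge 0$; $j_p(i_{p-1}(y))=[j_{p-1}(y)]$; $k_p([e])=k_{p-1}(e)$. The bidegrees in $(r,s)$ are: $i_p$: $(1,-1)$; $j_p$: $(-p,p)$; $k_p$: $(0,1)$; $d_p$: $(-p,p+1)$. *)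

theory Defs
  imports
    "HOL-Library.Poly_Mapping"
    "HOL-Library.Product_Plus"
    "HOL-Library.Function_Algebras"
    "HOL-Algebra.Weak_Morphisms"
begin

text \<open>
  A group is a type of class \<open>group_add\<close>. This class is not commutative: the group operation is
  merely written \<open>+\<close>, so that \<open>g m h\<^sup>-\<^sup>1\<close> reads \<open>g + m - h\<close>. With this convention the type
  \<open>'h \<Rightarrow>\<^sub>0 int\<close> with its library multiplication (convolution) is the integral group ring of \<open>'h\<close>,
  and \<open>frag_of h\<close> is the group element \<open>h\<close> viewed in the group ring.
\<close>

section \<open>Left modules over a not necessarily commutative ring\<close>

record ('r, 'm) lmod =
  carr :: "'m set"
  smul :: "'r \<Rightarrow> 'm \<Rightarrow> 'm"

definition left_module :: "('r::ring_1, 'm::ab_group_add) lmod \<Rightarrow> bool" where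
  "left_module M \<longleftrightarrow>
     0 \<in> carr M \<and>
     (\<forall>x\<in>carr M. \<forall>y\<in>carr M. x + y \<in> carr M) \<and>
     (\<forall>x\<in>carr M. - x \<in> carr M) \<and>
     (\<forall>c. \<forall>x\<in>carr M. smul M c x \<in> carr M) \<and>
     (\<forall>c. \<forall>x\<in>carr M. \<forall>y\<in>carr M. smul M c (x + y) = smul M c x + smul M c y) \<and>
     (\<forall>c d. \<forall>x\<in>carr M. smul M (c + d) x = smul M c x + smul M d x) \<and>
     (\<forall>c d. \<forall>x\<in>carr M. smul M (c * d) x = smul M c (smul M d x)) \<and>
     (\<forall>x\<in>carr M. smul M 1 x = x)"

text \<open>
  Homomorphisms are extended by \<open>0\<close> outside the carrier, so that \<open>lhom M N\<close> is a subgroup of the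
  function type under pointwise addition.
\<close>

definition lhom :: "('r, 'm::ab_group_add) lmod \<Rightarrow> ('r, 'n::ab_group_add) lmod \<Rightarrow> ('m \<Rightarrow> 'n) set"
  where
  "lhom M N = {f. (\<forall>x\<in>carr M. f x \<in> carr N) \<and> (\<forall>x. x \<notin> carr M \<longrightarrow> f x = 0) \<and>
     (\<forall>x\<in>carr M. \<forall>y\<in>carr M. f (x + y) = f x + f y) \<and>
     (\<forall>c. \<forall>x\<in>carr M. f (smul M c x) = smul N c (f x))}"

definition restrict0 :: "'m set \<Rightarrow> ('m \<Rightarrow> 'n::zero) \<Rightarrow> 'm \<Rightarrow> 'n" where
  "restrict0 X f = (\<lambda>x. if x \<in> X then f x else 0)"


section \<open>The standard resolution and Ext\<close>

text \<open>Extension of a family of additive maps \<open>F k\<close> to finitely supported functions.\<close>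

definition add_extend :: "('k \<Rightarrow> 'm::zero \<Rightarrow> 'b::comm_monoid_add) \<Rightarrow> ('k \<Rightarrow>\<^sub>0 'm) \<Rightarrow> 'b" where
  "add_extend F x = (\<Sum>k\<in>Poly_Mapping.keys x. F k (Poly_Mapping.lookup x k))"

text \<open>
  \<open>bar r M\<close> is the tensor product over the integers of the free module on \<open>(r+1)\<close>-tuples of group
  elements (degree \<open>r\<close> of the homogeneous standard resolution of the trivial module) with \<open>M\<close>,
  under the diagonal action. It is realised as the finitely supported functions from tuples to
  \<open>M\<close>, so that \<open>Poly_Mapping.single \<sigma> m\<close> is the pure tensor of \<open>\<sigma>\<close> and \<open>m\<close>.
  When \<open>M\<close> is free as an abelian group, this is a projective resolution of \<open>M\<close>; it is used below
  only for such \<open>M\<close> (see \<open>bar_exact\<close>, \<open>bar_exact_0\<close> and \<open>bar_projective_Ipow\<close> below).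
\<close>

definition bar :: "nat \<Rightarrow> (('h::group_add \<Rightarrow>\<^sub>0 int), 'm::ab_group_add) lmod \<Rightarrow>
    (('h \<Rightarrow>\<^sub>0 int), ('h list \<Rightarrow>\<^sub>0 'm)) lmod" where
  "bar r M =
     \<lparr>carr = {x. (\<forall>\<sigma>\<in>Poly_Mapping.keys x. length \<sigma> = Suc r) \<and>
                (\<forall>\<sigma>. Poly_Mapping.lookup x \<sigma> \<in> carr M)},
      smul = (\<lambda>c. add_extend (\<lambda>\<sigma> m. add_extend (\<lambda>h k.
                Poly_Mapping.single (map ((+) h) \<sigma>) (smul M (Poly_Mapping.single h k) m)) c))\<rparr>"

definition face :: "nat \<Rightarrow> 'h list \<Rightarrow> 'h list" where
  "face i \<sigma> = take i \<sigma> @ drop (Suc i) \<sigma>"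

definition boundary :: "('h list \<Rightarrow>\<^sub>0 'm::ab_group_add) \<Rightarrow> ('h list \<Rightarrow>\<^sub>0 'm)" where
  "boundary = add_extend (\<lambda>\<sigma> m. \<Sum>i<length \<sigma>.
     Poly_Mapping.single (face i \<sigma>) (if even i then m else - m))"

definition coboundary :: "nat \<Rightarrow> (('h::group_add \<Rightarrow>\<^sub>0 int), 'm::ab_group_add) lmod \<Rightarrow>
    (('h list \<Rightarrow>\<^sub>0 'm) \<Rightarrow> 'a::ab_group_add) \<Rightarrow> ('h list \<Rightarrow>\<^sub>0 'm) \<Rightarrow> 'a" where
  "coboundary r M \<phi> = restrict0 (carr (bar (Suc r) M)) (\<phi> \<circ> boundary)"

definition cocycles :: "nat \<Rightarrow> (('h::group_add \<Rightarrow>\<^sub>0 int), 'm::ab_group_add) lmod \<Rightarrow>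
    (('h \<Rightarrow>\<^sub>0 int), 'a::ab_group_add) lmod \<Rightarrow> (('h list \<Rightarrow>\<^sub>0 'm) \<Rightarrow> 'a) set" where
  "cocycles r M A = {\<phi> \<in> lhom (bar r M) A. coboundary r M \<phi> = 0}"

definition coboundaries :: "nat \<Rightarrow> (('h::group_add \<Rightarrow>\<^sub>0 int), 'm::ab_group_add) lmod \<Rightarrow>
    (('h \<Rightarrow>\<^sub>0 int), 'a::ab_group_add) lmod \<Rightarrow> (('h list \<Rightarrow>\<^sub>0 'm) \<Rightarrow> 'a) set" where
  "coboundaries r M A =
     (case r of 0 \<Rightarrow> {0} | Suc q \<Rightarrow> coboundary q M ` lhom (bar q M) A)"

definition add_group :: "'b::ab_group_add set \<Rightarrow> 'b monoid" where
  "add_group Z = \<lparr>carrier = Z, mult = (+), one = 0\<rparr>"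

text \<open>\<open>Ext r M A\<close> is the cohomology of \<open>Hom(bar _ M, A)\<close> in degree \<open>r\<close>.\<close>

definition Ext :: "nat \<Rightarrow> (('h::group_add \<Rightarrow>\<^sub>0 int), 'm::ab_group_add) lmod \<Rightarrow>
    (('h \<Rightarrow>\<^sub>0 int), 'a::ab_group_add) lmod \<Rightarrow> (('h list \<Rightarrow>\<^sub>0 'm) \<Rightarrow> 'a) set monoid" where
  "Ext r M A = add_group (cocycles r M A) Mod coboundaries r M A"

definition cls :: "nat \<Rightarrow> (('h::group_add \<Rightarrow>\<^sub>0 int), 'm::ab_group_add) lmod \<Rightarrow>
    (('h \<Rightarrow>\<^sub>0 int), 'a::ab_group_add) lmod \<Rightarrow> (('h list \<Rightarrow>\<^sub>0 'm) \<Rightarrow> 'a) \<Rightarrow>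
    (('h list \<Rightarrow>\<^sub>0 'm) \<Rightarrow> 'a) set" where
  "cls r M A \<phi> = coboundaries r M A #>\<^bsub>add_group (cocycles r M A)\<^esub> \<phi>"

text \<open>Pullback of cochains along a homomorphism \<open>f\<close> of modules with source \<open>M\<close>.\<close>

definition pullback :: "nat \<Rightarrow> (('h::group_add \<Rightarrow>\<^sub>0 int), 'm::ab_group_add) lmod \<Rightarrow> ('m \<Rightarrow> 'n) \<Rightarrow>
    (('h list \<Rightarrow>\<^sub>0 'n::ab_group_add) \<Rightarrow> 'a::ab_group_add) \<Rightarrow> ('h list \<Rightarrow>\<^sub>0 'm) \<Rightarrow> 'a" where
  "pullback r M f \<phi> = restrict0 (carr (bar r M)) (\<lambda>x. \<phi> (Poly_Mapping.map f x))"

definition Ext_map :: "nat \<Rightarrow> (('h::group_add \<Rightarrow>\<^sub>0 int), 'm::ab_group_add) lmod \<Rightarrow> ('m \<Rightarrow> 'n) \<Rightarrow>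
    (('h \<Rightarrow>\<^sub>0 int), 'a::ab_group_add) lmod \<Rightarrow>
    (('h list \<Rightarrow>\<^sub>0 'n::ab_group_add) \<Rightarrow> 'a) set \<Rightarrow> (('h list \<Rightarrow>\<^sub>0 'm) \<Rightarrow> 'a) set" where
  "Ext_map r M f A X = the_elem ((\<lambda>\<phi>. cls r M A (pullback r M f \<phi>)) ` X)"

text \<open>
  The connecting homomorphism \<open>Ext r M' A \<rightarrow> Ext (r+1) M'' A\<close> of a short exact sequence
  \<open>0 \<rightarrow> M' \<rightarrow> M \<rightarrow> M'' \<rightarrow> 0\<close> with maps \<open>i\<close>, \<open>e\<close>: a cocycle \<open>\<phi>\<close> is extended along \<open>i\<close> to a cochain
  \<open>\<psi>\<close> on \<open>M\<close>, and the coboundary of \<open>\<psi>\<close> is the pullback along \<open>e\<close> of a cocycle \<open>\<chi>\<close>.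
\<close>

definition connecting :: "nat \<Rightarrow> (('h::group_add \<Rightarrow>\<^sub>0 int), 'm1::ab_group_add) lmod \<Rightarrow> ('m1 \<Rightarrow> 'm) \<Rightarrow>
    (('h \<Rightarrow>\<^sub>0 int), 'm::ab_group_add) lmod \<Rightarrow> ('m \<Rightarrow> 'm2) \<Rightarrow>
    (('h \<Rightarrow>\<^sub>0 int), 'm2::ab_group_add) lmod \<Rightarrow> (('h \<Rightarrow>\<^sub>0 int), 'a::ab_group_add) lmod \<Rightarrow>
    (('h list \<Rightarrow>\<^sub>0 'm1) \<Rightarrow> 'a) set \<Rightarrow> (('h list \<Rightarrow>\<^sub>0 'm2) \<Rightarrow> 'a) set" where
  "connecting r M' i M e M'' A X =
     the_elem {cls (Suc r) M'' A \<chi> | \<phi> \<psi> \<chi>. \<phi> \<in> X \<and> \<psi> \<in> lhom (bar r M) A \<and> pullback r M' i \<psi> = \<phi> \<and>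
        \<chi> \<in> cocycles (Suc r) M'' A \<and> pullback (Suc r) M e \<chi> = coboundary r M \<psi>}"


section \<open>The modules \<open>I^s\<close> and \<open>Z[\<pi>] \<otimes> I^s\<close>\<close>

definition aug :: "('g \<Rightarrow>\<^sub>0 int) \<Rightarrow> int" where
  "aug a = (\<Sum>g\<in>Poly_Mapping.keys a. Poly_Mapping.lookup a g)"

definition aug_ideal :: "('g \<Rightarrow>\<^sub>0 int) set" where
  "aug_ideal = {a. aug a = 0}"

text \<open>
  Tensor products over the integers: the \<open>s\<close>-fold tensor power of \<open>Z[\<pi>]\<close> is the free abelian group
  on the lists of length \<open>s\<close>, and tensor products of subgroups are the subgroups generated by the
  pure tensors. Subgroups of free abelian groups are flat, so nothing is lost; the universal
  property is proved below (\<open>tensor_group_universal\<close>).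
\<close>

definition tensor :: "('g \<Rightarrow>\<^sub>0 int) \<Rightarrow> ('g list \<Rightarrow>\<^sub>0 int) \<Rightarrow> ('g list \<Rightarrow>\<^sub>0 int)" where
  "tensor a x = frag_extend (\<lambda>g. frag_extend (\<lambda>w. frag_of (g # w)) x) a"

inductive_set tensor_group :: "('g \<Rightarrow>\<^sub>0 int) set \<Rightarrow> ('g list \<Rightarrow>\<^sub>0 int) set \<Rightarrow> ('g list \<Rightarrow>\<^sub>0 int) set"
  for X Y where
  zero: "0 \<in> tensor_group X Y"
| add: "a \<in> X \<Longrightarrow> y \<in> Y \<Longrightarrow> u \<in> tensor_group X Y \<Longrightarrow> tensor a y + u \<in> tensor_group X Y"

primrec I_power :: "nat \<Rightarrow> ('g list \<Rightarrow>\<^sub>0 int) set" where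
  "I_power 0 = {x. Poly_Mapping.keys x \<subseteq> {[]}}"
| "I_power (Suc s) = tensor_group aug_ideal (I_power s)"

text \<open>Linear extension of an action \<open>act\<close> of a group on a set to the group ring.\<close>

definition perm_smul :: "('h \<Rightarrow> 'x \<Rightarrow> 'x) \<Rightarrow> ('h \<Rightarrow>\<^sub>0 int) \<Rightarrow> ('x \<Rightarrow>\<^sub>0 int) \<Rightarrow> ('x \<Rightarrow>\<^sub>0 int)" where
  "perm_smul act c x = frag_extend (\<lambda>h. frag_extend (\<lambda>w. frag_of (act h w)) x) c"

definition bact :: "'g::group_add \<times> 'g \<Rightarrow> 'g \<Rightarrow> 'g" where
  "bact gh t = fst gh + t - snd gh"

definition I_mod :: "(('g::group_add \<times> 'g) \<Rightarrow>\<^sub>0 int, 'g \<Rightarrow>\<^sub>0 int) lmod" where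
  "I_mod = \<lparr>carr = aug_ideal, smul = perm_smul bact\<rparr>"

definition Ipow_mod :: "nat \<Rightarrow> (('g::group_add \<times> 'g) \<Rightarrow>\<^sub>0 int, 'g list \<Rightarrow>\<^sub>0 int) lmod" where
  "Ipow_mod s = \<lparr>carr = I_power s, smul = perm_smul (\<lambda>gh. map (bact gh))\<rparr>"

definition ZIpow_mod :: "nat \<Rightarrow> (('g::group_add \<times> 'g) \<Rightarrow>\<^sub>0 int, 'g list \<Rightarrow>\<^sub>0 int) lmod" where
  "ZIpow_mod s = \<lparr>carr = tensor_group UNIV (I_power s), smul = perm_smul (\<lambda>gh. map (bact gh))\<rparr>"

text \<open>
  \<open>i \<otimes> 1\<close> is the inclusion of \<open>carr (Ipow_mod (s+1))\<close> into \<open>carr (ZIpow_mod s)\<close>, hence \<open>id\<close>;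
  \<open>\<epsilon> \<otimes> 1\<close> deletes the first tensor factor.
\<close>

definition eps_tensor :: "('g list \<Rightarrow>\<^sub>0 int) \<Rightarrow> ('g list \<Rightarrow>\<^sub>0 int)" where
  "eps_tensor = frag_extend (\<lambda>w. frag_of (tl w))"


section \<open>Exact couples and their derived couples\<close>

text \<open>
  Bidegrees of the \<open>p\<close>-th couple: \<open>ci\<close> is \<open>(1,-1)\<close>, \<open>cj\<close> is \<open>(-p,p)\<close>, \<open>ck\<close> is \<open>(0,1)\<close>.
  The indices \<open>r\<close>, \<open>s\<close> of each map are those of its source.
\<close>

record 'e couple =
  cD :: "int \<Rightarrow> int \<Rightarrow> 'e monoid"
  cE :: "int \<Rightarrow> int \<Rightarrow> 'e monoid"
  ci :: "int \<Rightarrow> int \<Rightarrow> 'e \<Rightarrow> 'e"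
  cj :: "int \<Rightarrow> int \<Rightarrow> 'e \<Rightarrow> 'e"
  ck :: "int \<Rightarrow> int \<Rightarrow> 'e \<Rightarrow> 'e"

definition cd :: "'e couple \<Rightarrow> int \<Rightarrow> int \<Rightarrow> 'e \<Rightarrow> 'e" where
  "cd C r s = cj C r (s + 1) \<circ> ck C r s"

definition cycle_group :: "int \<Rightarrow> 'e couple \<Rightarrow> int \<Rightarrow> int \<Rightarrow> 'e monoid" where
  "cycle_group p C r s =
     (cE C r s)\<lparr>carrier := kernel (cE C r s) (cE C (r - p) (s + p + 1)) (cd C r s)\<rparr>"

definition boundary_set :: "int \<Rightarrow> 'e couple \<Rightarrow> int \<Rightarrow> int \<Rightarrow> 'e set" where
  "boundary_set p C r s = cd C (r + p) (s - p - 1) ` carrier (cE C (r + p) (s - p - 1))"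

text \<open>
  The elements of the groups \<open>cE\<close> are themselves cosets (sets of cochains), and an element of the
  homology of \<open>cE\<close> is a coset of such cosets. It is replaced by its union, which determines it
  because distinct cosets are disjoint. This keeps the type of \<open>E\<^sub>p\<close> independent of \<open>p\<close>; it is
  the usual identification of \<open>(Z/B)/(B'/B)\<close> with \<open>Z/B'\<close>.
\<close>

definition homology_group :: "int \<Rightarrow> 'b set couple \<Rightarrow> int \<Rightarrow> int \<Rightarrow> 'b set monoid" where
  "homology_group p C r s = image_group Union (cycle_group p C r s Mod boundary_set p C r s)"

definition homology_class :: "int \<Rightarrow> 'b set couple \<Rightarrow> int \<Rightarrow> int \<Rightarrow> 'b set \<Rightarrow> 'b set" where
  "homology_class p C r s e = \<Union> (boundary_set p C r s #>\<^bsub>cycle_group p C r s\<^esub> e)"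

text \<open>
  From the \<open>p\<close>-th to the \<open>(p+1)\<close>-st couple. For \<open>s < 0\<close> the groups \<open>D\<close> vanish and \<open>j\<close> is zero.
\<close>

definition derived_couple :: "int \<Rightarrow> 'b set couple \<Rightarrow> 'b set couple" where
  "derived_couple p C =
     \<lparr>cD = (\<lambda>r s. (cD C r s)\<lparr>carrier := ci C (r - 1) (s + 1) ` carrier (cD C (r - 1) (s + 1))\<rparr>),
      cE = homology_group p C,
      ci = ci C,
      cj = (\<lambda>r s x. if s < 0 then \<one>\<^bsub>homology_group p C (r - p - 1) (s + p + 1)\<^esub> else
              the_elem {homology_class p C (r - p - 1) (s + p + 1) (cj C (r - 1) (s + 1) y) | y.
                y \<in> carrier (cD C (r - 1) (s + 1)) \<and> ci C (r - 1) (s + 1) y = x}),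
      ck = (\<lambda>r s e. the_elem {ck C r s z | z.
              z \<in> carrier (cycle_group p C r s) \<and> homology_class p C r s z = e})\<rparr>"

type_synonym ('g, 'a) cochain = "(('g \<times> 'g) list \<Rightarrow>\<^sub>0 ('g list \<Rightarrow>\<^sub>0 int)) \<Rightarrow> 'a"

definition D0 :: "(('g::group_add \<times> 'g) \<Rightarrow>\<^sub>0 int, 'a::ab_group_add) lmod \<Rightarrow>
    int \<Rightarrow> int \<Rightarrow> ('g, 'a) cochain set monoid" where
  "D0 A r s = (if r < 0 \<or> s < 0 then add_group {0} Mod {0} else Ext (nat r) (Ipow_mod (nat s)) A)"

definition E0 :: "(('g::group_add \<times> 'g) \<Rightarrow>\<^sub>0 int, 'a::ab_group_add) lmod \<Rightarrow>
    int \<Rightarrow> int \<Rightarrow> ('g, 'a) cochain set monoid" where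
  "E0 A r s = (if r < 0 \<or> s < 0 then add_group {0} Mod {0} else Ext (nat r) (ZIpow_mod (nat s)) A)"

definition i0 :: "(('g::group_add \<times> 'g) \<Rightarrow>\<^sub>0 int, 'a::ab_group_add) lmod \<Rightarrow>
    int \<Rightarrow> int \<Rightarrow> ('g, 'a) cochain set \<Rightarrow> ('g, 'a) cochain set" where
  "i0 A r s X = (if r < 0 \<or> s < 1 then \<one>\<^bsub>D0 A (r + 1) (s - 1)\<^esub> else
     connecting (nat r) (Ipow_mod (nat s)) id (ZIpow_mod (nat (s - 1))) eps_tensor
       (Ipow_mod (nat (s - 1))) A X)"

definition j0 :: "(('g::group_add \<times> 'g) \<Rightarrow>\<^sub>0 int, 'a::ab_group_add) lmod \<Rightarrow>
    int \<Rightarrow> int \<Rightarrow> ('g, 'a) cochain set \<Rightarrow> ('g, 'a) cochain set" where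
  "j0 A r s X = (if r < 0 \<or> s < 0 then \<one>\<^bsub>E0 A r s\<^esub> else
     Ext_map (nat r) (ZIpow_mod (nat s)) eps_tensor A X)"

definition k0 :: "(('g::group_add \<times> 'g) \<Rightarrow>\<^sub>0 int, 'a::ab_group_add) lmod \<Rightarrow>
    int \<Rightarrow> int \<Rightarrow> ('g, 'a) cochain set \<Rightarrow> ('g, 'a) cochain set" where
  "k0 A r s X = (if r < 0 \<or> s < 0 then \<one>\<^bsub>D0 A r (s + 1)\<^esub> else
     Ext_map (nat r) (Ipow_mod (nat (s + 1))) id A X)"

primrec derived :: "(('g::group_add \<times> 'g) \<Rightarrow>\<^sub>0 int, 'a::ab_group_add) lmod \<Rightarrow>
    nat \<Rightarrow> ('g, 'a) cochain set couple" where
  "derived A 0 = \<lparr>cD = D0 A, cE = E0 A, ci = i0 A, cj = j0 A, ck = k0 A\<rparr>"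
| "derived A (Suc p) = derived_couple (int p) (derived A p)"

text \<open>\<open>p\<close>-fold iterate of \<open>i\<^sub>0\<close>, starting at \<open>D\<^sub>0\<^bsup>r,s\<^esup>\<close>.\<close>

primrec i0_iter :: "(('g::group_add \<times> 'g) \<Rightarrow>\<^sub>0 int, 'a::ab_group_add) lmod \<Rightarrow>
    nat \<Rightarrow> int \<Rightarrow> int \<Rightarrow> ('g, 'a) cochain set \<Rightarrow> ('g, 'a) cochain set" where
  "i0_iter A 0 r s X = X"
| "i0_iter A (Suc p) r s X = i0_iter A p (r + 1) (s - 1) (i0 A r s X)"


abbreviation D_der :: "(('g::group_add \<times> 'g) \<Rightarrow>\<^sub>0 int, 'a::ab_group_add) lmod \<Rightarrow>
    nat \<Rightarrow> int \<Rightarrow> int \<Rightarrow> ('g, 'a) cochain set monoid" where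
  "D_der A p \<equiv> cD (derived A p)"

abbreviation E_der :: "(('g::group_add \<times> 'g) \<Rightarrow>\<^sub>0 int, 'a::ab_group_add) lmod \<Rightarrow>
    nat \<Rightarrow> int \<Rightarrow> int \<Rightarrow> ('g, 'a) cochain set monoid" where
  "E_der A p \<equiv> cE (derived A p)"

abbreviation j_der :: "(('g::group_add \<times> 'g) \<Rightarrow>\<^sub>0 int, 'a::ab_group_add) lmod \<Rightarrow>
    nat \<Rightarrow> int \<Rightarrow> int \<Rightarrow> ('g, 'a) cochain set \<Rightarrow> ('g, 'a) cochain set" where
  "j_der A p \<equiv> cj (derived A p)"


section \<open>Canonical class, essential classes, zero-divisors\<close>

text \<open>Cohomology of \<open>\<pi> \<times> \<pi>\<close>: the trivial module \<open>Z\<close> is \<open>I^0\<close>, with generator \<open>frag_of []\<close>.\<close>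

abbreviation coho :: "nat \<Rightarrow> (('g::group_add \<times> 'g) \<Rightarrow>\<^sub>0 int, 'a::ab_group_add) lmod \<Rightarrow>
    ('g, 'a) cochain set monoid" where
  "coho n A \<equiv> Ext n (Ipow_mod 0) A"

text \<open>
  The 1-cocycle of a crossed homomorphism \<open>f\<close>, in homogeneous form:
  the pair \<open>(x, y)\<close> is sent to \<open>x \<cdot> f (x\<^sup>-\<^sup>1 y)\<close>.
\<close>

definition crossed_cocycle :: "(('g::group_add \<times> 'g) \<Rightarrow>\<^sub>0 int, 'a::ab_group_add) lmod \<Rightarrow>
    ('g \<times> 'g \<Rightarrow> 'a) \<Rightarrow> ('g, 'a) cochain" where
  "crossed_cocycle A f = restrict0 (carr (bar 1 (Ipow_mod 0))) (add_extend (\<lambda>\<sigma> z.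
     smul A (Poly_Mapping.single (\<sigma> ! 0) (Poly_Mapping.lookup z [])) (f (- (\<sigma> ! 0) + \<sigma> ! 1))))"

definition canonical_class :: "('g::group_add, 'g \<Rightarrow>\<^sub>0 int) cochain set" where
  "canonical_class = cls 1 (Ipow_mod 0) I_mod
     (crossed_cocycle I_mod (\<lambda>(g, h). frag_of (g - h) - frag_of 0))"

text \<open>
  Cup product of a \<open>p\<close>-cochain with coefficients in \<open>I\<close> and a \<open>q\<close>-cochain with coefficients in
  \<open>I^s\<close> (Alexander--Whitney formula, values in \<open>I^(s+1)\<close>).
\<close>

definition cup_cochain :: "nat \<Rightarrow> nat \<Rightarrow> ('g::group_add, 'g \<Rightarrow>\<^sub>0 int) cochain \<Rightarrow>
    ('g, 'g list \<Rightarrow>\<^sub>0 int) cochain \<Rightarrow> ('g, 'g list \<Rightarrow>\<^sub>0 int) cochain" where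
  "cup_cochain p q f f' = restrict0 (carr (bar (p + q) (Ipow_mod 0))) (add_extend (\<lambda>\<sigma> z.
     frag_cmul (Poly_Mapping.lookup z [])
       (tensor (f (Poly_Mapping.single (take (Suc p) \<sigma>) (frag_of [])))
               (f' (Poly_Mapping.single (drop p \<sigma>) (frag_of []))))))"

definition cup :: "nat \<Rightarrow> nat \<Rightarrow> nat \<Rightarrow> ('g::group_add, 'g \<Rightarrow>\<^sub>0 int) cochain set \<Rightarrow>
    ('g, 'g list \<Rightarrow>\<^sub>0 int) cochain set \<Rightarrow> ('g, 'g list \<Rightarrow>\<^sub>0 int) cochain set" where
  "cup p q s X Y = the_elem {cls (p + q) (Ipow_mod 0) (Ipow_mod (Suc s)) (cup_cochain p q f f') |
     f f'. f \<in> X \<and> f' \<in> Y}"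

text \<open>The zeroth power is the unit of \<open>H^0(\<pi> \<times> \<pi>, Z)\<close>, represented by the augmentation.\<close>

primrec canonical_power :: "nat \<Rightarrow> ('g::group_add, 'g list \<Rightarrow>\<^sub>0 int) cochain set" where
  "canonical_power 0 = cls 0 (Ipow_mod 0) (Ipow_mod 0)
     (restrict0 (carr (bar 0 (Ipow_mod 0))) (add_extend (\<lambda>\<sigma> z. z)))"
| "canonical_power (Suc n) = cup 1 n n canonical_class (canonical_power n)"

definition coeff_map :: "nat \<Rightarrow> (('g::group_add \<times> 'g) \<Rightarrow>\<^sub>0 int, 'b::ab_group_add) lmod \<Rightarrow>
    ('a \<Rightarrow> 'b) \<Rightarrow> ('g, 'a::ab_group_add) cochain set \<Rightarrow> ('g, 'b) cochain set" where
  "coeff_map n B \<mu> X = the_elem ((\<lambda>\<phi>. cls n (Ipow_mod 0) B (\<mu> \<circ> \<phi>)) ` X)"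

definition essential :: "nat \<Rightarrow> (('g::group_add \<times> 'g) \<Rightarrow>\<^sub>0 int, 'a::ab_group_add) lmod \<Rightarrow>
    ('g, 'a) cochain set \<Rightarrow> bool" where
  "essential n A \<alpha> \<longleftrightarrow> (\<exists>\<mu>\<in>lhom (Ipow_mod n) A. coeff_map n A \<mu> (canonical_power n) = \<alpha>)"

text \<open>Restriction to the diagonal subgroup, identified with \<open>\<pi>\<close>.\<close>

definition conj_mod :: "(('g::group_add \<times> 'g) \<Rightarrow>\<^sub>0 int, 'a) lmod \<Rightarrow> ('g \<Rightarrow>\<^sub>0 int, 'a) lmod" where
  "conj_mod A = \<lparr>carr = carr A, smul = (\<lambda>c. smul A (frag_extend (\<lambda>g. frag_of (g, g)) c))\<rparr>"

definition trivial_mod :: "('g::group_add \<Rightarrow>\<^sub>0 int, 'g list \<Rightarrow>\<^sub>0 int) lmod" where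
  "trivial_mod = \<lparr>carr = {x. Poly_Mapping.keys x \<subseteq> {[]}}, smul = (\<lambda>c. frag_cmul (aug c))\<rparr>"

definition diag_restrict :: "nat \<Rightarrow> ('g::group_add, 'a::ab_group_add) cochain \<Rightarrow>
    ('g list \<Rightarrow>\<^sub>0 ('g list \<Rightarrow>\<^sub>0 int)) \<Rightarrow> 'a" where
  "diag_restrict n \<phi> = restrict0 (carr (bar n trivial_mod))
     (\<lambda>x. \<phi> (add_extend (\<lambda>\<sigma> z. Poly_Mapping.single (map (\<lambda>g. (g, g)) \<sigma>) z) x))"

definition zero_divisor :: "nat \<Rightarrow> (('g::group_add \<times> 'g) \<Rightarrow>\<^sub>0 int, 'a::ab_group_add) lmod \<Rightarrow>
    ('g, 'a) cochain set \<Rightarrow> bool" where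
  "zero_divisor n A \<alpha> \<longleftrightarrow>
     the_elem ((\<lambda>\<phi>. cls n trivial_mod (conj_mod A) (diag_restrict n \<phi>)) ` \<alpha>)
       = \<one>\<^bsub>Ext n trivial_mod (conj_mod A)\<^esub>"


section \<open>Facts justifying the constructions\<close>

lemma tensor_add_left: "tensor (a + b) y = tensor a y + tensor b y"
  by (simp add: tensor_def frag_extend_add)

lemma frag_extend_add_fun: "frag_extend (\<lambda>g. F g + G g) a = frag_extend F a + frag_extend G a"
  by (simp add: frag_extend_def frag_cmul_distrib2 sum.distrib)

lemma tensor_add_right: "tensor a (y + z) = tensor a y + tensor a z"
  by (simp add: tensor_def frag_extend_add frag_extend_add_fun)

lemma additive_minus_frag:
  fixes f :: "('k \<Rightarrow>\<^sub>0 int) \<Rightarrow> 'b::ab_group_add"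
  assumes "\<And>x y. f (x + y) = f x + f y"
  shows "f 0 = 0" "f (- x) = - f x" "f (x - y) = f x - f y"
proof -
  show z: "f 0 = 0" using assms[of 0 0] by simp
  show m: "f (- x) = - f x" for x
    using assms[of x "- x"] z by (simp add: eq_neg_iff_add_eq_0 add.commute)
  show "f (x - y) = f x - f y" using assms[of x "- y"] m[of y] by simp
qed

lemma additive_frag_eq:
  fixes f g :: "('k \<Rightarrow>\<^sub>0 int) \<Rightarrow> 'b::ab_group_add"
  assumes f: "\<And>x y. f (x + y) = f x + f y" and g: "\<And>x y. g (x + y) = g x + g y"
    and eq: "\<And>k. f (frag_of k) = g (frag_of k)"
  shows "f x = g x"
  by (induction x rule: frag_induction[OF subset_UNIV])
     (simp_all add: eq additive_minus_frag[OF f] additive_minus_frag[OF g])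

lemma biadditive_frag_eq:
  fixes f g :: "('k \<Rightarrow>\<^sub>0 int) \<Rightarrow> ('l \<Rightarrow>\<^sub>0 int) \<Rightarrow> 'b::ab_group_add"
  assumes "\<And>x y z. f (x + y) z = f x z + f y z" "\<And>x y z. f x (y + z) = f x y + f x z"
    and "\<And>x y z. g (x + y) z = g x z + g y z" "\<And>x y z. g x (y + z) = g x y + g x z"
    and "\<And>k l. f (frag_of k) (frag_of l) = g (frag_of k) (frag_of l)"
  shows "f x y = g x y"
  by (rule additive_frag_eq[of "\<lambda>x. f x y" "\<lambda>x. g x y"], simp_all add: assms)
     (rule additive_frag_eq, simp_all add: assms)

lemma add_extend_add:
  assumes F: "\<And>k c d. F k (c + d) = F k c + F k d"
  shows "add_extend F (x + y) = add_extend F x + (add_extend F y :: 'b::ab_group_add)"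
proof -
  have F0: "F k 0 = 0" for k using F[of k 0 0] by simp
  have ext: "add_extend F z = (\<Sum>k\<in>K. F k (Poly_Mapping.lookup z k))"
    if "finite K" "Poly_Mapping.keys z \<subseteq> K" for z K
    unfolding add_extend_def
    by (rule sum.mono_neutral_left) (use that F0 in \<open>auto simp: in_keys_iff\<close>)
  let ?K = "Poly_Mapping.keys x \<union> Poly_Mapping.keys y"
  show ?thesis
    using ext[of ?K x] ext[of ?K y] ext[of ?K "x + y"] Poly_Mapping.keys_add[of x y]
    by (simp add: lookup_add F sum.distrib)
qed

lemma aug_add: "aug (a + b) = aug a + aug b"
  using add_extend_add[of "\<lambda>_ c. c" a b] by (simp add: aug_def add_extend_def)

lemma aug_of [simp]: "aug (frag_of g) = 1"
  by (simp add: aug_def)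

lemma aug_cmul_of [simp]: "aug (frag_cmul c (frag_of g)) = c"
proof (cases "c = 0")
  case False
  then have "Poly_Mapping.keys (frag_cmul c (frag_of g)) = {g}" by auto
  then show ?thesis by (simp add: aug_def)
qed (simp add: aug_def)

lemma tensor_group_add:
  assumes "u \<in> tensor_group X Y" "v \<in> tensor_group X Y"
  shows "u + v \<in> tensor_group X Y"
  using assms by induction (auto simp: add.assoc intro: tensor_group.add)

lemma tensor_in_group: "a \<in> X \<Longrightarrow> y \<in> Y \<Longrightarrow> tensor a y \<in> tensor_group X Y"
  using tensor_group.add[OF _ _ tensor_group.zero] by fastforce

lemma aug_ideal_projection:
  obtains p :: "('g \<Rightarrow>\<^sub>0 int) \<Rightarrow> ('g \<Rightarrow>\<^sub>0 int)"
  where "\<And>a b. p (a + b) = p a + p b" "\<And>a. p a \<in> aug_ideal" "\<And>a. a \<in> aug_ideal \<Longrightarrow> p a = a"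
proof
  let ?p = "\<lambda>a :: 'g \<Rightarrow>\<^sub>0 int. a - frag_cmul (aug a) (frag_of undefined)"
  show "?p (a + b) = ?p a + ?p b" for a b
    by (simp add: aug_add frag_cmul_distrib)
  show "?p a \<in> aug_ideal" for a
    by (simp add: aug_ideal_def additive_minus_frag(3)[OF aug_add])
  show "?p a = a" if "a \<in> aug_ideal" for a
    using that by (simp add: aug_ideal_def)
qed

lemma tensor_group_diff:
  assumes X: "\<And>a. a \<in> X \<Longrightarrow> - a \<in> X" and u: "u \<in> tensor_group X Y" and v: "v \<in> tensor_group X Y"
  shows "u - v \<in> tensor_group X Y"
proof -
  have "- v \<in> tensor_group X Y"
    using v
  proof induction
    case zero show ?case by (simp add: tensor_group.zero)
  next
    case (add a y v)
    have "tensor (- a) y = - tensor a y"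
      by (simp add: tensor_def frag_extend_minus)
    then show ?case
      using tensor_group.add[OF X[OF add(1)] add(2,4)] by simp
  qed
  then show ?thesis using tensor_group_add[OF u] by fastforce
qed

lemma aug_ideal_minus: "a \<in> aug_ideal \<Longrightarrow> - a \<in> aug_ideal"
  by (simp add: aug_ideal_def additive_minus_frag(2)[OF aug_add])

lemma tensor_group_projection:
  fixes p :: "('g \<Rightarrow>\<^sub>0 int) \<Rightarrow> ('g \<Rightarrow>\<^sub>0 int)" and \<rho> :: "('g list \<Rightarrow>\<^sub>0 int) \<Rightarrow> ('g list \<Rightarrow>\<^sub>0 int)"
  assumes p: "\<And>a b. p (a + b) = p a + p b" "\<And>a. p a \<in> X" "\<And>a. a \<in> X \<Longrightarrow> p a = a"
    and r: "\<And>x y. \<rho> (x + y) = \<rho> x + \<rho> y" "\<And>x. \<rho> x \<in> Y" "\<And>x. x \<in> Y \<Longrightarrow> \<rho> x = x"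
    and X: "\<And>a. a \<in> X \<Longrightarrow> - a \<in> X"
  obtains q :: "('g list \<Rightarrow>\<^sub>0 int) \<Rightarrow> ('g list \<Rightarrow>\<^sub>0 int)"
  where "\<And>x y. q (x + y) = q x + q y" "\<And>x. q x \<in> tensor_group X Y"
    "\<And>x. x \<in> tensor_group X Y \<Longrightarrow> q x = x"
proof
  let ?q = "frag_extend (\<lambda>w. case w of [] \<Rightarrow> 0 | g # w' \<Rightarrow> tensor (p (frag_of g)) (\<rho> (frag_of w')))"
  show q: "?q (x + y) = ?q x + ?q y" for x y
    by (simp add: frag_extend_add)
  have qt: "?q (tensor a y) = tensor (p a) (\<rho> y)" for a y
    by (rule biadditive_frag_eq[of "\<lambda>a y. ?q (tensor a y)" "\<lambda>a y. tensor (p a) (\<rho> y)"])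
       (simp_all only: tensor_add_left tensor_add_right q p r, simp add: tensor_def)
  show "?q x \<in> tensor_group X Y" for x
  proof (induction x rule: frag_induction[OF subset_UNIV])
    case 1 show ?case by (simp add: tensor_group.zero)
  next
    case (2 w) show ?case
      by (cases w) (auto simp: tensor_group.zero intro: tensor_in_group p r)
  next
    case (3 x y)
    then show ?case
      unfolding additive_minus_frag(3)[of ?q, OF q] by (intro tensor_group_diff X)
  qed
  show "?q x = x" if "x \<in> tensor_group X Y" for x
    using that
  proof induction
    case (add a y u)
    then show ?case unfolding q qt by (simp add: p r)
  qed simp
qed

lemma I_power_projection:
  obtains \<rho> :: "('g list \<Rightarrow>\<^sub>0 int) \<Rightarrow> ('g list \<Rightarrow>\<^sub>0 int)"
  where "\<And>x y. \<rho> (x + y) = \<rho> x + \<rho> y" "\<And>x. \<rho> x \<in> I_power s" "\<And>x. x \<in> I_power s \<Longrightarrow> \<rho> x = x"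
proof -
  have "\<exists>\<rho> :: ('g list \<Rightarrow>\<^sub>0 int) \<Rightarrow> ('g list \<Rightarrow>\<^sub>0 int).
    (\<forall>x y. \<rho> (x + y) = \<rho> x + \<rho> y) \<and> (\<forall>x. \<rho> x \<in> I_power s) \<and> (\<forall>x\<in>I_power s. \<rho> x = x)"
  proof (induction s)
    case 0
    show ?case
    proof (rule exI[of _ "\<lambda>x. frag_cmul (Poly_Mapping.lookup x []) (frag_of [])"], intro conjI allI ballI)
      fix x :: "'g list \<Rightarrow>\<^sub>0 int" assume "x \<in> I_power 0"
      then show "frag_cmul (Poly_Mapping.lookup x []) (frag_of []) = x"
        by (intro poly_mapping_eqI) (auto simp: lookup_single when_def in_keys_iff)
    qed (auto simp: lookup_add frag_cmul_distrib)
  next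
    case (Suc s)
    then obtain \<rho> :: "('g list \<Rightarrow>\<^sub>0 int) \<Rightarrow> ('g list \<Rightarrow>\<^sub>0 int)" where
      r: "\<And>x y. \<rho> (x + y) = \<rho> x + \<rho> y" "\<And>x. \<rho> x \<in> I_power s" "\<And>x. x \<in> I_power s \<Longrightarrow> \<rho> x = x"
      by blast
    obtain p :: "('g \<Rightarrow>\<^sub>0 int) \<Rightarrow> ('g \<Rightarrow>\<^sub>0 int)" where
      p: "\<And>a b. p (a + b) = p a + p b" "\<And>a. p a \<in> aug_ideal" "\<And>a. a \<in> aug_ideal \<Longrightarrow> p a = a"
      using aug_ideal_projection by blast
    obtain q :: "('g list \<Rightarrow>\<^sub>0 int) \<Rightarrow> ('g list \<Rightarrow>\<^sub>0 int)" where
      "\<And>x y. q (x + y) = q x + q y" "\<And>x. q x \<in> tensor_group aug_ideal (I_power s)"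
      "\<And>x. x \<in> tensor_group aug_ideal (I_power s) \<Longrightarrow> q x = x"
      using tensor_group_projection[of p aug_ideal \<rho> "I_power s", OF p r aug_ideal_minus] by blast
    then show ?case by (intro exI[of _ q]) simp
  qed
  then show ?thesis using that by blast
qed

lemma ZI_power_projection:
  obtains q :: "('g list \<Rightarrow>\<^sub>0 int) \<Rightarrow> ('g list \<Rightarrow>\<^sub>0 int)"
  where "\<And>x y. q (x + y) = q x + q y" "\<And>x. q x \<in> tensor_group UNIV (I_power s)"
    "\<And>x. x \<in> tensor_group UNIV (I_power s) \<Longrightarrow> q x = x"
proof -
  obtain \<rho> :: "('g list \<Rightarrow>\<^sub>0 int) \<Rightarrow> ('g list \<Rightarrow>\<^sub>0 int)" where
    r: "\<And>x y. \<rho> (x + y) = \<rho> x + \<rho> y" "\<And>x. \<rho> x \<in> I_power s" "\<And>x. x \<in> I_power s \<Longrightarrow> \<rho> x = x"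
    using I_power_projection by blast
  show ?thesis
    by (rule tensor_group_projection[of "\<lambda>a. a" UNIV \<rho> "I_power s", OF refl UNIV_I refl r UNIV_I])
       (assumption, rule that)
qed

text \<open>
  The universal property of the tensor products used here: every biadditive map on
  \<open>Z[\<pi>] \<times> I^s\<close> or on \<open>I \<times> I^s\<close> factors uniquely through the pure tensors.
\<close>

theorem tensor_group_universal:
  fixes \<beta> :: "('g \<Rightarrow>\<^sub>0 int) \<Rightarrow> ('g list \<Rightarrow>\<^sub>0 int) \<Rightarrow> 'b::ab_group_add"
  assumes X: "X = UNIV \<or> X = aug_ideal"
    and left: "\<And>a b y. a \<in> X \<Longrightarrow> b \<in> X \<Longrightarrow> y \<in> I_power s \<Longrightarrow> \<beta> (a + b) y = \<beta> a y + \<beta> b y"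
    and right: "\<And>a y z. a \<in> X \<Longrightarrow> y \<in> I_power s \<Longrightarrow> z \<in> I_power s \<Longrightarrow> \<beta> a (y + z) = \<beta> a y + \<beta> a z"
  shows "\<exists>!f. (\<forall>u\<in>tensor_group X (I_power s). \<forall>v\<in>tensor_group X (I_power s). f (u + v) = f u + f v) \<and>
              (\<forall>u. u \<notin> tensor_group X (I_power s) \<longrightarrow> f u = 0) \<and>
              (\<forall>a\<in>X. \<forall>y\<in>I_power s. f (tensor a y) = \<beta> a y)"
    (is "\<exists>!f. ?P f")
proof -
  let ?T = "tensor_group X (I_power s)"
  obtain p :: "('g \<Rightarrow>\<^sub>0 int) \<Rightarrow> ('g \<Rightarrow>\<^sub>0 int)" where
    p: "\<And>a b. p (a + b) = p a + p b" "\<And>a. p a \<in> X" "\<And>a. a \<in> X \<Longrightarrow> p a = a"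
  proof (cases "X = UNIV")
    case True
    then show ?thesis using that[of id] by simp
  next
    case False
    with X have "X = aug_ideal" by simp
    then show ?thesis using that aug_ideal_projection by blast
  qed
  obtain \<rho> :: "('g list \<Rightarrow>\<^sub>0 int) \<Rightarrow> ('g list \<Rightarrow>\<^sub>0 int)" where
    r: "\<And>x y. \<rho> (x + y) = \<rho> x + \<rho> y" "\<And>x. \<rho> x \<in> I_power s" "\<And>x. x \<in> I_power s \<Longrightarrow> \<rho> x = x"
    using I_power_projection by blast
  define F where "F w c = (case w of [] \<Rightarrow> 0 |
      g # w' \<Rightarrow> \<beta> (p (frag_cmul c (frag_of g))) (\<rho> (frag_of w')))" for w c
  have "F w (c + d) = F w c + F w d" for w c d
    by (cases w) (simp_all add: F_def frag_cmul_distrib p r left)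
  then have f: "add_extend F (x + y) = add_extend F x + add_extend F y" for x y
    by (rule add_extend_add)
  have ft: "add_extend F (tensor a y) = \<beta> (p a) (\<rho> y)" for a y
    by (rule biadditive_frag_eq[of "\<lambda>a y. add_extend F (tensor a y)" "\<lambda>a y. \<beta> (p a) (\<rho> y)"])
       (simp_all add: tensor_add_left tensor_add_right f p r left right,
        simp add: tensor_def add_extend_def F_def)
  have tin: "a \<in> X \<Longrightarrow> y \<in> I_power s \<Longrightarrow> tensor a y \<in> ?T" for a y
    by (rule tensor_in_group)
  show ?thesis
  proof (rule ex1I[of _ "restrict0 ?T (add_extend F)"])
    show "?P (restrict0 ?T (add_extend F))"
      by (simp add: restrict0_def tensor_group_add tin f ft p r)
  next
    fix g assume g: "?P g"
    have g0: "g 0 = 0" using g tensor_group.zero[of X "I_power s"] by (metis add_0 add_cancel_left_left)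
    have "g u = add_extend F u" if "u \<in> ?T" for u
      using that
    proof induction
      case zero show ?case using g0 additive_minus_frag(1)[OF f] by simp
    next
      case (add a y u)
      then show ?case using g tin[OF add(1,2)] by (simp add: f ft p r)
    qed
    then show "g = restrict0 ?T (add_extend F)"
      using g by (auto simp: restrict0_def)
  qed
qed



lemma add_extend_add_on:
  assumes F: "\<And>k c d. c \<in> S \<Longrightarrow> d \<in> S \<Longrightarrow> F k (c + d) = F k c + F k d"
    and S: "0 \<in> S" and x: "\<And>k. Poly_Mapping.lookup x k \<in> S" and y: "\<And>k. Poly_Mapping.lookup y k \<in> S"
  shows "add_extend F (x + y) = add_extend F x + (add_extend F y :: 'b::ab_group_add)"
proof -
  have F0: "F k 0 = 0" for k using F[of 0 0 k] S by simp
  have ext: "add_extend F z = (\<Sum>k\<in>K. F k (Poly_Mapping.lookup z k))"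
    if "finite K" "Poly_Mapping.keys z \<subseteq> K" for z K
    unfolding add_extend_def
    by (rule sum.mono_neutral_left) (use that F0 in \<open>auto simp: in_keys_iff\<close>)
  let ?K = "Poly_Mapping.keys x \<union> Poly_Mapping.keys y"
  show ?thesis
    using ext[of ?K x] ext[of ?K y] ext[of ?K "x + y"] Poly_Mapping.keys_add[of x y] x y
    by (simp add: lookup_add F sum.distrib)
qed

lemma add_extend_single:
  "F k 0 = 0 \<Longrightarrow> add_extend F (Poly_Mapping.single k m) = F k m"
  by (cases "m = 0") (simp_all add: add_extend_def)

lemma add_extend_zero [simp]: "add_extend F 0 = 0"
  by (simp add: add_extend_def)

lemma poly_mapping_sum_induct:
  fixes x :: "'k \<Rightarrow>\<^sub>0 'm::comm_monoid_add"
  assumes "P 0" "\<And>k. k \<in> Poly_Mapping.keys x \<Longrightarrow> P (Poly_Mapping.single k (Poly_Mapping.lookup x k))"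
    "\<And>u v. P u \<Longrightarrow> P v \<Longrightarrow> P (u + v)"
  shows "P x"
proof -
  have "P (\<Sum>k\<in>K. Poly_Mapping.single k (Poly_Mapping.lookup x k))" if "finite K" "K \<subseteq> Poly_Mapping.keys x" for K
    using that by (induction K rule: finite_induct) (auto intro: assms)
  moreover have "(\<Sum>k\<in>Poly_Mapping.keys x. Poly_Mapping.single k (Poly_Mapping.lookup x k)) = x"
    by (rule poly_mapping_eqI)
       (auto simp: lookup_sum lookup_single when_def in_keys_iff)
  ultimately show ?thesis by (metis finite_keys order_refl)
qed

lemma bar_induct [consumes 2, case_names zero single add]:
  assumes "x \<in> carr (bar r M)" "left_module M"
    and "P 0"
    and "\<And>\<sigma> m. length \<sigma> = Suc r \<Longrightarrow> m \<in> carr M \<Longrightarrow> P (Poly_Mapping.single \<sigma> m)"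
    and "\<And>u v. u \<in> carr (bar r M) \<Longrightarrow> v \<in> carr (bar r M) \<Longrightarrow> P u \<Longrightarrow> P v \<Longrightarrow> P (u + v)"
  shows "P x"
proof -
  have "x \<in> carr (bar r M) \<and> P x"
    apply (rule poly_mapping_sum_induct[of "\<lambda>x. x \<in> carr (bar r M) \<and> P x"])
    using assms
    by (auto simp: bar_def left_module_def lookup_add lookup_single when_def  dest: set_mp[OF keys_add] split: if_splits)
  then show ?thesis by simp
qed

lemma left_moduleD: assumes "left_module M"
  shows "0 \<in> carr M" "x \<in> carr M \<Longrightarrow> y \<in> carr M \<Longrightarrow> x + y \<in> carr M" "x \<in> carr M \<Longrightarrow> - x \<in> carr M"
    "x \<in> carr M \<Longrightarrow> smul M c x \<in> carr M"
    "x \<in> carr M \<Longrightarrow> y \<in> carr M \<Longrightarrow> smul M c (x + y) = smul M c x + smul M c y"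
    "x \<in> carr M \<Longrightarrow> smul M (c + d) x = smul M c x + smul M d x"
    "x \<in> carr M \<Longrightarrow> smul M (c * d) x = smul M c (smul M d x)"
    "x \<in> carr M \<Longrightarrow> smul M 1 x = x" "smul M c 0 = 0" "x \<in> carr M \<Longrightarrow> smul M 0 x = 0"
  using assms unfolding left_module_def apply auto
  apply (metis add_cancel_right_right)
  by (metis add_cancel_right_right)

lemma bar_carr_add: "left_module M \<Longrightarrow> x \<in> carr (bar r M) \<Longrightarrow> y \<in> carr (bar r M) \<Longrightarrow> x + y \<in> carr (bar r M)"
  by (auto simp: bar_def lookup_add left_moduleD dest: set_mp[OF keys_add])

lemma bar_carr_0: "left_module M \<Longrightarrow> 0 \<in> carr (bar r M)"
  by (auto simp: bar_def left_moduleD)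

lemma bar_carr_single: "left_module M \<Longrightarrow> m \<in> carr M \<Longrightarrow> length \<sigma> = Suc r \<Longrightarrow> Poly_Mapping.single \<sigma> m \<in> carr (bar r M)"
  by (auto simp: bar_def left_moduleD lookup_single when_def split: if_splits)

lemma bar_smul_add: "left_module M \<Longrightarrow> x \<in> carr (bar r M) \<Longrightarrow> y \<in> carr (bar r M) \<Longrightarrow>
  smul (bar r M) c (x + y) = smul (bar r M) c x + smul (bar r M) c y"
  unfolding bar_def
  apply simp
  apply (rule add_extend_add_on[of "carr M"])
  by (auto simp: left_moduleD add_extend_def single_add sum.distrib)

lemma bar_smul_single: assumes M: "left_module M" and m: "m \<in> carr M"
  shows "smul (bar r M) (Poly_Mapping.single h k) (Poly_Mapping.single \<sigma> m) =
    Poly_Mapping.single (map ((+) h) \<sigma>) (smul M (Poly_Mapping.single h k) m)"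
  unfolding bar_def using left_moduleD[OF M] m
  by (simp add: add_extend_single add_extend_def)

lemma bar_smul_ladd: assumes M: "left_module M" and x: "x \<in> carr (bar r M)"
  shows "smul (bar r M) (c + d) x = smul (bar r M) c x + smul (bar r M) d x"
  using x M
proof (induction rule: bar_induct)
  case zero show ?case by (simp add: bar_def)
next
  case (single \<sigma> m)
  have *: "smul (bar r M) c (Poly_Mapping.single \<sigma> m) = add_extend (\<lambda>h k.
                Poly_Mapping.single (map ((+) h) \<sigma>) (smul M (Poly_Mapping.single h k) m)) c" for c
    by (simp add: bar_def add_extend_single add_extend_def left_moduleD M)
  show ?case unfolding *
    by (rule add_extend_add) (simp add: single_add left_moduleD M single)
next
  case (add u v) then show ?case by (simp add: bar_smul_add M)
qed

lemma bar_smul_0: "left_module M \<Longrightarrow> x \<in> carr (bar r M) \<Longrightarrow> smul (bar r M) 0 x = 0"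
  using bar_smul_ladd[of M x r 0 0] by simp

lemma bar_smul_zero: "smul (bar r M) c 0 = 0" by (simp add: bar_def)

lemma bar_smul_carr: assumes M: "left_module M" and x: "x \<in> carr (bar r M)"
  shows "smul (bar r M) c x \<in> carr (bar r M)"
proof (induction c rule: poly_mapping_sum_induct)
  case 1 then show ?case using bar_smul_0[OF M x] bar_carr_0[OF M] by simp
next
  case (2 h)
  show ?case using x M
  proof (induction rule: bar_induct)
    case zero show ?case by (simp add: bar_smul_zero bar_carr_0 M)
  qed (simp_all add: bar_smul_single bar_carr_single M left_moduleD bar_smul_add bar_carr_add)
next
  case (3 u v) then show ?case using bar_smul_ladd[OF M x] bar_carr_add[OF M] by simp
qed


lemma bar_smul_mult: assumes M: "left_module M" and x: "x \<in> carr (bar r M)"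
  shows "smul (bar r M) (c * d) x = smul (bar r M) c (smul (bar r M) d x)"
proof (induction c rule: poly_mapping_sum_induct)
  case 1 then show ?case using bar_smul_0[OF M x] bar_smul_0[OF M bar_smul_carr[OF M x]] by simp
next
  case (2 h)
  show ?case
  proof (induction d rule: poly_mapping_sum_induct)
    case 1 then show ?case using bar_smul_0[OF M x] by (simp add: bar_smul_zero)
  next
    case (2 h')
    show ?case using x M
    proof (induction rule: bar_induct)
      case zero show ?case by (simp add: bar_smul_zero)
    next
      case (single \<sigma> m)
      have "map ((+) (h + h')) \<sigma> = map ((+) h \<circ> (+) h') \<sigma>" by (simp add: add.assoc)
      note e = this
      show ?case using single
        by (simp add: mult_single bar_smul_single M left_moduleD e flip: left_moduleD(7))
    qed (simp_all add: bar_smul_add bar_smul_carr M)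
  next
    case (3 u v) then show ?case
      using bar_smul_ladd[OF M x] bar_smul_add[OF M bar_smul_carr[OF M x] bar_smul_carr[OF M x]]
      by (simp add: distrib_left)
  qed
next
  case (3 u v) then show ?case using bar_smul_ladd[OF M] x bar_smul_carr[OF M] by (simp add: distrib_right)
qed

lemma bar_left_module: assumes M: "left_module M" shows "left_module (bar r M)"
proof -
  have "smul (bar r M) 1 x = x" if x: "x \<in> carr (bar r M)" for x
    using x M
  proof (induction rule: bar_induct)
    case (single \<sigma> m)
    have "map ((+) 0) \<sigma> = \<sigma>" by (simp add: map_idI)
    then show ?case using single bar_smul_single[OF M single(2), of r 0 1 \<sigma>] left_moduleD(8)[OF M single(2)] by simp
  qed (simp_all add: bar_smul_zero bar_smul_add M)
  moreover have "- x \<in> carr (bar r M)" if "x \<in> carr (bar r M)" for x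
    using that by (auto simp: bar_def left_moduleD M in_keys_iff)
  ultimately show ?thesis
    unfolding left_module_def using bar_smul_carr[OF M] bar_smul_mult[OF M] bar_smul_ladd[OF M]
      bar_smul_add[OF M] bar_carr_add[OF M] bar_carr_0[OF M] by auto
qed

lemma boundary_add: "boundary (x + y) = boundary x + boundary y"
  unfolding boundary_def
  by (rule add_extend_add) (auto simp flip: sum.distrib single_add intro!: sum.cong)

lemma boundary_single: "boundary (Poly_Mapping.single \<sigma> m) =
   (\<Sum>i<length \<sigma>. Poly_Mapping.single (face i \<sigma>) (if even i then m else - m))"
  unfolding boundary_def by (rule add_extend_single) (auto intro!: sum.neutral)

lemma boundary_hom: assumes M: "left_module M"
  shows "restrict0 (carr (bar (Suc r) M)) boundary \<in> lhom (bar (Suc r) M) (bar r M)"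
proof -
  have c: "boundary x \<in> carr (bar r M)" if x: "x \<in> carr (bar (Suc r) M)" for x
    using x M
  proof (induction rule: bar_induct)
    case zero show ?case by (simp add: boundary_def bar_carr_0 M)
  next
    case (single \<sigma> m)
    have "(\<Sum>i\<in>K. Poly_Mapping.single (face i \<sigma>) (if even i then m else - m)) \<in> carr (bar r M)"
      if "finite K" "K \<subseteq> {..<length \<sigma>}" for K
      using that
    proof (induction K rule: finite_induct)
      case (insert i K) then show ?case using single
        by (auto intro!: bar_carr_add[OF M] bar_carr_single[OF M] left_moduleD[OF M] simp: face_def)
    qed (simp add: bar_carr_0 M)
    then show ?case by (simp add: boundary_single)
  qed (simp add: boundary_add bar_carr_add M)
  have s: "boundary (smul (bar (Suc r) M) c x) = smul (bar r M) c (boundary x)" if x: "x \<in> carr (bar (Suc r) M)" for x c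
  proof (induction c rule: poly_mapping_sum_induct)
    case 1 then show ?case using bar_smul_0 M x c by (metis boundary_add add_cancel_right_right)
  next
    case (2 h)
    show ?case using x M
    proof (induction rule: bar_induct)
      case zero show ?case by (simp add: bar_smul_zero boundary_def)
    next
      case (single \<sigma> m)
      have neg: "smul M c (- m) = - smul M c m" for c
        using left_moduleD(5)[OF M single(2) left_moduleD(3)[OF M single(2)], of c] left_moduleD(9)[OF M]
        by (simp add: eq_neg_iff_add_eq_0 add.commute)
      have "smul (bar r M) (Poly_Mapping.single h (Poly_Mapping.lookup c h)) (\<Sum>i\<in>K. Poly_Mapping.single (face i \<sigma>) (if even i then m else - m)) = (\<Sum>i\<in>K. Poly_Mapping.single (map ((+) h) (face i \<sigma>)) (smul M (Poly_Mapping.single h (Poly_Mapping.lookup c h)) (if even i then m else - m)))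
          \<and> (\<Sum>i\<in>K. Poly_Mapping.single (face i \<sigma>) (if even i then m else - m)) \<in> carr (bar r M)"
      if "finite K" "K \<subseteq> {..<length \<sigma>}" for K
      using that
    proof (induction K rule: finite_induct)
      case (insert i K)
      have "Poly_Mapping.single (face i \<sigma>) (if even i then m else - m) \<in> carr (bar r M)"
        using insert single by (auto intro!: bar_carr_single M left_moduleD simp: face_def)
      then show ?case using single insert left_moduleD[OF M]
        by (auto simp: bar_smul_add[OF M] bar_carr_add[OF M] bar_smul_single[OF M])
    qed (simp add: bar_carr_0 M bar_smul_zero)
      note * = this[of "{..<length \<sigma>}", simplified]
      have "smul (bar r M) (Poly_Mapping.single h (Poly_Mapping.lookup c h)) (boundary (Poly_Mapping.single \<sigma> m)) =
        boundary (smul (bar (Suc r) M) (Poly_Mapping.single h (Poly_Mapping.lookup c h)) (Poly_Mapping.single \<sigma> m))"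
        unfolding bar_smul_single[OF M single(2)] boundary_single *[THEN conjunct1] length_map
        by (rule sum.cong) (auto simp: face_def take_map drop_map neg)
      then show ?case by simp
    qed (simp_all add: bar_smul_add bar_smul_carr boundary_add c M)
  next
    case (3 u v) then show ?case by (simp add: bar_smul_ladd M x c boundary_add)
  qed
  show ?thesis
    using c s bar_left_module[OF M, of "Suc r"] unfolding lhom_def restrict0_def left_module_def by (auto simp: boundary_add)
qed


lemma face_face: "i \<le> j \<Longrightarrow> face j (face i \<sigma>) = face i (face (Suc j) \<sigma>)"
proof (induction \<sigma> arbitrary: i j)
  case (Cons x \<sigma>) then show ?case
    by (cases i; cases j) (auto simp: face_def)
qed (simp add: face_def)

lemma boundary_zero: "boundary 0 = 0" by (simp add: boundary_def)

lemma boundary_sum: "finite K \<Longrightarrow> boundary (\<Sum>i\<in>K. f i) = (\<Sum>i\<in>K. boundary (f i))"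
  by (induction K rule: finite_induct) (auto simp: boundary_add boundary_zero)

lemma boundary_boundary: "boundary (boundary x) = 0"
proof (induction x rule: poly_mapping_sum_induct)
  case (2 \<sigma>)
  let ?m = "Poly_Mapping.lookup x \<sigma>"
  let ?n = "length \<sigma>"
  define t where "t = (\<lambda>(i, j). Poly_Mapping.single (face j (face i \<sigma>)) (if even (i + j) then ?m else - ?m))"
  have "boundary (boundary (Poly_Mapping.single \<sigma> ?m)) = (\<Sum>i<?n. \<Sum>j<?n - 1. t (i, j))"
    by (auto simp: boundary_single boundary_sum t_def face_def intro!: sum.cong)
  also have "\<dots> = sum t ({..<?n} \<times> {..<?n - 1})"
    by (simp add: sum.cartesian_product)
  also have "{..<?n} \<times> {..<?n - 1} = {(i, j). j < i \<and> i < ?n} \<union> {(i, j). i \<le> j \<and> j < ?n - 1}"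
    by auto
  also have "sum t \<dots> = sum t {(i, j). j < i \<and> i < ?n} + sum t {(i, j). i \<le> j \<and> j < ?n - 1}"
    by (rule sum.union_disjoint)
       (auto intro: finite_subset[of _ "{..<?n} \<times> {..<?n}"])
  also have "sum t {(i, j). i \<le> j \<and> j < ?n - 1} = sum (\<lambda>p. - t p) {(i, j). j < i \<and> i < ?n}"
    by (rule sum.reindex_bij_witness[of _ "\<lambda>(i, j). (j, i - 1)" "\<lambda>(i, j). (Suc j, i)"])
       (auto simp: t_def face_face single_uminus)
  finally show ?case by (simp add: sum_negf)
qed (simp_all add: boundary_zero boundary_add)

definition aug_bar :: "('h list \<Rightarrow>\<^sub>0 'm::ab_group_add) \<Rightarrow> 'm" where
  "aug_bar = add_extend (\<lambda>\<sigma> m. m)"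

definition contr :: "('h::zero list \<Rightarrow>\<^sub>0 'm::ab_group_add) \<Rightarrow> ('h list \<Rightarrow>\<^sub>0 'm)" where
  "contr = add_extend (\<lambda>\<sigma> m. Poly_Mapping.single (0 # \<sigma>) m)"

lemma contr_add: "contr (x + y) = contr x + contr y"
  unfolding contr_def by (rule add_extend_add) (simp add: single_add)

lemma contr_single: "contr (Poly_Mapping.single \<sigma> m) = Poly_Mapping.single (0 # \<sigma>) m"
  unfolding contr_def by (rule add_extend_single) simp

lemma contr_sum: "finite K \<Longrightarrow> contr (\<Sum>i\<in>K. f i) = (\<Sum>i\<in>K. contr (f i))"
  by (induction K rule: finite_induct) (auto simp: contr_add, simp add: contr_def)

lemma boundary_contr: "boundary (contr x) = x - contr (boundary x)"
proof (induction x rule: poly_mapping_sum_induct)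
  case 1 show ?case by (simp add: contr_def boundary_def)
next
  case (2 \<sigma>)
  show ?case
    by (simp add: contr_single boundary_single contr_sum sum.lessThan_Suc_shift del: sum.lessThan_Suc)
       (auto simp: face_def sum_negf[symmetric] single_uminus intro!: sum.cong)
qed (simp add: contr_add boundary_add)

lemma bar_exact:
  assumes M: "left_module M" and x: "x \<in> carr (bar (Suc r) M)" and z: "boundary x = 0"
  shows "\<exists>y\<in>carr (bar (Suc (Suc r)) M). boundary y = x"
proof (rule bexI[of _ "contr x"])
  show "boundary (contr x) = x" using boundary_contr[of x] z by (simp add: contr_def)
  show "contr x \<in> carr (bar (Suc (Suc r)) M)" using x M
    by (induction rule: bar_induct) (simp add: contr_def bar_carr_0 M, simp_all add: contr_single contr_add bar_carr_add bar_carr_single M)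
qed

lemma aug_bar_add: "aug_bar (x + y) = aug_bar x + aug_bar y"
  unfolding aug_bar_def by (rule add_extend_add) simp

lemma aug_bar_single: "aug_bar (Poly_Mapping.single \<sigma> m) = m"
  unfolding aug_bar_def by (rule add_extend_single) simp

lemma aug_bar_hom:
  fixes M :: "('h::group_add \<Rightarrow>\<^sub>0 int, 'm::ab_group_add) lmod"
  assumes M: "left_module M"
  shows "restrict0 (carr (bar 0 M)) aug_bar \<in> lhom (bar 0 M) M"
    and "aug_bar ` carr (bar 0 M) = carr M"
    and "\<And>x. x \<in> carr (bar 1 M) \<Longrightarrow> aug_bar (boundary x) = 0"
proof -
  have z: "aug_bar 0 = (0 :: 'm)" by (simp add: aug_bar_def)
  have c: "aug_bar x \<in> carr M" if "x \<in> carr (bar 0 M)" for x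
    using that M by (induction rule: bar_induct) (simp_all add: z aug_bar_single aug_bar_add left_moduleD M)
  have s: "aug_bar (smul (bar 0 M) a x) = smul M a (aug_bar x)" if x: "x \<in> carr (bar 0 M)" for a x
  proof (induction a rule: poly_mapping_sum_induct)
    case 1 then show ?case using bar_smul_0[OF M x] by (simp add: z left_moduleD M c x)
  next
    case (2 h)
    show ?case using x M
      by (induction rule: bar_induct)
         (simp_all add: z bar_smul_zero aug_bar_single aug_bar_add left_moduleD M bar_smul_single bar_smul_add c)
  next
    case (3 u v) then show ?case by (simp add: bar_smul_ladd M x aug_bar_add left_moduleD c)
  qed
  show "restrict0 (carr (bar 0 M)) aug_bar \<in> lhom (bar 0 M) M"
    by (auto simp: lhom_def restrict0_def c s aug_bar_add bar_carr_add M bar_smul_carr)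
  show "aug_bar ` carr (bar 0 M) = carr M"
  proof (intro equalityI subsetI)
    fix m assume "m \<in> carr M"
    then show "m \<in> aug_bar ` carr (bar 0 M)"
      by (intro image_eqI[of _ _ "Poly_Mapping.single [0] m"]) (simp_all add: aug_bar_single bar_carr_single M)
  qed (use c in auto)
  show "aug_bar (boundary x) = 0" if "x \<in> carr (bar 1 M)" for x
    using that M
    by (induction rule: bar_induct)
       (simp_all add: z boundary_zero boundary_add aug_bar_add boundary_single numeral_2_eq_2 aug_bar_single)
qed

lemma bar_exact_0:
  assumes M: "left_module M" and x: "x \<in> carr (bar 0 M)" and z: "aug_bar x = 0"
  shows "\<exists>y\<in>carr (bar 1 M). boundary y = x"
proof (rule bexI[of _ "contr x"])
  have "boundary (contr x) = x - Poly_Mapping.single [0] (aug_bar x)" using x M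
  proof (induction rule: bar_induct)
    case zero show ?case by (simp add: contr_def boundary_def aug_bar_def)
  next
    case (single \<sigma> m) 
    then obtain g where "\<sigma> = [g]" by (metis length_0_conv length_Suc_conv)
    then show ?case by (simp add: contr_single boundary_single face_def aug_bar_def add_extend_single single_uminus)
  qed (simp add: contr_add boundary_add aug_bar_add single_add)
  then show "boundary (contr x) = x" using z by simp
  show "contr x \<in> carr (bar 1 M)" using x M
    by (induction rule: bar_induct) (simp add: contr_def bar_carr_0 M, simp_all add: contr_single contr_add bar_carr_add bar_carr_single M)
qed


lemma sum_induct_carr: "left_module N \<Longrightarrow> (\<And>i. i \<in> K \<Longrightarrow> g i \<in> carr N) \<Longrightarrow> sum g K \<in> carr N"
  by (induction K rule: infinite_finite_induct) (auto simp: left_moduleD)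

lemma smul_minus: assumes M: "left_module M" and x: "x \<in> carr M" shows "smul M c (- x) = - smul M c x"
  using left_moduleD(5)[OF M x left_moduleD(3)[OF M x], of c] left_moduleD(9)[OF M]
  by (simp add: eq_neg_iff_add_eq_0 add.commute)

lemma int_smul_additive:
  fixes M :: "('h::group_add \<Rightarrow>\<^sub>0 int, 'm::ab_group_add) lmod" and N :: "('k::group_add \<Rightarrow>\<^sub>0 int, 'n::ab_group_add) lmod"
  assumes M: "left_module M" and N: "left_module N" and m: "m \<in> carr M"
    and f: "\<And>x y. x \<in> carr M \<Longrightarrow> y \<in> carr M \<Longrightarrow> f (x + y) = f x + f y" and fN: "\<And>x. x \<in> carr M \<Longrightarrow> f x \<in> carr N"
  shows "f (smul M (Poly_Mapping.single 0 k) m) = smul N (Poly_Mapping.single 0 k) (f m)"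
proof -
  have f0: "f 0 = 0" using f[OF left_moduleD(1)[OF M] left_moduleD(1)[OF M]] by simp
  have 1: "smul M (Poly_Mapping.single 0 (k + 1)) m = smul M (Poly_Mapping.single 0 k) m + m" for k
    by (simp add: single_add left_moduleD M m)
  have 2: "smul N (Poly_Mapping.single 0 (k + 1)) (f m) = smul N (Poly_Mapping.single 0 k) (f m) + f m" for k
    by (simp add: single_add left_moduleD N fN m)
  show ?thesis
  proof (induction k rule: int_induct[of _ 0])
    case base then show ?case by (simp add: left_moduleD M N m fN f0)
  next
    case (step1 i) then show ?case by (simp only: 1 2) (simp add: f left_moduleD M m)
  next
    case (step2 i)
    have "f (smul M (Poly_Mapping.single 0 i) m) = f (smul M (Poly_Mapping.single 0 (i - 1)) m) + f m"
      using 1[of "i - 1"] by (simp add: f left_moduleD M m)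
    moreover have "smul N (Poly_Mapping.single 0 i) (f m) = smul N (Poly_Mapping.single 0 (i - 1)) (f m) + f m"
      using 2[of "i - 1"] by simp
    ultimately show ?case using step2 by simp
  qed
qed

lemma bar_projective:
  fixes M :: "('h::group_add \<Rightarrow>\<^sub>0 int, 'x \<Rightarrow>\<^sub>0 int) lmod"
    and N :: "('h \<Rightarrow>\<^sub>0 int, 'n::ab_group_add) lmod" and N' :: "('h \<Rightarrow>\<^sub>0 int, 'n'::ab_group_add) lmod"
  assumes M: "left_module M"
    and \<rho>: "\<And>x y. \<rho> (x + y) = \<rho> x + \<rho> y" "\<And>x. \<rho> x \<in> carr M" "\<And>x. x \<in> carr M \<Longrightarrow> \<rho> x = x"
    and N: "left_module N" and N': "left_module N'"
    and q: "q \<in> lhom N N'" "q ` carr N = carr N'" and f: "f \<in> lhom (bar r M) N'"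
  shows "\<exists>f'\<in>lhom (bar r M) N. \<forall>x\<in>carr (bar r M). q (f' x) = f x"
proof -
  let ?T = "\<lambda>\<tau>. length \<tau> = Suc r"
  have fN: "f x \<in> carr N'" if "x \<in> carr (bar r M)" for x using f that by (auto simp: lhom_def)
  have fa: "f (x + y) = f x + f y" if "x \<in> carr (bar r M)" "y \<in> carr (bar r M)" for x y using f that by (auto simp: lhom_def)
  have fs: "f (smul (bar r M) c x) = smul N' c (f x)" if "x \<in> carr (bar r M)" for x c using f that by (auto simp: lhom_def)
  have qN: "q x \<in> carr N'" if "x \<in> carr N" for x using q that by (auto simp: lhom_def)
  have qa: "q (x + y) = q x + q y" if "x \<in> carr N" "y \<in> carr N" for x y using q that by (auto simp: lhom_def)
  have qs: "q (smul N c x) = smul N' c (q x)" if "x \<in> carr N" for x c using q that by (auto simp: lhom_def)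
  have q0: "q 0 = 0" using qa[OF left_moduleD(1)[OF N] left_moduleD(1)[OF N]] by simp
  have "\<exists>n\<in>carr N. ?T \<tau> \<longrightarrow> q n = f (Poly_Mapping.single \<tau> (\<rho> (frag_of w)))" for \<tau> w
  proof (cases "?T \<tau>")
    case True
    then have "f (Poly_Mapping.single \<tau> (\<rho> (frag_of w))) \<in> q ` carr N"
      unfolding q(2) by (intro fN bar_carr_single M \<rho>)
    then show ?thesis by auto
  qed (use left_moduleD(1)[OF N] in blast)
  then obtain c where c: "\<And>\<tau> w. c \<tau> w \<in> carr N" "\<And>\<tau> w. ?T \<tau> \<Longrightarrow> q (c \<tau> w) = f (Poly_Mapping.single \<tau> (\<rho> (frag_of w)))"
    by metis
  define u where "u \<tau> = add_extend (\<lambda>w k. smul N (Poly_Mapping.single 0 k) (c \<tau> w))" for \<tau>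
  have ua: "u \<tau> (x + y) = u \<tau> x + u \<tau> y" for \<tau> x y
    unfolding u_def by (rule add_extend_add) (simp add: single_add left_moduleD N c)
  have uof: "u \<tau> (frag_of w) = c \<tau> w" for \<tau> w
    unfolding u_def by (subst add_extend_single) (auto simp: left_moduleD N c)
  have uN: "u \<tau> x \<in> carr N" for \<tau> x
    unfolding u_def add_extend_def
    by (rule sum_induct_carr) (auto simp: left_moduleD N c)
  have uq: "q (u \<tau> m) = f (Poly_Mapping.single \<tau> (\<rho> m))" if t: "?T \<tau>" for \<tau> m
    by (rule additive_frag_eq[of "\<lambda>m. q (u \<tau> m)" "\<lambda>m. f (Poly_Mapping.single \<tau> (\<rho> m))"])
      (auto simp: ua qa uN \<rho> single_add fa bar_carr_single M t uof c)
  define F where "F = (\<lambda>\<sigma> m. smul N (Poly_Mapping.single (hd \<sigma>) 1) (u (map ((+) (- hd \<sigma>)) \<sigma>) (smul M (Poly_Mapping.single (- hd \<sigma>) 1) m)))"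
  define f' where "f' = add_extend F"
  have F: "F \<sigma> (m + m') = F \<sigma> m + F \<sigma> m'" if "m \<in> carr M" "m' \<in> carr M" for \<sigma> m m'
    using that by (simp add: F_def left_moduleD M N ua uN)
  have F0: "F \<sigma> 0 = 0" for \<sigma> using F[OF left_moduleD(1)[OF M] left_moduleD(1)[OF M], of \<sigma>] by simp
  have f'a: "f' (x + y) = f' x + f' y" if "x \<in> carr (bar r M)" "y \<in> carr (bar r M)" for x y
    unfolding f'_def by (rule add_extend_add_on[of "carr M"]) (use that F left_moduleD(1)[OF M] in \<open>auto simp: bar_def\<close>)
  have f'1: "f' (Poly_Mapping.single \<sigma> m) = F \<sigma> m" for \<sigma> m
    unfolding f'_def by (rule add_extend_single) (rule F0)
  have f'0: "f' 0 = 0" by (simp add: f'_def)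
  have FN: "F \<sigma> m \<in> carr N" for \<sigma> m by (simp add: F_def left_moduleD N uN)
  have f'N: "f' x \<in> carr N" for x
    unfolding f'_def add_extend_def by (rule sum_induct_carr) (auto simp: left_moduleD N FN)
  have f'q: "q (f' x) = f x" if x: "x \<in> carr (bar r M)" for x
    using x M
  proof (induction rule: bar_induct)
    case zero show ?case using fa[OF bar_carr_0 bar_carr_0, OF M M] by (simp add: f'0 q0)
  next
    case (single \<sigma> m)
    have "f (Poly_Mapping.single \<sigma> m) = f (smul (bar r M) (Poly_Mapping.single (hd \<sigma>) 1)
       (Poly_Mapping.single (map ((+) (- hd \<sigma>)) \<sigma>) (smul M (Poly_Mapping.single (- hd \<sigma>) 1) m)))"
      by (simp add: bar_smul_single M single left_moduleD comp_def mult_single flip: left_moduleD(7) add.assoc)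
    then show ?case
      by (simp add: f'1 F_def qs uN uq single \<rho> left_moduleD M fs bar_carr_single)
  qed (simp add: f'a qa f'N fa)
  have f's: "f' (smul (bar r M) c x) = smul N c (f' x)" if x: "x \<in> carr (bar r M)" for x c
  proof (induction c rule: poly_mapping_sum_induct)
    case 1 then show ?case using bar_smul_0[OF M x] by (simp add: f'0 left_moduleD N f'N)
  next
    case (2 h)
    let ?k = "Poly_Mapping.lookup c h"
    show ?case using x M
    proof (induction rule: bar_induct)
      case zero show ?case by (simp add: bar_smul_zero f'0 left_moduleD N)
    next
      case (single \<sigma> m)
      then have hd: "hd (map ((+) h) \<sigma>) = h + hd \<sigma>" by (cases \<sigma>) auto
      have tau: "map ((+) (- (h + hd \<sigma>))) (map ((+) h) \<sigma>) = map ((+) (- hd \<sigma>)) \<sigma>"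
        by (simp add: comp_def minus_add add.assoc del: add_uminus_conv_diff)
      have "smul M (Poly_Mapping.single (- (h + hd \<sigma>)) 1) (smul M (Poly_Mapping.single h ?k) m) =
        smul M (Poly_Mapping.single 0 ?k) (smul M (Poly_Mapping.single (- hd \<sigma>) 1) m)"
        by (simp add: mult_single M single minus_add add.assoc del: add_uminus_conv_diff flip: left_moduleD(7))
      moreover have "u \<tau> (smul M (Poly_Mapping.single 0 ?k) m') = smul N (Poly_Mapping.single 0 ?k) (u \<tau> m')" if "m' \<in> carr M" for \<tau> m'
        by (rule int_smul_additive[OF M N that ua uN])
      ultimately show ?case
        unfolding bar_smul_single[OF M single(2)] f'1 F_def hd tau
        by (simp add: left_moduleD M single N uN mult_single flip: left_moduleD(7)[OF N])
    qed (simp add: bar_smul_add M bar_smul_carr f'a left_moduleD N f'N)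
  next
    case (3 a b) then show ?case by (simp add: bar_smul_ladd[OF M x] f'a bar_smul_carr M x left_moduleD N f'N)
  qed
  show ?thesis
  proof (rule bexI[of _ "restrict0 (carr (bar r M)) f'"])
    show "restrict0 (carr (bar r M)) f' \<in> lhom (bar r M) N"
      by (auto simp: lhom_def restrict0_def f'N f'a f's bar_carr_add M bar_smul_carr)
  qed (simp add: restrict0_def f'q)
qed


lemma perm_smul_add_left: "perm_smul act (c + d) x = perm_smul act c x + perm_smul act d x"
  by (simp add: perm_smul_def frag_extend_add)

lemma perm_smul_add_right: "perm_smul act c (x + y) = perm_smul act c x + perm_smul act c y"
  by (simp add: perm_smul_def frag_extend_add frag_extend_add_fun)

lemma perm_smul_of: "perm_smul act (frag_of h) x = frag_extend (\<lambda>w. frag_of (act h w)) x"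
  by (simp add: perm_smul_def)

lemma perm_smul_mult:
  fixes act :: "'h::group_add \<Rightarrow> 'x \<Rightarrow> 'x"
  assumes act: "\<And>g h w. act (g + h) w = act g (act h w)"
  shows "perm_smul act (c * d) x = perm_smul act c (perm_smul act d x)"
proof (rule biadditive_frag_eq[of "\<lambda>c d. perm_smul act (c * d) x" "\<lambda>c d. perm_smul act c (perm_smul act d x)"])
  fix g h :: 'h
  show "perm_smul act (frag_of g * frag_of h) x = perm_smul act (frag_of g) (perm_smul act (frag_of h) x)"
    by (rule additive_frag_eq[of "\<lambda>x. perm_smul act (frag_of g * frag_of h) x"])
       (simp_all add: perm_smul_add_right mult_single perm_smul_of act)
qed (simp_all add: distrib_left distrib_right perm_smul_add_left perm_smul_add_right)

lemma perm_smul_one: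
  fixes act :: "'h::group_add \<Rightarrow> 'x \<Rightarrow> 'x"
  assumes "\<And>w. act 0 w = w"
  shows "perm_smul act 1 x = x"
  unfolding single_one[symmetric] perm_smul_of assms
  by (rule additive_frag_eq[of "\<lambda>x. frag_extend frag_of x"]) (simp_all add: frag_extend_add)

lemma perm_module:
  fixes act :: "'h::group_add \<Rightarrow> 'x \<Rightarrow> 'x"
  assumes act: "\<And>g h w. act (g + h) w = act g (act h w)" "\<And>w. act 0 w = w"
    and S: "0 \<in> S" "\<And>x y. x \<in> S \<Longrightarrow> y \<in> S \<Longrightarrow> x - y \<in> S"
    "\<And>g x. x \<in> S \<Longrightarrow> perm_smul act (frag_of g) x \<in> S"
  shows "left_module \<lparr>carr = S, smul = perm_smul act\<rparr>"
proof -
  have "perm_smul act c x \<in> S" if "x \<in> S" for c x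
  proof (induction c rule: frag_induction[OF subset_UNIV])
    case 1 show ?case using S by (simp add: perm_smul_def)
  next
    case (3 a b) then show ?case
      using S(2) additive_minus_frag(3)[of "\<lambda>c. perm_smul act c x", OF perm_smul_add_left] by simp
  qed (use S that in auto)
  moreover have m: "- x \<in> S" if "x \<in> S" for x using S(2)[OF S(1) that] by simp
  moreover have "x + y \<in> S" if "x \<in> S" "y \<in> S" for x y using S(2)[OF that(1) m[OF that(2)]] by simp
  ultimately show ?thesis
    using S by (auto simp: left_module_def perm_smul_add_left perm_smul_add_right perm_smul_mult[of act, OF act(1)] perm_smul_one[of act, OF act(2)])
qed

lemma bact: "bact (g + h) w = bact g (bact h w)" "bact 0 w = w"
  by (simp_all add: bact_def add.assoc diff_conv_add_uminus minus_add del: add_uminus_conv_diff)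

lemma mbact: "map (bact (g + h)) w = map (bact g) (map (bact h) w)" "map (bact 0) w = w"
  by (auto simp: bact intro: map_idI)

lemma aug_diff: "aug (a - b) = aug a - aug b"
  by (simp add: additive_minus_frag(3)[OF aug_add])

lemma aug_perm: "aug (perm_smul act (frag_of g) a) = aug a"
  by (rule additive_frag_eq[of "\<lambda>a. aug (perm_smul act (frag_of g) a)"])
     (simp_all add: perm_smul_add_right aug_add perm_smul_of)

lemma I_module: "left_module I_mod"
  unfolding I_mod_def
  by (rule perm_module) (auto simp: bact aug_ideal_def aug_perm aug_diff, simp add: aug_def)

lemma perm_tensor: "perm_smul (\<lambda>gh. map (bact gh)) (frag_of g) (tensor a y) =
   tensor (perm_smul bact (frag_of g) a) (perm_smul (\<lambda>gh. map (bact gh)) (frag_of g) y)"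
  by (rule biadditive_frag_eq[of "\<lambda>a y. perm_smul (\<lambda>gh. map (bact gh)) (frag_of g) (tensor a y)"
     "\<lambda>a y. tensor (perm_smul bact (frag_of g) a) (perm_smul (\<lambda>gh. map (bact gh)) (frag_of g) y)"])
    (simp_all add: tensor_add_left tensor_add_right perm_smul_add_right, simp add: perm_smul_of tensor_def)

lemma tensor_stable:
  assumes "\<And>a. a \<in> X \<Longrightarrow> perm_smul bact (frag_of g) a \<in> X"
    "\<And>y. y \<in> Y \<Longrightarrow> perm_smul (\<lambda>gh. map (bact gh)) (frag_of g) y \<in> Y"
    "u \<in> tensor_group X Y"
  shows "perm_smul (\<lambda>gh. map (bact gh)) (frag_of g) u \<in> tensor_group X Y"
  using assms(3)
proof induction
  case zero show ?case by (simp add: perm_smul_of tensor_group.zero)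
next
  case (add a y u) then show ?case by (simp add: perm_smul_add_right perm_tensor tensor_group.add assms)
qed

lemma Ipow_stable: "y \<in> I_power s \<Longrightarrow> perm_smul (\<lambda>gh. map (bact gh)) (frag_of g) y \<in> I_power s"
proof (induction s arbitrary: y)
  case 0
  then show ?case using keys_frag_extend[of "\<lambda>w. frag_of (map (bact g) w)" y] by (auto simp: perm_smul_of)
next
  case (Suc s) then show ?case by (auto intro!: tensor_stable simp: aug_ideal_def aug_perm)
qed

lemma Ipow_0: "0 \<in> I_power s" by (cases s) (auto intro: tensor_group.zero)

lemma Ipow_diff: "x \<in> I_power s \<Longrightarrow> y \<in> I_power s \<Longrightarrow> x - y \<in> I_power s"
  by (cases s) (auto intro!: tensor_group_diff aug_ideal_minus dest: set_mp[OF keys_diff])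

lemma Ipow_module: "left_module (Ipow_mod s)"
  unfolding Ipow_mod_def by (rule perm_module) (simp_all only: mbact Ipow_0 Ipow_diff Ipow_stable)

lemma ZIpow_module: "left_module (ZIpow_mod s)"
  unfolding ZIpow_mod_def by (rule perm_module) (auto simp only: mbact intro!: tensor_group.zero tensor_group_diff tensor_stable Ipow_stable)

lemma eps_add: "eps_tensor (x + y) = eps_tensor x + eps_tensor y" by (simp add: eps_tensor_def frag_extend_add)

lemma eps_tensor: "eps_tensor (tensor a y) = frag_cmul (aug a) y"
  by (rule biadditive_frag_eq[of "\<lambda>a y. eps_tensor (tensor a y)" "\<lambda>a y. frag_cmul (aug a) y"])
    (simp_all add: tensor_add_left tensor_add_right eps_add aug_add frag_cmul_distrib frag_cmul_distrib2, simp add: eps_tensor_def tensor_def)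

lemma Ipow_cmul: "y \<in> I_power s \<Longrightarrow> frag_cmul c y \<in> I_power s"
proof (induction s arbitrary: y)
  case 0 then show ?case by (auto)
next
  case (Suc s)
  from Suc.prems have "y \<in> tensor_group aug_ideal (I_power s)" by simp
  then have "frag_cmul c y \<in> tensor_group aug_ideal (I_power s)"
  proof induction
    case zero show ?case by (simp add: tensor_group.zero)
  next
    case (add a z u)
    have "frag_cmul c (tensor a z) = tensor a (frag_cmul c z)"
      by (simp add: tensor_def frag_extend_cmul) (simp add: frag_extend_def frag_cmul_sum mult.left_commute)
    then show ?case using add Suc.IH[OF add(2)] by (simp add: frag_cmul_distrib2 tensor_group.add)
  qed
  then show ?case by simp
qed

text \<open>Exactness of \<open>0 \<rightarrow> I^(s+1) \<rightarrow> Z[\<pi>] \<otimes> I^s \<rightarrow> I^s \<rightarrow> 0\<close>.\<close>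

lemma short_exact_sequence:
  "I_power (Suc s) = {x :: 'a list \<Rightarrow>\<^sub>0 int. x \<in> tensor_group UNIV (I_power s) \<and> eps_tensor x = 0}"
  "eps_tensor ` tensor_group UNIV (I_power s) = (I_power s :: ('a list \<Rightarrow>\<^sub>0 int) set)"
proof -
  have dec: "eps_tensor u \<in> I_power s \<and> u - tensor (frag_of g) (eps_tensor u) \<in> I_power (Suc s)"
    if "u \<in> tensor_group UNIV (I_power s)" for u and g :: 'a
    using that
  proof induction
    case zero show ?case by (simp add: eps_tensor_def tensor_def Ipow_0 tensor_group.zero)
  next
    case (add a y u)
    have 1: "frag_cmul (aug a) y + eps_tensor u \<in> I_power s"
      using add Ipow_cmul[OF add(2), of "aug a"] Ipow_diff[OF _ Ipow_diff[OF Ipow_0]] by fastforce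
    have "tensor (frag_of g) (frag_cmul (aug a) y) = tensor (frag_cmul (aug a) (frag_of g)) y"
      by (simp add: tensor_def frag_extend_cmul)
    moreover have "tensor a y - tensor b y = tensor (a - b) y" for b
      using additive_minus_frag(3)[of "\<lambda>a. tensor a y", OF tensor_add_left] by simp
    ultimately have "tensor a y + u - tensor (frag_of g) (eps_tensor (tensor a y + u)) =
      tensor (a - frag_cmul (aug a) (frag_of g)) y + (u - tensor (frag_of g) (eps_tensor u))"
      by (simp add: eps_add eps_tensor tensor_add_right algebra_simps)
    moreover have "a - frag_cmul (aug a) (frag_of g) \<in> aug_ideal"
      by (simp add: aug_ideal_def aug_diff)
    moreover have "u - tensor (frag_of g) (eps_tensor u) \<in> tensor_group aug_ideal (I_power s)"
      using add by simp
    ultimately have "tensor a y + u - tensor (frag_of g) (eps_tensor (tensor a y + u)) \<in> I_power (Suc s)"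
      by (simp only: I_power.simps tensor_group.add[OF _ add(2)])
    then show ?case using 1 by (simp add: eps_add eps_tensor)
  qed
  have e: "eps_tensor u = 0 \<and> u \<in> tensor_group UNIV (I_power s)" if "u \<in> tensor_group aug_ideal (I_power s)" for u
    using that by induction (auto simp: eps_add eps_tensor aug_ideal_def intro: tensor_group.intros, simp add: eps_tensor_def)
  show "I_power (Suc s) = {x :: 'a list \<Rightarrow>\<^sub>0 int. x \<in> tensor_group UNIV (I_power s) \<and> eps_tensor x = 0}"
  proof (intro equalityI subsetI CollectI conjI)
    fix x :: "'a list \<Rightarrow>\<^sub>0 int"
    assume "x \<in> {x \<in> tensor_group UNIV (I_power s). eps_tensor x = 0}"
    then show "x \<in> I_power (Suc s)"
      using dec[of x undefined] by (simp add: tensor_def)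
  qed (use e in auto)
  show "eps_tensor ` tensor_group UNIV (I_power s) = (I_power s :: ('a list \<Rightarrow>\<^sub>0 int) set)"
  proof
    show "(I_power s :: ('a list \<Rightarrow>\<^sub>0 int) set) \<subseteq> eps_tensor ` tensor_group UNIV (I_power s)"
    proof
      fix y :: "'a list \<Rightarrow>\<^sub>0 int" assume "y \<in> I_power s"
      then show "y \<in> eps_tensor ` tensor_group UNIV (I_power s)"
        by (intro image_eqI[of _ _ "tensor (frag_of undefined) y"]) (auto simp: eps_tensor tensor_in_group)
    qed
  qed (use dec in blast)
qed

text \<open>
  \<open>bar _ M\<close> is thus a projective resolution of \<open>M\<close> for the modules \<open>M\<close> used here: it is exact by
  \<open>bar_exact\<close> and \<open>bar_exact_0\<close>, and it consists of projective modules.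
\<close>

corollary bar_projective_Ipow:
  fixes N :: "(('g::group_add \<times> 'g) \<Rightarrow>\<^sub>0 int, 'n::ab_group_add) lmod"
    and N' :: "(('g \<times> 'g) \<Rightarrow>\<^sub>0 int, 'n'::ab_group_add) lmod"
  assumes M: "M = Ipow_mod s \<or> M = ZIpow_mod s"
    and N: "left_module N" "left_module N'" "q \<in> lhom N N'" "q ` carr N = carr N'" "f \<in> lhom (bar r M) N'"
  shows "\<exists>f'\<in>lhom (bar r M) N. \<forall>x\<in>carr (bar r M). q (f' x) = f x"
proof -
  have "left_module M" using M Ipow_module ZIpow_module by auto
  moreover obtain \<rho> :: "('g list \<Rightarrow>\<^sub>0 int) \<Rightarrow> ('g list \<Rightarrow>\<^sub>0 int)" where
    "\<And>x y. \<rho> (x + y) = \<rho> x + \<rho> y" "\<And>x. \<rho> x \<in> carr M" "\<And>x. x \<in> carr M \<Longrightarrow> \<rho> x = x"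
    using M
  proof
    assume "M = Ipow_mod s"
    then show ?thesis using that I_power_projection[of s thesis] by (auto simp: Ipow_mod_def)
  next
    assume "M = ZIpow_mod s"
    then show ?thesis using that ZI_power_projection[of s thesis] by (auto simp: ZIpow_mod_def)
  qed
  ultimately show ?thesis using bar_projective N by blast
qed

end

theory Submission
  imports Defs
begin

text \<open>
  Write \<open>D_p\<close> for the image of \<open>i_0^p\<close> in degree \<open>(n,0)\<close>; these subgroups decrease with \<open>p\<close>, and
  \<open>D_0\<close> is the whole of \<open>H^n(\<pi> \<times> \<pi>, A)\<close>. Exactness of the \<open>p\<close>-th derived couple at \<open>D\<close> says that the
  kernel of \<open>j_p\<close> on \<open>D_p\<close> is the image of \<open>i_p\<close>, which is \<open>D_(p+1)\<close>. Hence \<open>j_p(\<alpha>)\<close> is defined and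
  vanishes exactly when \<open>\<alpha>\<close> lies in \<open>D_(p+1)\<close>, which gives the assertions about successive obstructions.
  The couple at hand is not exact everywhere, because the groups with \<open>s < 0\<close> are zero.
  The locale \<open>partial_exact_couple\<close> collects a part of exactness that does hold and that is inherited by
  the derived couple (\<open>partial_exact_couple.derived_partial_exact_couple\<close>). It holds initially by the
  long exact sequence of Ext, proved for cochains on the bar resolution in \<open>bar_split_sequence\<close>.

  For the essential classes it remains to identify \<open>D_n\<close>, the image under \<open>i_0^n\<close> of
  \<open>Ext^0(I^n, A) = Hom(I^n, A)\<close>. Put \<open>p(g,h) = g h^-1\<close>. The connecting homomorphisms can be followed on
  explicit cochains: up to sign they carry the class of \<open>\<mu>\<close> through the classes of
  \<open>(x_0, ..., x_r) \<otimes> m \<mapsto> \<mu> ((p x_1 - p x_0) \<otimes> ... \<otimes> (p x_r - p x_(r-1)) \<otimes> m)\<close>.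
  For \<open>r = n\<close> and \<open>m = 1\<close> the argument of \<open>\<mu>\<close> is the Alexander--Whitney formula for the \<open>n\<close>-th cup
  power of the canonical class (\<open>canonical_power_eq\<close>). So \<open>D_n\<close> consists of the classes
  \<open>\<mu>_*(v^n)\<close>, the sign being absorbed by \<open>\<mu>\<close> (\<open>essential_iff_iterated_image\<close>).

  The map \<open>j_0\<close> is induced by the augmentation \<open>Z[\<pi>] \<rightarrow> Z\<close>, and \<open>Z[\<pi>]\<close> is induced from the trivial
  module of the diagonal subgroup. That \<open>j_0(\<alpha>)\<close> and the restriction of \<open>\<alpha>\<close> to the diagonal vanish
  together is therefore a case of Shapiro's lemma; \<open>pullback_eps_coboundary_iff\<close> proves it with an
  explicit homotopy, the prism operator.
\<close>

section \<open>Quotients of groups of disjoint sets\<close>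

lemma subgroup_comm_group:
  assumes "comm_group G" "subgroup H G" shows "comm_group (G\<lparr>carrier := H\<rparr>)"
proof -
  interpret comm_group G by fact
  show ?thesis
    by (rule group.group_comm_groupI[OF subgroup.subgroup_is_group[OF assms(2) is_group]])
       (use subgroup.subset[OF assms(2)] in \<open>auto intro: m_comm\<close>)
qed

lemma (in group_hom) image_eq_iff:
  assumes "x \<in> carrier G" "y \<in> carrier G"
  shows "h x = h y \<longleftrightarrow> h (x \<otimes> inv y) = \<one>\<^bsub>H\<^esub>"
proof -
  have "\<one>\<^bsub>H\<^esub> = h x \<otimes>\<^bsub>H\<^esub> inv\<^bsub>H\<^esub> h y \<longleftrightarrow> h x = h y"
    using assms H.inv_solve_right[of "\<one>\<^bsub>H\<^esub>" "h x" "h y"] by simp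
  then show ?thesis using assms by auto
qed

lemma disjoint_family_Union_inject:
  assumes F: "pairwise disjnt F" "{} \<notin> F" and XY: "X \<subseteq> F" "Y \<subseteq> F" "\<Union>X = \<Union>Y"
  shows "X = Y"
proof -
  have "X \<subseteq> Y" if X: "X \<subseteq> F" and Y: "Y \<subseteq> F" and U: "\<Union>X = \<Union>Y" for X Y
  proof
    fix x assume x: "x \<in> X"
    then have "x \<noteq> {}" using F(2) X by auto
    then obtain a where a: "a \<in> x" by auto
    then obtain y where y: "y \<in> Y" "a \<in> y" using U x by auto
    have "x = y"
    proof (rule ccontr)
      assume "x \<noteq> y"
      then have "disjnt x y" using F(1) x y(1) X Y unfolding pairwise_def by auto
      then show False using a y(2) by (auto simp: disjnt_def)
    qed
    with y show "x \<in> Y" by simp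
  qed
  from this[of X Y] this[of Y X] XY show ?thesis by simp
qed

text \<open>
  Disjointness makes a set of sets recoverable from its union, so \<open>Union\<close> is injective on the
  quotient and transports its group structure. The last two conclusions return the hypotheses, which
  allows the construction to be repeated for all derived couples.
\<close>

lemma union_quotient:
  fixes G :: "'b set monoid"
  assumes G: "comm_group G" and B: "subgroup B G"
    and F: "pairwise disjnt (carrier G)" "{} \<notin> carrier G"
  defines "H \<equiv> image_group Union (G Mod B)" and "q \<equiv> \<lambda>x. \<Union>(B #>\<^bsub>G\<^esub> x)"
  shows "comm_group H" "q \<in> hom G H" "q ` carrier G = carrier H"
    "\<And>x. x \<in> carrier G \<Longrightarrow> q x = \<one>\<^bsub>H\<^esub> \<longleftrightarrow> x \<in> B"
    "pairwise disjnt (carrier H)" "{} \<notin> carrier H"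
proof -
  interpret G: comm_group G by fact
  have N: "B \<lhd> G" using G.normal_iff_subgroup B by simp
  interpret N: normal B G by (rule N)
  have sub: "X \<subseteq> carrier G" "X \<noteq> {}" if "X \<in> carrier (G Mod B)" for X
    using that G.rcosets_part_G[OF B] subgroup.rcosets_non_empty[OF B] by (auto simp: FactGroup_def)
  have inj: "inj_on Union (carrier (G Mod B))"
    using disjoint_family_Union_inject[OF F sub(1) sub(1)] by (rule inj_onI)
  note iso = inj_imp_image_group_iso[OF inj, folded H_def]
  have "comm_group (G Mod B)" by (rule G.abelian_FactGroup[OF B])
  from comm_group.iso_imp_img_comm_group[OF this iso]
  have one: "comm_group (H\<lparr>one := \<Union> \<one>\<^bsub>G Mod B\<^esub>\<rparr>)" .
  then show H: "comm_group H" by (simp add: H_def image_group_def)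
  have hom: "Union \<in> hom (G Mod B) H" using iso by (simp add: iso_def)
  have "Union \<circ> (\<lambda>x. B #>\<^bsub>G\<^esub> x) \<in> hom G H"
    using Group.hom_compose[OF N.r_coset_hom_Mod hom] .
  then show q: "q \<in> hom G H" by (simp add: q_def comp_def)
  show carr: "q ` carrier G = carrier H"
    by (auto simp: q_def H_def image_group_def carrier_FactGroup)
  show "q x = \<one>\<^bsub>H\<^esub> \<longleftrightarrow> x \<in> B" if x: "x \<in> carrier G" for x
  proof -
    have "q x = \<one>\<^bsub>H\<^esub> \<longleftrightarrow> B #>\<^bsub>G\<^esub> x = B"
      using inj_on_eq_iff[OF inj, of "B #>\<^bsub>G\<^esub> x" B] x N.subgroup_in_rcosets[OF G.is_group] G.rcosetsI[OF N.subset x]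
      by (simp add: q_def H_def image_group_def FactGroup_def)
    also have "\<dots> \<longleftrightarrow> x \<in> B"
      using G.coset_join1[OF _ x B] G.coset_join2[OF x B] by blast
    finally show ?thesis .
  qed
  have "disjnt (\<Union>X) (\<Union>Y)" if "X \<in> carrier (G Mod B)" "Y \<in> carrier (G Mod B)" "X \<noteq> Y" for X Y
  proof -
    have "disjnt X Y" using G.rcos_disjoint[OF B] that by (auto simp: FactGroup_def pairwise_def)
    show ?thesis
    proof (rule ccontr)
      assume "\<not> disjnt (\<Union>X) (\<Union>Y)"
      then obtain a x y where *: "x \<in> X" "y \<in> Y" "a \<in> x" "a \<in> y" by (auto simp: disjnt_def)
      then have "x \<noteq> y" using \<open>disjnt X Y\<close> by (auto simp: disjnt_def)
      then have "disjnt x y" using F(1) * sub(1)[OF that(1)] sub(1)[OF that(2)] by (auto simp: pairwise_def)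
      then show False using * by (auto simp: disjnt_def)
    qed
  qed
  then show "pairwise disjnt (carrier H)"
    unfolding H_def image_group_carrier pairwise_def by blast
  have "\<Union>X \<noteq> {}" if "X \<in> carrier (G Mod B)" for X
  proof -
    from sub(2)[OF that] obtain x where x: "x \<in> X" by auto
    then have "x \<noteq> {}" using F(2) sub(1)[OF \<open>X \<in> carrier (G Mod B)\<close>] by auto
    with x show ?thesis by auto
  qed
  then show "{} \<notin> carrier H"
    unfolding H_def image_group_carrier by blast
qed

section \<open>Derived couples\<close>

text \<open>
  Since \<open>D\<close> vanishes for \<open>s < 0\<close>, the kernel of \<open>i\<close> on \<open>D\<close> in degree \<open>(r,0)\<close> is everything and need not
  be the image of \<open>k\<close>; so \<open>exact_i\<close> concerns sources with positive second index. At \<open>E\<close> only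
  \<open>k \<circ> j = 1\<close> is recorded: in degrees \<open>s < p\<close> the \<open>p\<close>-th \<open>j\<close> comes from a zero group, whereas \<open>k\<close> may
  well have a kernel there. The target indices are variables constrained by equations so that the
  rules apply to index expressions in any form.
\<close>

locale partial_exact_couple =
  fixes p :: int and C :: "'b set couple"
  assumes D_group: "comm_group (cD C r s)"
    and E_group: "comm_group (cE C r s)"
    and E_disjoint: "pairwise disjnt (carrier (cE C r s))"
    and E_nonempty: "{} \<notin> carrier (cE C r s)"
    and i_hom: "r' = r + 1 \<Longrightarrow> s' = s - 1 \<Longrightarrow> ci C r s \<in> hom (cD C r s) (cD C r' s')"
    and j_hom: "r' = r - p \<Longrightarrow> s' = s + p \<Longrightarrow> cj C r s \<in> hom (cD C r s) (cE C r' s')"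
    and k_hom: "s' = s + 1 \<Longrightarrow> ck C r s \<in> hom (cE C r s) (cD C r s')"
    and D_trivial: "s < 0 \<Longrightarrow> carrier (cD C r s) = {\<one>\<^bsub>cD C r s\<^esub>}"
    and E_trivial: "s < 0 \<Longrightarrow> carrier (cE C r s) = {\<one>\<^bsub>cE C r s\<^esub>}"
    and exact_j: "0 \<le> s \<Longrightarrow> x \<in> carrier (cD C r s) \<Longrightarrow> r' = r - p \<Longrightarrow> s' = s + p \<Longrightarrow>
      cj C r s x = \<one>\<^bsub>cE C r' s'\<^esub> \<longleftrightarrow> x \<in> ci C (r - 1) (s + 1) ` carrier (cD C (r - 1) (s + 1))"
    and exact_i: "0 \<le> s \<Longrightarrow> x \<in> carrier (cD C r (s + 1)) \<Longrightarrow>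
      ci C r (s + 1) x = \<one>\<^bsub>cD C (r + 1) s\<^esub> \<longleftrightarrow> x \<in> ck C r s ` carrier (cE C r s)"
    and kj: "0 \<le> s \<Longrightarrow> x \<in> carrier (cD C r s) \<Longrightarrow>
      ck C (r - p) (s + p) (cj C r s x) = \<one>\<^bsub>cD C (r - p) (s + p + 1)\<^esub>"
begin

lemma i_ghom: "r' = r + 1 \<Longrightarrow> s' = s - 1 \<Longrightarrow> group_hom (cD C r s) (cD C r' s') (ci C r s)"
  and j_ghom: "r' = r - p \<Longrightarrow> s' = s + p \<Longrightarrow> group_hom (cD C r s) (cE C r' s') (cj C r s)"
  and k_ghom: "s' = s + 1 \<Longrightarrow> group_hom (cE C r s) (cD C r s') (ck C r s)"
  using i_hom j_hom k_hom D_group E_group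
  by (simp_all add: group_hom_def group_hom_axioms_def comm_group.axioms)

lemma d_ghom: "r' = r - p \<Longrightarrow> s' = s + p + 1 \<Longrightarrow> group_hom (cE C r s) (cE C r' s') (cd C r s)"
  using Group.hom_compose[OF k_hom j_hom, OF refl, of r' r s' s] E_group
  by (simp add: group_hom_def group_hom_axioms_def comm_group.axioms cd_def)

abbreviation cycle where "cycle r s \<equiv> carrier (cycle_group p C r s)"

lemma cycle_iff: "r' = r - p \<Longrightarrow> s' = s + p + 1 \<Longrightarrow>
   e \<in> cycle r s \<longleftrightarrow> e \<in> carrier (cE C r s) \<and> cd C r s e = \<one>\<^bsub>cE C r' s'\<^esub>"
  by (auto simp: cycle_group_def kernel_def)

lemma cycle_group: "comm_group (cycle_group p C r s)"
  unfolding cycle_group_def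
  by (intro subgroup_comm_group E_group group_hom.subgroup_kernel d_ghom refl)

lemma cycle_k: 
  assumes "0 \<le> s" "e \<in> carrier (cE C r s)"
  shows "e \<in> cycle r s \<longleftrightarrow> ck C r s e \<in> ci C (r - 1) (s + 2) ` carrier (cD C (r - 1) (s + 2))"
proof -
  have "ck C r s e \<in> carrier (cD C r (s + 1))" using k_hom assms by (auto simp: hom_def)
  from exact_j[OF _ this, of "r - p" "s + p + 1"] assms show ?thesis
    by (simp add: cycle_iff[OF refl refl] cd_def add.commute[of 2])
qed

lemma boundary_cycle: "boundary_set p C r s \<subseteq> cycle r s"
proof
  fix x assume "x \<in> boundary_set p C r s"
  then obtain e where e: "e \<in> carrier (cE C (r + p) (s - p - 1))" "x = cd C (r + p) (s - p - 1) e"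
    by (auto simp: boundary_set_def)
  have x: "x \<in> carrier (cE C r s)"
    using e group_hom.hom_closed[OF d_ghom, of r "r + p" s "s - p - 1"] by simp
  show "x \<in> cycle r s"
  proof (cases "s - p - 1 < 0")
    case True
    then have "x = \<one>\<^bsub>cE C r s\<^esub>" using E_trivial e group_hom.hom_one[OF d_ghom, of r "r + p" s "s - p - 1"] by simp
    then show ?thesis using x group_hom.hom_one[OF d_ghom[OF refl refl]] by (simp add: cycle_iff[OF refl refl])
  next
    case False
    then have y: "ck C (r + p) (s - p - 1) e \<in> carrier (cD C (r + p) (s - p))"
      using e group_hom.hom_closed[OF k_ghom, of "s - p" "s - p - 1"] by simp
    have "ck C r s x = \<one>\<^bsub>cD C r (s + 1)\<^esub>"
      using kj[OF _ y] False e by (simp add: cd_def)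
    then have "cd C r s x = \<one>\<^bsub>cE C (r - p) (s + p + 1)\<^esub>"
      using group_hom.hom_one[OF j_ghom, of "r - p" r "s + p + 1" "s + 1"] by (simp add: cd_def)
    then show ?thesis using x by (simp add: cycle_iff[OF refl refl])
  qed
qed

lemma boundary_k:
  assumes "0 \<le> s" "e \<in> boundary_set p C r s"
  shows "ck C r s e = \<one>\<^bsub>cD C r (s + 1)\<^esub>"
proof -
  from assms obtain e' where e: "e' \<in> carrier (cE C (r + p) (s - p - 1))" "e = cd C (r + p) (s - p - 1) e'"
    by (auto simp: boundary_set_def)
  show ?thesis
  proof (cases "s - p - 1 < 0")
    case True
    then have "e = \<one>\<^bsub>cE C r s\<^esub>" using E_trivial e group_hom.hom_one[OF d_ghom, of r "r + p" s "s - p - 1"] by simp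
    then show ?thesis using group_hom.hom_one[OF k_ghom[OF refl]] by simp
  next
    case False
    then have y: "ck C (r + p) (s - p - 1) e' \<in> carrier (cD C (r + p) (s - p))"
      using e group_hom.hom_closed[OF k_ghom, of "s - p" "s - p - 1"] by simp
    show ?thesis using kj[OF _ y] False e by (simp add: cd_def)
  qed
qed

lemma boundary_subgroup: "subgroup (boundary_set p C r s) (cycle_group p C r s)"
proof -
  have "subgroup (boundary_set p C r s) (cE C r s)"
    unfolding boundary_set_def
    by (rule group_hom.img_is_subgroup[OF d_ghom]) auto
  then show ?thesis
    using boundary_cycle[of r s] E_group
    by (auto simp: cycle_group_def intro!: group.subgroup_incl group_hom.subgroup_kernel d_ghom comm_group.axioms)
qed

lemma cycle_disjoint: "pairwise disjnt (cycle r s)" "{} \<notin> cycle r s"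
proof -
  have "cycle r s \<subseteq> carrier (cE C r s)" by (auto simp: cycle_iff[OF refl refl])
  then show "pairwise disjnt (cycle r s)" "{} \<notin> cycle r s"
    using pairwise_subset[OF E_disjoint] E_nonempty by blast+
qed

lemmas homology = union_quotient[OF cycle_group boundary_subgroup cycle_disjoint,
  folded homology_group_def homology_class_def]

lemma homology_ghom: "group_hom (cycle_group p C r s) (homology_group p C r s) (homology_class p C r s)"
  using homology(1,2)[of r s] cycle_group[of r s]
  by (auto simp: group_hom_def group_hom_axioms_def comm_group.axioms homology_class_def[abs_def])

lemma homology_class_eq:
  assumes x: "x \<in> cycle r s" and y: "y \<in> cycle r s"
  shows "homology_class p C r s x = homology_class p C r s y \<longleftrightarrow>
    x \<otimes>\<^bsub>cE C r s\<^esub> inv\<^bsub>cE C r s\<^esub> y \<in> boundary_set p C r s"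
proof -
  interpret h: group_hom "cycle_group p C r s" "homology_group p C r s" "homology_class p C r s"
    by (rule homology_ghom)
  have "subgroup (cycle r s) (cE C r s)"
    by (simp add: cycle_group_def group_hom.subgroup_kernel[OF d_ghom])
  then have "inv\<^bsub>cycle_group p C r s\<^esub> y = inv\<^bsub>cE C r s\<^esub> y"
    using group.m_inv_consistent[of "cE C r s" "cycle r s" y] y E_group[of r s]
    by (simp add: cycle_group_def comm_group.axioms)
  moreover have "x \<otimes>\<^bsub>cycle_group p C r s\<^esub> inv\<^bsub>cycle_group p C r s\<^esub> y \<in> cycle r s" using x y by simp
  ultimately show ?thesis
    using h.image_eq_iff[OF x y] homology(4)[of _ r s] by (simp add: cycle_group_def homology_class_def)
qed

lemma j_cycle:
  assumes s: "0 \<le> s" and x: "x \<in> carrier (cD C r s)" and [simp]: "r' = r - p" "s' = s + p"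
  shows "cj C r s x \<in> cycle r' s'"
  using group_hom.hom_closed[OF j_ghom[OF refl refl] x] kj[OF s x]
    group_hom.hom_one[OF j_ghom, of "r - p - p" "r - p" "s + p + p + 1" "s + p + 1"]
  by (simp add: cycle_iff[of "r - p - p" "r - p" "s + p + p + 1" "s + p"] cd_def)

text \<open>
  A boundary is \<open>j (k e)\<close>, and \<open>j y = j (k e)\<close> means that \<open>y\<close> and \<open>k e\<close> differ by an element of the
  image of \<open>i\<close>. Because the image of \<open>k\<close> is the kernel of \<open>i\<close>, such an \<open>e\<close> exists if and only if \<open>y\<close>
  has the same value under \<open>i\<close> as some element of that image. Both the independence of the
  derived \<open>j\<close> from the chosen preimage and the exactness of the derived couple at \<open>D\<close> are read off
  from this.
\<close>

lemma j_boundary_iff: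
  assumes s: "0 \<le> s" and y: "y \<in> carrier (cD C r (s + 1))" and [simp]: "r' = r - p" "s' = s + p + 1"
  shows "cj C r (s + 1) y \<in> boundary_set p C r' s' \<longleftrightarrow>
    (\<exists>z\<in>carrier (cD C (r - 1) (s + 2)). ci C r (s + 1) y = ci C r (s + 1) (ci C (r - 1) (s + 2) z))"
proof -
  let ?Z = "carrier (cD C (r - 1) (s + 2))" and ?i = "ci C (r - 1) (s + 2)"
  let ?sub = "\<lambda>a. y \<otimes>\<^bsub>cD C r (s + 1)\<^esub> inv\<^bsub>cD C r (s + 1)\<^esub> a"
  let ?D = "cD C r (s + 1)"
  interpret j: group_hom ?D "cE C r' s'" "cj C r (s + 1)" by (rule j_ghom) simp_all
  interpret k: group_hom "cE C r s" ?D "ck C r s" by (rule k_ghom) simp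
  interpret i: group_hom ?D "cD C (r + 1) s" "ci C r (s + 1)" by (rule i_ghom) simp_all
  interpret i2: group_hom "cD C (r - 1) (s + 2)" ?D "ci C (r - 1) (s + 2)" by (rule i_ghom) simp_all
  have ex: "cj C r (s + 1) x = \<one>\<^bsub>cE C r' s'\<^esub> \<longleftrightarrow> x \<in> ?i ` ?Z"
    if "x \<in> carrier ?D" for x
    using exact_j[of "s + 1" x r r' s'] that s by (simp add: add.commute add.left_commute)
  have "cj C r (s + 1) y \<in> boundary_set p C r' s' \<longleftrightarrow> (\<exists>e\<in>carrier (cE C r s). cj C r (s + 1) y = cj C r (s + 1) (ck C r s e))"
    by (auto simp: boundary_set_def cd_def)
  also have "\<dots> \<longleftrightarrow> (\<exists>e\<in>carrier (cE C r s). ?sub (ck C r s e) \<in> ?i ` ?Z)"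
  proof (intro bex_cong refl)
    fix e assume e: "e \<in> carrier (cE C r s)"
    show "cj C r (s + 1) y = cj C r (s + 1) (ck C r s e) \<longleftrightarrow>
      ?sub (ck C r s e) \<in> ?i ` ?Z"
      unfolding j.image_eq_iff[OF y k.hom_closed[OF e]] by (rule ex) (simp add: y e)
  qed
  also have "\<dots> \<longleftrightarrow> (\<exists>e\<in>carrier (cE C r s). \<exists>z\<in>?Z. ?sub (?i z) = ck C r s e)"
  proof -
    have "?sub a = b \<longleftrightarrow> ?sub b = a" if "a \<in> carrier ?D" "b \<in> carrier ?D" for a b
      using that y comm_groupE(4)[OF D_group[of r "s + 1"], of a b] j.G.inv_solve_right[of b y a] j.G.inv_solve_right[of a y b]
      by metis
    then have *: "?sub (ck C r s e) = ?i z \<longleftrightarrow> ?sub (?i z) = ck C r s e"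
      if "e \<in> carrier (cE C r s)" "z \<in> ?Z" for e z
      using that by simp
    then show ?thesis by (auto simp: image_iff)
  qed
  also have "\<dots> \<longleftrightarrow> (\<exists>z\<in>?Z. ?sub (?i z) \<in> ck C r s ` carrier (cE C r s))"
    by (auto simp: image_iff)
  also have "\<dots> \<longleftrightarrow> (\<exists>z\<in>?Z. ci C r (s + 1) y = ci C r (s + 1) (?i z))"
  proof (intro bex_cong refl)
    fix z assume z: "z \<in> ?Z"
    show "?sub (?i z) \<in> ck C r s ` carrier (cE C r s) \<longleftrightarrow>
      ci C r (s + 1) y = ci C r (s + 1) (?i z)"
      unfolding i.image_eq_iff[OF y i2.hom_closed[OF z]] by (rule exact_i[OF s, symmetric]) (simp add: y z)
  qed
  finally show ?thesis .
qed

abbreviation "C' \<equiv> derived_couple p C"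

lemma derived_simps:
  "cD C' r s = (cD C r s)\<lparr>carrier := ci C (r - 1) (s + 1) ` carrier (cD C (r - 1) (s + 1))\<rparr>"
  "cE C' = homology_group p C" "ci C' = ci C"
  by (simp_all add: derived_couple_def)

text \<open>
  Two preimages of the same element differ by the kernel of \<open>i\<close>, which \<open>j\<close> sends into the boundaries;
  hence the set under \<open>the_elem\<close> in the definition is a singleton.
\<close>

lemma derived_j:
  assumes s: "0 \<le> s" and y: "y \<in> carrier (cD C (r - 1) (s + 1))"
  shows "cj C' r s (ci C (r - 1) (s + 1) y) = homology_class p C (r - p - 1) (s + p + 1) (cj C (r - 1) (s + 1) y)"
proof -
  let ?Y = "cD C (r - 1) (s + 1)" and ?j = "cj C (r - 1) (s + 1)" and ?i = "ci C (r - 1) (s + 1)"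
  let ?hc = "homology_class p C (r - p - 1) (s + p + 1)"
  have eq: "?hc (?j y') = ?hc (?j y)"
    if y': "y' \<in> carrier (?Y)" and e: "?i y' = ?i y" for y'
  proof -
    interpret j: group_hom ?Y "cE C (r - p - 1) (s + p + 1)" ?j by (rule j_ghom) simp_all
    interpret i: group_hom ?Y "cD C r s" ?i by (rule i_ghom) simp_all
    interpret i2: group_hom "cD C (r - 1 - 1) (s + 2)" ?Y "ci C (r - 1 - 1) (s + 2)" by (rule i_ghom) simp_all
    let ?w = "y' \<otimes>\<^bsub>?Y\<^esub> inv\<^bsub>?Y\<^esub> y"
    have w: "?w \<in> carrier (?Y)" "?i ?w = \<one>\<^bsub>cD C r s\<^esub>"
      using y y' e i.image_eq_iff[OF y' y] by blast+
    moreover have "?i (ci C (r - 1 - 1) (s + 2) \<one>\<^bsub>cD C (r - 1 - 1) (s + 2)\<^esub>) = \<one>\<^bsub>cD C r s\<^esub>"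
      by (simp only: i.hom_one i2.hom_one)
    ultimately have "?j ?w \<in> boundary_set p C (r - p - 1) (s + p + 1)"
      using j_boundary_iff[OF s w(1), of "r - p - 1" "s + p + 1"] i2.G.one_closed by fastforce
    then have "?j y' \<otimes>\<^bsub>cE C (r - p - 1) (s + p + 1)\<^esub> inv\<^bsub>cE C (r - p - 1) (s + p + 1)\<^esub> ?j y
      \<in> boundary_set p C (r - p - 1) (s + p + 1)"
      by (simp add: y y')
    moreover have "?j y \<in> cycle (r - p - 1) (s + p + 1)"
       "?j y' \<in> cycle (r - p - 1) (s + p + 1)"
      using s y y' by (auto intro!: j_cycle)
    ultimately show ?thesis by (simp add: homology_class_eq)
  qed
  have "{?hc (?j y') | y'. y' \<in> carrier (?Y) \<and> ?i y' = ?i y}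
     = {?hc (?j y)}"
    using y eq by blast
  then show ?thesis using s by (simp add: derived_couple_def)
qed

lemma cycle_trivial: "s < 0 \<Longrightarrow> cycle r s \<subseteq> {\<one>\<^bsub>cE C r s\<^esub>}"
  using E_trivial by (auto simp: cycle_iff[OF refl refl])

text \<open>
  Again a set under \<open>the_elem\<close> is a singleton, now because \<open>k\<close> kills boundaries by \<open>k \<circ> j = 1\<close>.
\<close>

lemma derived_k:
  assumes z: "z \<in> cycle r s"
  shows "ck C' r s (homology_class p C r s z) = ck C r s z"
proof -
  interpret k: group_hom "cE C r s" "cD C r (s + 1)" "ck C r s" by (rule k_ghom) simp
  have eq: "ck C r s z' = ck C r s z"
    if z': "z' \<in> cycle r s" and e: "homology_class p C r s z' = homology_class p C r s z" for z'
  proof (cases "s < 0")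
    case True
    then show ?thesis using cycle_trivial[of s r] z z' by auto
  next
    case False
    have zc: "z \<in> carrier (cE C r s)" "z' \<in> carrier (cE C r s)"
      using z z' by (auto simp: cycle_iff[OF refl refl])
    show ?thesis using boundary_k[of s _ r] False e homology_class_eq[OF z' z] k.image_eq_iff[OF zc(2,1)] by auto
  qed
  have "{ck C r s z' | z'. z' \<in> cycle r s \<and> homology_class p C r s z' = homology_class p C r s z} = {ck C r s z}"
    using z eq by blast
  then show ?thesis by (simp add: derived_couple_def)
qed

lemma derived_D_cases:
  assumes "x \<in> carrier (cD C' r s)"
  obtains y where "y \<in> carrier (cD C (r - 1) (s + 1))" "x = ci C (r - 1) (s + 1) y"
  using assms by (auto simp: derived_simps)

lemma derived_E_cases:
  assumes "e \<in> carrier (cE C' r s)"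
  obtains z where "z \<in> cycle r s" "e = homology_class p C r s z"
  using assms that unfolding derived_simps homology(3)[of r s, folded homology_class_def, symmetric] by blast

lemma derived_D_subgroup: "subgroup (carrier (cD C' r s)) (cD C r s)"
  using group_hom.img_is_subgroup[OF i_ghom, of r "r - 1" s "s + 1"] by (simp add: derived_simps)

lemma derived_j_hom:
  assumes rs: "r' = r - (p + 1)" "s' = s + (p + 1)"
  shows "cj C' r s \<in> hom (cD C' r s) (cE C' r' s')"
proof (cases "s < 0")
  case True
  then have "cj C' r s = (\<lambda>x. \<one>\<^bsub>cE C' r' s'\<^esub>)"
    by (auto simp: derived_couple_def rs algebra_simps)
  have "comm_group (cE C' r' s')" using homology(1)[of r' s'] by (simp add: derived_simps)
  then interpret H: comm_group "cE C' r' s'" .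
  show ?thesis using \<open>cj C' r s = _\<close> H.one_closed H.l_one[OF H.one_closed] by (simp add: hom_def)
next
  case False
  let ?Y = "cD C (r - 1) (s + 1)" and ?j = "cj C (r - 1) (s + 1)" and ?i = "ci C (r - 1) (s + 1)"
  interpret j: group_hom ?Y "cE C r' s'" ?j by (rule j_ghom) (simp_all add: rs)
  interpret i: group_hom ?Y "cD C r s" ?i by (rule i_ghom) simp_all
  interpret h: group_hom "cycle_group p C r' s'" "homology_group p C r' s'" "homology_class p C r' s'" by (rule homology_ghom)
  have jc: "?j y \<in> cycle r' s'" if "y \<in> carrier (?Y)" for y
    using False that by (intro j_cycle) (auto simp: rs)
  have dj: "cj C' r s (?i y) = homology_class p C r' s' (?j y)" if "y \<in> carrier (?Y)" for y
    using derived_j[OF _ that] False by (simp add: rs algebra_simps)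
  show ?thesis
  proof (rule homI)
    fix x assume "x \<in> carrier (cD C' r s)"
    then show "cj C' r s x \<in> carrier (cE C' r' s')"
      by (elim derived_D_cases) (simp add: dj jc derived_simps)
  next
    fix x1 x2 assume "x1 \<in> carrier (cD C' r s)" "x2 \<in> carrier (cD C' r s)"
    then obtain y1 y2 where y: "y1 \<in> carrier (?Y)" "x1 = ?i y1"
       "y2 \<in> carrier (?Y)" "x2 = ?i y2" by (elim derived_D_cases) blast
    have "cj C' r s (x1 \<otimes>\<^bsub>cD C' r s\<^esub> x2) = cj C' r s (?i (y1 \<otimes>\<^bsub>?Y\<^esub> y2))"
      using y by (simp add: derived_simps)
    also have "\<dots> = homology_class p C r' s' (?j y1 \<otimes>\<^bsub>cycle_group p C r' s'\<^esub> ?j y2)"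
      using y by (subst dj) (auto simp: cycle_group_def)
    also have "\<dots> = cj C' r s x1 \<otimes>\<^bsub>cE C' r' s'\<^esub> cj C' r s x2"
      using y by (simp add: dj jc derived_simps)
    finally show "cj C' r s (x1 \<otimes>\<^bsub>cD C' r s\<^esub> x2) = cj C' r s x1 \<otimes>\<^bsub>cE C' r' s'\<^esub> cj C' r s x2" .
  qed
qed

lemma derived_k_hom: "ck C' r s \<in> hom (cE C' r s) (cD C' r (s + 1))"
proof -
  interpret k: group_hom "cE C r s" "cD C r (s + 1)" "ck C r s" by (rule k_ghom) simp
  interpret i: group_hom "cD C (r - 1) (s + 2)" "cD C r (s + 1)" "ci C (r - 1) (s + 2)" by (rule i_ghom) simp_all
  interpret h: group_hom "cycle_group p C r s" "homology_group p C r s" "homology_class p C r s" by (rule homology_ghom)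
  have zc: "z \<in> carrier (cE C r s)" if "z \<in> cycle r s" for z using that by (simp add: cycle_iff[OF refl refl])
  show ?thesis
  proof (rule homI)
    fix e assume "e \<in> carrier (cE C' r s)"
    then obtain z where z: "z \<in> cycle r s" "e = homology_class p C r s z" by (rule derived_E_cases)
    show "ck C' r s e \<in> carrier (cD C' r (s + 1))"
    proof (cases "s < 0")
      case True
      then have "z = \<one>\<^bsub>cE C r s\<^esub>" using cycle_trivial z by blast
      moreover have "\<one>\<^bsub>cD C r (s + 1)\<^esub> \<in> ci C (r - 1) (s + 2) ` carrier (cD C (r - 1) (s + 2))"
        using i.hom_one i.G.one_closed by (metis imageI)
      ultimately show ?thesis using z by (simp add: derived_k derived_simps add.commute)
    next
      case False
      then show ?thesis using z cycle_k[of s z r] zc by (simp add: derived_k derived_simps add.commute)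
    qed
  next
    fix e1 e2 assume "e1 \<in> carrier (cE C' r s)" "e2 \<in> carrier (cE C' r s)"
    then obtain z1 z2 where z: "z1 \<in> cycle r s" "e1 = homology_class p C r s z1"
      "z2 \<in> cycle r s" "e2 = homology_class p C r s z2" by (elim derived_E_cases) blast
    have "e1 \<otimes>\<^bsub>cE C' r s\<^esub> e2 = homology_class p C r s (z1 \<otimes>\<^bsub>cycle_group p C r s\<^esub> z2)"
      using z by (simp add: derived_simps)
    then have "ck C' r s (e1 \<otimes>\<^bsub>cE C' r s\<^esub> e2) = ck C r s (z1 \<otimes>\<^bsub>cycle_group p C r s\<^esub> z2)"
      using derived_k[OF h.G.m_closed[OF z(1,3)]] by (simp only:)
    also have "\<dots> = ck C' r s e1 \<otimes>\<^bsub>cD C' r (s + 1)\<^esub> ck C' r s e2"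
      using z zc by (simp add: derived_k derived_simps) (simp add: cycle_group_def)
    finally show "ck C' r s (e1 \<otimes>\<^bsub>cE C' r s\<^esub> e2) = ck C' r s e1 \<otimes>\<^bsub>cD C' r (s + 1)\<^esub> ck C' r s e2" .
  qed
qed

lemma derived_i_hom:
  assumes [simp]: "r' = r + 1" "s' = s - 1"
  shows "ci C' r s \<in> hom (cD C' r s) (cD C' r' s')"
proof -
  interpret i: group_hom "cD C r s" "cD C r' s'" "ci C r s" by (rule i_ghom) simp_all
  have "x \<in> carrier (cD C r s)" if "x \<in> carrier (cD C' r s)" for x
    using subgroup.subset[OF derived_D_subgroup] that by blast
  then show ?thesis by (auto simp: hom_def derived_simps)
qed

lemma derived_exact_j:
  assumes s: "0 \<le> s" and x: "x \<in> carrier (cD C' r s)" and [simp]: "r' = r - (p + 1)" "s' = s + (p + 1)"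
  shows "cj C' r s x = \<one>\<^bsub>cE C' r' s'\<^esub> \<longleftrightarrow> x \<in> ci C' (r - 1) (s + 1) ` carrier (cD C' (r - 1) (s + 1))"
proof -
  obtain y where y: "y \<in> carrier (cD C (r - 1) (s + 1))" "x = ci C (r - 1) (s + 1) y"
    using x by (rule derived_D_cases)
  have r': "r - p - 1 = r'" "s + p + 1 = s'" by simp_all
  have "cj C' r s x = \<one>\<^bsub>cE C' r' s'\<^esub> \<longleftrightarrow> cj C (r - 1) (s + 1) y \<in> boundary_set p C r' s'"
    unfolding y(2) derived_j[OF s y(1)] r' derived_simps
    using homology(4)[of "cj C (r - 1) (s + 1) y" r' s'] j_cycle[of "s + 1" y "r - 1" r' s'] y s
    by (simp add: homology_class_def)
  also have "\<dots> \<longleftrightarrow> x \<in> ci C' (r - 1) (s + 1) ` carrier (cD C' (r - 1) (s + 1))"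
    using j_boundary_iff[OF s y(1), of r' s'] y(2) by (auto simp: derived_simps image_iff add.commute)
  finally show ?thesis .
qed

lemma derived_exact_i:
  assumes s: "0 \<le> s" and x: "x \<in> carrier (cD C' r (s + 1))"
  shows "ci C' r (s + 1) x = \<one>\<^bsub>cD C' (r + 1) s\<^esub> \<longleftrightarrow> x \<in> ck C' r s ` carrier (cE C' r s)"
proof -
  have xD: "x \<in> carrier (cD C r (s + 1))" using x subgroup.subset[OF derived_D_subgroup] by blast
  have xi: "x \<in> ci C (r - 1) (s + 2) ` carrier (cD C (r - 1) (s + 2))"
    using x by (simp add: derived_simps add.commute)
  have "ci C' r (s + 1) x = \<one>\<^bsub>cD C' (r + 1) s\<^esub> \<longleftrightarrow> x \<in> ck C r s ` carrier (cE C r s)"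
    using exact_i[OF s xD] by (simp add: derived_simps)
  also have "\<dots> \<longleftrightarrow> x \<in> ck C r s ` cycle r s"
    using xi cycle_k[OF s] cycle_iff[OF refl refl] by blast
  also have "\<dots> \<longleftrightarrow> x \<in> ck C' r s ` carrier (cE C' r s)"
    unfolding derived_simps homology(3)[of r s, folded homology_class_def, symmetric] image_image
    by (simp add: derived_k cong: image_cong)
  finally show ?thesis .
qed

lemma derived_kj:
  assumes s: "0 \<le> s" and x: "x \<in> carrier (cD C' r s)"
  shows "ck C' (r - (p + 1)) (s + (p + 1)) (cj C' r s x) = \<one>\<^bsub>cD C' (r - (p + 1)) (s + (p + 1) + 1)\<^esub>"
proof -
  obtain y where y: "y \<in> carrier (cD C (r - 1) (s + 1))" "x = ci C (r - 1) (s + 1) y"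
    using x by (rule derived_D_cases)
  have e: "r - p - 1 = r - (p + 1)" "s + p + 1 = s + (p + 1)" by simp_all
  have c: "cj C (r - 1) (s + 1) y \<in> cycle (r - (p + 1)) (s + (p + 1))"
    using s y by (intro j_cycle) auto
  show ?thesis
    unfolding y(2) derived_j[OF s y(1)] e derived_k[OF c]
    using kj[of "s + 1" y "r - 1"] s y by (simp add: derived_simps algebra_simps)
qed

lemma derived_partial_exact_couple: "partial_exact_couple (p + 1) C'"
proof (rule partial_exact_couple.intro)
  show "comm_group (cD C' r s)" for r s
    using subgroup_comm_group[OF D_group derived_D_subgroup] by (simp add: derived_simps)
  show "comm_group (cE C' r s)" "pairwise disjnt (carrier (cE C' r s))" "{} \<notin> carrier (cE C' r s)" for r s
    unfolding derived_simps by (rule homology)+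
  show "carrier (cD C' r s) = {\<one>\<^bsub>cD C' r s\<^esub>}" if "s < 0" for r s
  proof -
    have "carrier (cD C' r s) \<subseteq> {\<one>\<^bsub>cD C r s\<^esub>}" "\<one>\<^bsub>cD C r s\<^esub> \<in> carrier (cD C' r s)"
      using subgroup.subset[OF derived_D_subgroup, of r s] subgroup.one_closed[OF derived_D_subgroup, of r s]
      unfolding D_trivial[OF that, of r] .
    then show ?thesis unfolding derived_simps by auto
  qed
  show "carrier (cE C' r s) = {\<one>\<^bsub>cE C' r s\<^esub>}" if "s < 0" for r s
  proof -
    interpret h: group_hom "cycle_group p C r s" "homology_group p C r s" "homology_class p C r s" by (rule homology_ghom)
    have "\<one>\<^bsub>cycle_group p C r s\<^esub> = \<one>\<^bsub>cE C r s\<^esub>" by (simp add: cycle_group_def)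
    then have "cycle r s = {\<one>\<^bsub>cycle_group p C r s\<^esub>}" using cycle_trivial[OF that, of r] h.G.one_closed by blast
    then have "homology_class p C r s ` cycle r s = {\<one>\<^bsub>homology_group p C r s\<^esub>}" by simp
    then show ?thesis unfolding derived_simps homology(3)[of r s, folded homology_class_def, symmetric] .
  qed
  show "ck C' r s \<in> hom (cE C' r s) (cD C' r s')" if "s' = s + 1" for r s s'
    using derived_k_hom that by simp
qed (rule derived_i_hom derived_j_hom derived_exact_j derived_exact_i derived_kj; assumption)+

end

section \<open>Quotients of additive groups\<close>

definition add_subgroup :: "'b::ab_group_add set \<Rightarrow> bool" where
  "add_subgroup Z \<longleftrightarrow> 0 \<in> Z \<and> (\<forall>x\<in>Z. \<forall>y\<in>Z. x - y \<in> Z)"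

lemma add_subgroupD:
  assumes "add_subgroup Z"
  shows "0 \<in> Z" "x \<in> Z \<Longrightarrow> y \<in> Z \<Longrightarrow> x - y \<in> Z" "x \<in> Z \<Longrightarrow> - x \<in> Z"
    "x \<in> Z \<Longrightarrow> y \<in> Z \<Longrightarrow> x + y \<in> Z"
proof -
  show 0: "0 \<in> Z" and d: "x \<in> Z \<Longrightarrow> y \<in> Z \<Longrightarrow> x - y \<in> Z" for x y
    using assms by (auto simp: add_subgroup_def)
  show m: "x \<in> Z \<Longrightarrow> - x \<in> Z" for x using d[OF 0, of x] by simp
  show "x \<in> Z \<Longrightarrow> y \<in> Z \<Longrightarrow> x + y \<in> Z" using d[OF _ m, of x y] by simp
qed

lemma add_group_comm_group:
  assumes "add_subgroup Z" shows "comm_group (add_group Z)"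
proof (rule comm_groupI)
  show "\<exists>y\<in>carrier (add_group Z). y \<otimes>\<^bsub>add_group Z\<^esub> x = \<one>\<^bsub>add_group Z\<^esub>"
    if "x \<in> carrier (add_group Z)" for x
    using that by (intro bexI[of _ "- x"]) (auto simp: add_group_def add_subgroupD[OF assms])
qed (auto simp: add_group_def add_subgroupD[OF assms] ac_simps)

lemma add_group_subgroup:
  assumes Z: "add_subgroup Z" and B: "add_subgroup B" "B \<subseteq> Z"
  shows "subgroup B (add_group Z)"
proof -
  interpret comm_group "add_group Z" by (rule add_group_comm_group[OF Z])
  show ?thesis
  proof
    show "inv\<^bsub>add_group Z\<^esub> x \<in> B" if "x \<in> B" for x
    proof -
      have "inv\<^bsub>add_group Z\<^esub> x = - x"
        by (rule inv_equality) (use that B add_subgroupD[OF Z] in \<open>auto simp: add_group_def\<close>)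
      then show ?thesis using that add_subgroupD[OF B(1)] by simp
    qed
  qed (use B add_subgroupD[OF B(1)] in \<open>auto simp: add_group_def\<close>)
qed

lemma coset_add_group: "B #>\<^bsub>add_group Z\<^esub> z = (\<lambda>b. b + z) ` B"
  by (auto simp: r_coset_def add_group_def)

lemma mem_coset_iff: "x \<in> (\<lambda>b. b + z) ` B \<longleftrightarrow> x - z \<in> (B :: 'b::ab_group_add set)"
  by (auto simp: image_iff) (metis diff_add_cancel)

lemma coset_eq_iff:
  assumes B: "add_subgroup B"
  shows "(\<lambda>b. b + x) ` B = (\<lambda>b. b + y) ` B \<longleftrightarrow> x - y \<in> B"
proof
  assume "(\<lambda>b. b + x) ` B = (\<lambda>b. b + y) ` B"
  moreover have "x \<in> (\<lambda>b. b + x) ` B" using add_subgroupD(1)[OF B] by (simp add: mem_coset_iff)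
  ultimately show "x - y \<in> B" by (simp add: mem_coset_iff)
next
  assume xy: "x - y \<in> B"
  have *: "z - x \<in> B \<longleftrightarrow> z - y \<in> B" for z
    using add_subgroupD(4)[OF B _ xy, of "z - x"] add_subgroupD(2)[OF B _ xy, of "z - y"] by auto
  show "(\<lambda>b. b + x) ` B = (\<lambda>b. b + y) ` B" by (rule Set.set_eqI) (simp only: mem_coset_iff *)
qed

lemma quotient_group:
  assumes Z: "add_subgroup Z" and B: "add_subgroup B" "B \<subseteq> Z"
  shows "comm_group (add_group Z Mod B)"
    and "pairwise disjnt (carrier (add_group Z Mod B))" "{} \<notin> carrier (add_group Z Mod B)"
    and "x \<in> Z \<Longrightarrow> y \<in> Z \<Longrightarrow> (\<lambda>b. b + x) ` B \<otimes>\<^bsub>add_group Z Mod B\<^esub> (\<lambda>b. b + y) ` B = (\<lambda>b. b + (x + y)) ` B"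
proof -
  interpret comm_group "add_group Z" by (rule add_group_comm_group[OF Z])
  have S: "subgroup B (add_group Z)" by (rule add_group_subgroup[OF assms])
  interpret normal B "add_group Z" using S by (rule subgroup_imp_normal)
  show "comm_group (add_group Z Mod B)" by (rule abelian_FactGroup[OF S])
  show "pairwise disjnt (carrier (add_group Z Mod B))" "{} \<notin> carrier (add_group Z Mod B)"
    using rcos_disjoint[OF S] subgroup.rcosets_non_empty[OF S] by (auto simp: FactGroup_def)
  show "(\<lambda>b. b + x) ` B \<otimes>\<^bsub>add_group Z Mod B\<^esub> (\<lambda>b. b + y) ` B = (\<lambda>b. b + (x + y)) ` B" if "x \<in> Z" "y \<in> Z"
  proof -
    have "x \<otimes>\<^bsub>add_group Z\<^esub> y = x + y" "carrier (add_group Z) = Z" by (simp_all add: add_group_def)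
    with rcos_sum[of x y] that show ?thesis by (simp add: coset_add_group)
  qed
qed

section \<open>Module homomorphisms\<close>

text \<open>
  Unlike for \<open>lhom\<close>, values outside the carrier are unconstrained, so that maps such as \<open>eps_tensor\<close>,
  which are given by one formula on a whole type, qualify without being cut off.
\<close>

definition module_map :: "('r, 'm::ab_group_add) lmod \<Rightarrow> ('r, 'n::ab_group_add) lmod \<Rightarrow> ('m \<Rightarrow> 'n) \<Rightarrow> bool" where
  "module_map M N f \<longleftrightarrow> (\<forall>x\<in>carr M. f x \<in> carr N) \<and>
     (\<forall>x\<in>carr M. \<forall>y\<in>carr M. f (x + y) = f x + f y) \<and>
     (\<forall>c. \<forall>x\<in>carr M. f (smul M c x) = smul N c (f x))"

lemma lhom_iff: "f \<in> lhom M N \<longleftrightarrow> module_map M N f \<and> (\<forall>x. x \<notin> carr M \<longrightarrow> f x = 0)"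
  by (auto simp: lhom_def module_map_def)

lemma module_mapD:
  assumes "module_map M N f"
  shows "x \<in> carr M \<Longrightarrow> f x \<in> carr N" "x \<in> carr M \<Longrightarrow> y \<in> carr M \<Longrightarrow> f (x + y) = f x + f y"
    "x \<in> carr M \<Longrightarrow> f (smul M c x) = smul N c (f x)"
  using assms by (auto simp: module_map_def)

lemma module_map_minus:
  assumes f: "module_map M N f" and M: "left_module M"
  shows "f 0 = 0" "x \<in> carr M \<Longrightarrow> f (- x) = - f x" "x \<in> carr M \<Longrightarrow> y \<in> carr M \<Longrightarrow> f (x - y) = f x - f y"
proof -
  show 0: "f 0 = 0" using module_mapD(2)[OF f left_moduleD(1)[OF M] left_moduleD(1)[OF M]] by simp
  show m: "f (- x) = - f x" if "x \<in> carr M" for x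
    using module_mapD(2)[OF f that left_moduleD(3)[OF M that]] 0 by (simp add: eq_neg_iff_add_eq_0 add.commute)
  show "f (x - y) = f x - f y" if "x \<in> carr M" "y \<in> carr M"
    using module_mapD(2)[OF f that(1) left_moduleD(3)[OF M that(2)]] m[OF that(2)] by simp
qed

lemma left_module_diff: "left_module M \<Longrightarrow> x \<in> carr M \<Longrightarrow> y \<in> carr M \<Longrightarrow> x - y \<in> carr M"
  using left_moduleD(2,3)[of M] by (metis add_uminus_conv_diff)

lemma module_map_restrict0:
  assumes "left_module M" shows "restrict0 (carr M) f \<in> lhom M N \<longleftrightarrow> module_map M N f"
  using assms by (auto simp: lhom_iff module_map_def restrict0_def left_moduleD)

lemma lhom_module_map: "f \<in> lhom M N \<Longrightarrow> module_map M N f"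
  by (simp add: lhom_iff)

lemma module_map_comp: "module_map M N f \<Longrightarrow> module_map N P g \<Longrightarrow> module_map M P (\<lambda>x. g (f x))"
  by (simp add: module_map_def)

lemma module_map_diff:
  assumes "left_module N" "module_map M N f" "module_map M N g"
  shows "module_map M N (\<lambda>x. f x - g x)"
proof -
  have "smul N c (f x - g x) = smul N c (f x) - smul N c (g x)" if "x \<in> carr M" for c x
    using that assms left_moduleD(5)[OF assms(1), of "f x" "- g x" c] smul_minus[OF assms(1), of "g x" c]
      left_moduleD(3)[OF assms(1), of "g x"] by (simp add: module_map_def)
  then show ?thesis using assms by (auto simp: module_map_def left_module_diff)
qed

lemma lhom_range: "left_module N \<Longrightarrow> f \<in> lhom M N \<Longrightarrow> f x \<in> carr N"
  by (cases "x \<in> carr M") (auto simp: lhom_def left_moduleD(1))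

lemma smul_diff: "left_module A \<Longrightarrow> x \<in> carr A \<Longrightarrow> y \<in> carr A \<Longrightarrow> smul A c (x - y) = smul A c x - smul A c y"
  using left_moduleD(5)[of A x "- y" c] smul_minus[of A y c] left_moduleD(3)[of A y] by simp

lemmas lhom_apply_zero = module_map_minus(1)[OF lhom_module_map]

lemma lhom_subgroup: "left_module N \<Longrightarrow> add_subgroup (lhom M N)"
proof -
  assume N: "left_module N"
  have "module_map M N 0" by (simp add: module_map_def left_moduleD[OF N])
  moreover have "module_map M N (f - g)" if "module_map M N f" "module_map M N g" for f g
    using module_map_diff[OF N that] by (simp add: fun_diff_def)
  ultimately show "add_subgroup (lhom M N)"
    by (auto simp: add_subgroup_def lhom_iff)
qed

text \<open>Equivariance under the group elements suffices, because they span the group ring.\<close>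

lemmas lhom_zero = add_subgroupD(1)[OF lhom_subgroup]
  and lhom_diff = add_subgroupD(2)[OF lhom_subgroup]
  and lhom_uminus = add_subgroupD(3)[OF lhom_subgroup]

lemma module_mapI:
  fixes M :: "('h::group_add \<Rightarrow>\<^sub>0 int, 'm::ab_group_add) lmod" and N :: "('h \<Rightarrow>\<^sub>0 int, 'n::ab_group_add) lmod"
  assumes M: "left_module M" and N: "left_module N"
    and f: "\<And>x. x \<in> carr M \<Longrightarrow> f x \<in> carr N" "\<And>x y. x \<in> carr M \<Longrightarrow> y \<in> carr M \<Longrightarrow> f (x + y) = f x + f y"
    and eq: "\<And>h x. x \<in> carr M \<Longrightarrow> f (smul M (frag_of h) x) = smul N (frag_of h) (f x)"
  shows "module_map M N f"
proof -
  have f0: "f 0 = 0" using f(2)[OF left_moduleD(1)[OF M] left_moduleD(1)[OF M]] by simp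
  have fd: "f (x - y) = f x - f y" if "x \<in> carr M" "y \<in> carr M" for x y
    using f(2)[of "x - y" y] left_module_diff[OF M that] that by simp
  have "f (smul M c x) = smul N c (f x)" if x: "x \<in> carr M" for c x
  proof (induction c rule: frag_induction[OF subset_UNIV])
    case 1 show ?case using x by (simp add: left_moduleD[OF M] left_moduleD[OF N] f f0)
  next
    case (2 h) show ?case by (rule eq[OF x])
  next
    case (3 a b)
    have "smul M (a - b) x = smul M a x - smul M b x" "smul N (a - b) (f x) = smul N a (f x) - smul N b (f x)"
      using left_moduleD(6)[OF M x, of "a - b" b] left_moduleD(6)[OF N f(1)[OF x], of "a - b" b] by simp_all
    with 3 show ?case using fd x by (simp add: left_moduleD[OF M])
  qed
  then show ?thesis using f by (simp add: module_map_def)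
qed

abbreviation "single \<equiv> Poly_Mapping.single"

lemma bar_module_mapI:
  fixes M :: "('h::group_add \<Rightarrow>\<^sub>0 int, 'm::ab_group_add) lmod" and N :: "('h \<Rightarrow>\<^sub>0 int, 'n::ab_group_add) lmod"
  assumes M: "left_module M" and N: "left_module N"
    and f: "\<And>x y. x \<in> carr (bar r M) \<Longrightarrow> y \<in> carr (bar r M) \<Longrightarrow> f (x + y) = f x + f y"
    and c: "\<And>\<sigma> m. length \<sigma> = Suc r \<Longrightarrow> m \<in> carr M \<Longrightarrow> f (single \<sigma> m) \<in> carr N"
    and eq: "\<And>h \<sigma> m. length \<sigma> = Suc r \<Longrightarrow> m \<in> carr M \<Longrightarrow>
      f (single (map ((+) h) \<sigma>) (smul M (frag_of h) m)) = smul N (frag_of h) (f (single \<sigma> m))"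
  shows "module_map (bar r M) N f"
proof (rule module_mapI[OF bar_left_module[OF M] N])
  have f0: "f 0 = 0" using f[OF bar_carr_0 bar_carr_0, OF M M] by simp
  show fc: "f x \<in> carr N" if "x \<in> carr (bar r M)" for x
    using that M by (induction rule: bar_induct) (auto simp: f0 left_moduleD[OF N] c f)
  show "f (smul (bar r M) (frag_of h) x) = smul N (frag_of h) (f x)" if "x \<in> carr (bar r M)" for h x
    using that M
  proof (induction rule: bar_induct)
    case zero show ?case by (simp add: bar_smul_zero f0 left_moduleD[OF N])
  next
    case (single \<sigma> m) then show ?case by (simp add: bar_smul_single[OF M] eq)
  next
    case (add u v) then show ?case
      by (simp add: bar_smul_add[OF M] f bar_smul_carr[OF M] left_moduleD(5)[OF N] fc)
  qed
qed (rule f)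

lemma add_extend_bar_add:
  assumes M: "left_module M"
    and F: "\<And>\<sigma> m m'. length \<sigma> = Suc r \<Longrightarrow> m \<in> carr M \<Longrightarrow> m' \<in> carr M \<Longrightarrow> F \<sigma> (m + m') = F \<sigma> m + (F \<sigma> m' :: 'b::ab_group_add)"
    and x: "x \<in> carr (bar r M)" and y: "y \<in> carr (bar r M)"
  shows "add_extend F (x + y) = add_extend F x + add_extend F y"
proof -
  let ?F = "\<lambda>\<sigma> m. if length \<sigma> = Suc r then F \<sigma> m else 0"
  have e: "add_extend F z = add_extend ?F z" if "z \<in> carr (bar r M)" for z
    unfolding add_extend_def using that by (intro sum.cong) (auto simp: bar_def)
  have "add_extend ?F (x + y) = add_extend ?F x + add_extend ?F y"
    by (rule add_extend_add_on[of "carr M"]) (use x y left_moduleD(1)[OF M] in \<open>auto simp: F bar_def\<close>)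
  then show ?thesis using x y by (simp add: e bar_carr_add[OF M])
qed

lemma add_extend_bar_single:
  assumes M: "left_module M"
    and F: "\<And>m m'. m \<in> carr M \<Longrightarrow> m' \<in> carr M \<Longrightarrow> F \<sigma> (m + m') = F \<sigma> m + (F \<sigma> m' :: 'b::ab_group_add)"
  shows "add_extend F (single \<sigma> m) = F \<sigma> m"
  using F[OF left_moduleD(1)[OF M] left_moduleD(1)[OF M]] by (intro add_extend_single) simp

text \<open>
  Every element of the bar resolution is in a unique way a sum of pure tensors of distinct tuples, so
  a cochain may be prescribed by its values on pure tensors.
\<close>

lemma bar_lift:
  fixes M :: "('h::group_add \<Rightarrow>\<^sub>0 int, 'm::ab_group_add) lmod" and N :: "('h \<Rightarrow>\<^sub>0 int, 'n::ab_group_add) lmod"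
  assumes M: "left_module M" and N: "left_module N"
    and F: "\<And>\<sigma> m m'. length \<sigma> = Suc r \<Longrightarrow> m \<in> carr M \<Longrightarrow> m' \<in> carr M \<Longrightarrow> F \<sigma> (m + m') = F \<sigma> m + F \<sigma> m'"
    and c: "\<And>\<sigma> m. length \<sigma> = Suc r \<Longrightarrow> m \<in> carr M \<Longrightarrow> F \<sigma> m \<in> carr N"
    and eq: "\<And>h \<sigma> m. length \<sigma> = Suc r \<Longrightarrow> m \<in> carr M \<Longrightarrow>
      F (map ((+) h) \<sigma>) (smul M (frag_of h) m) = smul N (frag_of h) (F \<sigma> m)"
  shows "restrict0 (carr (bar r M)) (add_extend F) \<in> lhom (bar r M) N"
    and "\<And>\<sigma> m. length \<sigma> = Suc r \<Longrightarrow> m \<in> carr M \<Longrightarrow>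
      restrict0 (carr (bar r M)) (add_extend F) (single \<sigma> m) = F \<sigma> m"
proof -
  have s: "add_extend F (single \<sigma> m) = F \<sigma> m" if "length \<sigma> = Suc r" for \<sigma> m
    by (rule add_extend_bar_single[OF M]) (rule F[OF that])
  show "restrict0 (carr (bar r M)) (add_extend F) \<in> lhom (bar r M) N"
    unfolding module_map_restrict0[OF bar_left_module[OF M]]
    by (rule bar_module_mapI[OF M N]) (simp_all add: add_extend_bar_add[OF M F] s c eq)
  show "restrict0 (carr (bar r M)) (add_extend F) (single \<sigma> m) = F \<sigma> m"
    if "length \<sigma> = Suc r" "m \<in> carr M" for \<sigma> m
    using that by (simp add: restrict0_def s bar_carr_single[OF M])
qed

lemma additive_bar_eqI:
  assumes M: "left_module M" and x: "x \<in> carr (bar r M)"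
    and f: "\<And>x y. x \<in> carr (bar r M) \<Longrightarrow> y \<in> carr (bar r M) \<Longrightarrow> f (x + y) = f x + (f y :: 'b::ab_group_add)"
    and g: "\<And>x y. x \<in> carr (bar r M) \<Longrightarrow> y \<in> carr (bar r M) \<Longrightarrow> g (x + y) = g x + g y"
    and eq: "\<And>\<sigma> m. length \<sigma> = Suc r \<Longrightarrow> m \<in> carr M \<Longrightarrow> f (single \<sigma> m) = g (single \<sigma> m)"
  shows "f x = g x"
  using x M
proof (induction rule: bar_induct)
  case zero
  show ?case using f[OF bar_carr_0 bar_carr_0, OF M M] g[OF bar_carr_0 bar_carr_0, OF M M] by simp
qed (simp_all add: f g eq)

lemma lhom_bar_eqI:
  assumes M: "left_module M" and f: "f \<in> lhom (bar r M) N" and g: "g \<in> lhom (bar r M) N"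
    and eq: "\<And>\<sigma> m. length \<sigma> = Suc r \<Longrightarrow> m \<in> carr M \<Longrightarrow> f (single \<sigma> m) = g (single \<sigma> m)"
  shows "f = g"
proof
  fix x show "f x = g x"
  proof (cases "x \<in> carr (bar r M)")
    case True
    show ?thesis by (rule additive_bar_eqI[OF M True, of f g]) (use f g eq in \<open>auto simp: lhom_def\<close>)
  qed (use f g in \<open>simp add: lhom_def\<close>)
qed

lemma lhom_bar_free_eqI:
  fixes M :: "('h::group_add \<Rightarrow>\<^sub>0 int, 'x \<Rightarrow>\<^sub>0 int) lmod"
  assumes M: "left_module M" and W: "carr M = {u. Poly_Mapping.keys u \<subseteq> W}"
    and f: "f \<in> lhom (bar r M) N" and g: "g \<in> lhom (bar r M) N"
    and eq: "\<And>\<sigma> w. length \<sigma> = Suc r \<Longrightarrow> w \<in> W \<Longrightarrow> f (single \<sigma> (frag_of w)) = g (single \<sigma> (frag_of w))"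
  shows "f = g"
proof (rule lhom_bar_eqI[OF M f g])
  fix \<sigma> :: "'h list" and m assume \<sigma>: "length \<sigma> = Suc r" and m: "m \<in> carr M"
  have c: "single \<sigma> m \<in> carr (bar r M)" if "m \<in> carr M" for m
    using that \<sigma> by (intro bar_carr_single[OF M])
  have "m \<in> carr M \<and> f (single \<sigma> m) = g (single \<sigma> m)"
  proof (rule frag_induction[of m W])
    show "Poly_Mapping.keys m \<subseteq> W" using m by (simp add: W)
    show "0 \<in> carr M \<and> f (single \<sigma> 0) = g (single \<sigma> 0)"
      using lhom_apply_zero[OF f bar_left_module[OF M]]
        lhom_apply_zero[OF g bar_left_module[OF M]] left_moduleD(1)[OF M] by simp
    show "a - b \<in> carr M \<and> f (single \<sigma> (a - b)) = g (single \<sigma> (a - b))"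
      if "a \<in> carr M \<and> f (single \<sigma> a) = g (single \<sigma> a)"
        "b \<in> carr M \<and> f (single \<sigma> b) = g (single \<sigma> b)" for a b
      using that left_module_diff[OF M, of a b]
        module_map_minus(3)[OF lhom_module_map[OF f] bar_left_module[OF M], of "single \<sigma> a" "single \<sigma> b"]
        module_map_minus(3)[OF lhom_module_map[OF g] bar_left_module[OF M], of "single \<sigma> a" "single \<sigma> b"]
      by (simp add: single_diff c)
  qed (use eq[OF \<sigma>] W in auto)
  then show "f (single \<sigma> m) = g (single \<sigma> m)" by simp
qed

section \<open>Cochains and Ext\<close>

lemma boundary_map: "left_module M \<Longrightarrow> module_map (bar (Suc r) M) (bar r M) boundary"
  using boundary_hom module_map_restrict0 bar_left_module by blast

lemma coboundary_hom: "left_module M \<Longrightarrow> \<phi> \<in> lhom (bar r M) A \<Longrightarrow> coboundary r M \<phi> \<in> lhom (bar (Suc r) M) A"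
  unfolding coboundary_def comp_def
  by (simp add: module_map_restrict0 bar_left_module module_map_comp[OF boundary_map lhom_module_map])

lemma coboundary_diff: "coboundary r M (\<phi> - \<psi>) = coboundary r M \<phi> - coboundary r M \<psi>"
  by (auto simp: coboundary_def restrict0_def)

lemma coboundary_uminus: "coboundary r M (- \<phi>) = - coboundary r M \<phi>"
  by (auto simp: coboundary_def restrict0_def)

lemma coboundary_0: "coboundary r M 0 = 0"
  by (auto simp: coboundary_def restrict0_def)

lemma coboundary_coboundary:
  assumes M: "left_module M" and \<phi>: "\<phi> \<in> lhom (bar r M) A"
  shows "coboundary (Suc r) M (coboundary r M \<phi>) = 0"
proof -
  have "\<phi> 0 = 0" using lhom_apply_zero[OF \<phi> bar_left_module[OF M]] .
  then show ?thesis by (auto simp: coboundary_def restrict0_def boundary_boundary)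
qed

lemma cocycles_subgroup: assumes "left_module A" shows "add_subgroup (cocycles r M A)"
  using lhom_subgroup[OF assms, of "bar r M"]
  by (auto simp: add_subgroup_def cocycles_def coboundary_diff coboundary_0)

lemmas cocycles_zero = add_subgroupD(1)[OF cocycles_subgroup]
  and cocycles_diff = add_subgroupD(2)[OF cocycles_subgroup]
  and cocycles_add = add_subgroupD(4)[OF cocycles_subgroup]

lemma coboundaries_subgroup: assumes "left_module A" shows "add_subgroup (coboundaries r M A)"
proof (cases r)
  case (Suc q)
  have "0 \<in> coboundary q M ` lhom (bar q M) A"
    using lhom_zero[OF assms] coboundary_0 by (metis image_eqI)
  moreover have "coboundary q M \<phi> - coboundary q M \<psi> \<in> coboundary q M ` lhom (bar q M) A"
    if "\<phi> \<in> lhom (bar q M) A" "\<psi> \<in> lhom (bar q M) A" for \<phi> \<psi>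
    using lhom_diff[OF assms that] coboundary_diff by (metis image_eqI)
  ultimately show ?thesis by (auto simp: add_subgroup_def coboundaries_def Suc)
qed (simp add: add_subgroup_def coboundaries_def)

lemmas coboundaries_zero = add_subgroupD(1)[OF coboundaries_subgroup]
  and coboundaries_add = add_subgroupD(4)[OF coboundaries_subgroup]

lemma coboundaries_cocycles:
  assumes "left_module M" "left_module A" shows "coboundaries r M A \<subseteq> cocycles r M A"
  using assms cocycles_zero[OF assms(2)]
  by (cases r) (auto simp: coboundaries_def cocycles_def coboundary_hom coboundary_coboundary)

lemma cls_eq: "cls r M A \<phi> = (\<lambda>b. b + \<phi>) ` coboundaries r M A"
  by (simp add: cls_def coset_add_group)

lemma mem_cls_iff: "\<psi> \<in> cls r M A \<phi> \<longleftrightarrow> \<psi> - \<phi> \<in> coboundaries r M A"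
  by (simp add: cls_eq mem_coset_iff)

lemma cls_eq_iff: "left_module A \<Longrightarrow> cls r M A \<phi> = cls r M A \<psi> \<longleftrightarrow> \<phi> - \<psi> \<in> coboundaries r M A"
  by (simp add: cls_eq coset_eq_iff coboundaries_subgroup)

lemma cls_self: "left_module A \<Longrightarrow> \<phi> \<in> cls r M A \<phi>"
  by (simp add: mem_cls_iff add_subgroupD[OF coboundaries_subgroup])

lemma Ext_one: "\<one>\<^bsub>Ext r M A\<^esub> = coboundaries r M A"
  by (simp add: Ext_def)

lemma cls_one_iff: "left_module A \<Longrightarrow> cls r M A \<phi> = \<one>\<^bsub>Ext r M A\<^esub> \<longleftrightarrow> \<phi> \<in> coboundaries r M A"
  using cls_eq_iff[of A r M \<phi> 0] by (simp add: Ext_one cls_eq)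

lemma Ext_carrier: "carrier (Ext r M A) = cls r M A ` cocycles r M A"
  by (simp add: Ext_def carrier_FactGroup cls_def[abs_def]) (simp add: add_group_def)

lemma Ext_group:
  assumes M: "left_module M" and A: "left_module A"
  shows "comm_group (Ext r M A)" "pairwise disjnt (carrier (Ext r M A))" "{} \<notin> carrier (Ext r M A)"
    "\<And>\<phi> \<psi>. \<phi> \<in> cocycles r M A \<Longrightarrow> \<psi> \<in> cocycles r M A \<Longrightarrow>
       cls r M A \<phi> \<otimes>\<^bsub>Ext r M A\<^esub> cls r M A \<psi> = cls r M A (\<phi> + \<psi>)"
  using quotient_group[OF cocycles_subgroup[OF A] coboundaries_subgroup[OF A] coboundaries_cocycles[OF M A]]
  by (simp_all add: Ext_def cls_eq)

text \<open>
  Maps between Ext groups are defined as \<open>the_elem\<close> of the set of images of all representatives.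
  Respecting coboundaries is what makes this set a singleton.
\<close>

lemma the_elem_image_cls:
  assumes A: "left_module A" "left_module A'"
    and f: "\<And>\<psi>. \<psi> - \<phi> \<in> coboundaries r M A \<Longrightarrow> f \<psi> - f \<phi> \<in> coboundaries r' M' A'"
  shows "the_elem ((\<lambda>\<phi>. cls r' M' A' (f \<phi>)) ` cls r M A \<phi>) = cls r' M' A' (f \<phi>)"
proof -
  have "cls r' M' A' (f \<psi>) = cls r' M' A' (f \<phi>)" if "\<psi> \<in> cls r M A \<phi>" for \<psi>
    using that f by (simp add: mem_cls_iff cls_eq_iff[OF A(2)])
  then have "(\<lambda>\<phi>. cls r' M' A' (f \<phi>)) ` cls r M A \<phi> = {cls r' M' A' (f \<phi>)}"
    using cls_self[OF A(1), of \<phi> r M] by blast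
  then show ?thesis by simp
qed

section \<open>Functoriality in the first variable\<close>

lemma lookup_map_0: "f 0 = 0 \<Longrightarrow> Poly_Mapping.lookup (Poly_Mapping.map f x) k = f (Poly_Mapping.lookup x k)"
  by (auto simp: Poly_Mapping.map.rep_eq when_def)

lemma map_id: "Poly_Mapping.map id x = x"
  by (rule poly_mapping_eqI) (simp add: lookup_map_0)

lemma map_single_0: "f 0 = 0 \<Longrightarrow> Poly_Mapping.map f (single \<sigma> m) = single \<sigma> (f m)"
  by (rule poly_mapping_eqI) (simp add: lookup_map_0 lookup_single when_def)

lemma map_bar_add:
  assumes M: "left_module M" and f: "module_map M N f" and x: "x \<in> carr (bar r M)" and y: "y \<in> carr (bar r M)"
  shows "Poly_Mapping.map f (x + y) = Poly_Mapping.map f x + Poly_Mapping.map f y"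
  by (rule poly_mapping_eqI)
     (use x y module_map_minus(1)[OF f M] in \<open>simp add: lookup_map_0 lookup_add module_mapD[OF f] bar_def\<close>)

lemma module_map_bar:
  assumes M: "left_module M" and N: "left_module N" and f: "module_map M N f"
  shows "module_map (bar r M) (bar r N) (Poly_Mapping.map f)"
proof -
  note f0 = module_map_minus(1)[OF f M]
  show ?thesis
    by (rule bar_module_mapI[OF M bar_left_module[OF N]])
       (simp_all add: map_bar_add[OF M f] map_single_0[of f, OF f0] bar_carr_single[OF N] bar_smul_single[OF N] module_mapD[OF f])
qed

lemma map_boundary:
  assumes M: "left_module M" and N: "left_module N" and f: "module_map M N f" and x: "x \<in> carr (bar (Suc r) M)"
  shows "Poly_Mapping.map f (boundary x) = boundary (Poly_Mapping.map f x)"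
proof (rule additive_bar_eqI[OF M x])
  note f0 = module_map_minus(1)[OF f M]
  note bm = module_mapD[OF boundary_map[OF M]]
  show "Poly_Mapping.map f (boundary (u + v)) = Poly_Mapping.map f (boundary u) + Poly_Mapping.map f (boundary v)"
    if "u \<in> carr (bar (Suc r) M)" "v \<in> carr (bar (Suc r) M)" for u v
    using that by (simp add: boundary_add map_bar_add[OF M f, of _ r] bm)
  show "boundary (Poly_Mapping.map f (u + v)) = boundary (Poly_Mapping.map f u) + boundary (Poly_Mapping.map f v)"
    if "u \<in> carr (bar (Suc r) M)" "v \<in> carr (bar (Suc r) M)" for u v
    using that by (simp add: boundary_add map_bar_add[OF M f])
  fix \<sigma> :: "'a list" and m assume \<sigma>: "length \<sigma> = Suc (Suc r)" and m: "m \<in> carr M"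
  show "Poly_Mapping.map f (boundary (single \<sigma> m)) = boundary (Poly_Mapping.map f (single \<sigma> m))"
  proof (rule poly_mapping_eqI)
    fix \<tau>
    have "f (\<Sum>i\<in>K. g i) = (\<Sum>i\<in>K. f (g i)) \<and> (\<Sum>i\<in>K. g i) \<in> carr M" if "finite K" "\<And>i. g i \<in> carr M" for K :: "nat set" and g
      using that by (induction K rule: finite_induct) (auto simp: f0 module_mapD[OF f] left_moduleD[OF M])
    from this[of "{..<length \<sigma>}" "\<lambda>i. Poly_Mapping.lookup (single (face i \<sigma>) (if even i then m else - m)) \<tau>"]
    show "Poly_Mapping.lookup (Poly_Mapping.map f (boundary (single \<sigma> m))) \<tau> =
      Poly_Mapping.lookup (boundary (Poly_Mapping.map f (single \<sigma> m))) \<tau>"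
      using m by (auto simp: lookup_map_0[of f, OF f0] map_single_0[of f, OF f0] boundary_single lookup_sum lookup_single when_def
        left_moduleD[OF M] f0 module_map_minus[OF f M] intro!: sum.cong)
  qed
qed

lemma pullback_hom:
  assumes "left_module M" "left_module N" "module_map M N f" "\<phi> \<in> lhom (bar r N) A"
  shows "pullback r M f \<phi> \<in> lhom (bar r M) A"
  unfolding pullback_def
  by (simp add: module_map_restrict0 bar_left_module assms(1) module_map_comp[OF module_map_bar[OF assms(1-3)] lhom_module_map[OF assms(4)]])

lemma pullback_diff: "pullback r M f (\<phi> - \<psi>) = pullback r M f \<phi> - pullback r M f \<psi>"
  and pullback_add: "pullback r M f (\<phi> + \<psi>) = pullback r M f \<phi> + pullback r M f \<psi>"
  and pullback_0: "pullback r M f 0 = 0"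
  by (auto simp: pullback_def restrict0_def)

lemma pullback_coboundary:
  assumes M: "left_module M" and N: "left_module N" and f: "module_map M N f"
  shows "pullback (Suc r) M f (coboundary r N \<phi>) = coboundary r M (pullback r M f \<phi>)"
  using module_mapD(1)[OF module_map_bar[OF M N f]] module_mapD(1)[OF boundary_map[OF M]] map_boundary[OF M N f]
  by (auto simp: pullback_def coboundary_def restrict0_def fun_eq_iff)

lemma pullback_cocycles:
  assumes M: "left_module M" and N: "left_module N" and f: "module_map M N f" and \<phi>: "\<phi> \<in> cocycles r N A"
  shows "pullback r M f \<phi> \<in> cocycles r M A"
  using \<phi> pullback_coboundary[OF M N f, of r \<phi>] by (simp add: cocycles_def pullback_0 pullback_hom[OF M N f])

lemma pullback_coboundaries:
  assumes M: "left_module M" and N: "left_module N" and f: "module_map M N f" and \<phi>: "\<phi> \<in> coboundaries r N A"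
  shows "pullback r M f \<phi> \<in> coboundaries r M A"
proof (cases r)
  case 0
  then show ?thesis using \<phi> by (simp add: coboundaries_def pullback_0)
next
  case (Suc q)
  then obtain \<theta> where \<theta>: "\<theta> \<in> lhom (bar q N) A" "\<phi> = coboundary q N \<theta>"
    using \<phi> by (auto simp: coboundaries_def)
  then show ?thesis
    using Suc pullback_hom[OF M N f \<theta>(1)] pullback_coboundary[OF M N f, of q \<theta>] by (simp add: coboundaries_def)
qed

lemma Ext_map_cls:
  assumes M: "left_module M" and N: "left_module N" and A: "left_module A" and f: "module_map M N f"
  shows "Ext_map r M f A (cls r N A \<phi>) = cls r M A (pullback r M f \<phi>)"
  unfolding Ext_map_def
  by (rule the_elem_image_cls[OF A A]) (simp add: pullback_diff[symmetric] pullback_coboundaries[OF M N f])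

lemma Ext_map_hom:
  assumes M: "left_module M" and N: "left_module N" and A: "left_module A" and f: "module_map M N f"
  shows "Ext_map r M f A \<in> hom (Ext r N A) (Ext r M A)"
proof (rule homI)
  fix X assume "X \<in> carrier (Ext r N A)"
  then show "Ext_map r M f A X \<in> carrier (Ext r M A)"
    by (auto simp: Ext_carrier Ext_map_cls[OF M N A f] pullback_cocycles[OF M N f])
next
  fix X Y assume "X \<in> carrier (Ext r N A)" "Y \<in> carrier (Ext r N A)"
  then show "Ext_map r M f A (X \<otimes>\<^bsub>Ext r N A\<^esub> Y) = Ext_map r M f A X \<otimes>\<^bsub>Ext r M A\<^esub> Ext_map r M f A Y"
    by (auto simp: Ext_carrier Ext_map_cls[OF M N A f] pullback_cocycles[OF M N f] Ext_group(4)[OF N A] Ext_group(4)[OF M A] pullback_add)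
qed

section \<open>The long exact sequence of Ext\<close>

text \<open>
  A short exact sequence \<open>0 \<rightarrow> M1 \<rightarrow> M \<rightarrow> M2 \<rightarrow> 0\<close> whose first map is an inclusion. Projectivity enters
  only through the module sections of \<open>bar r M \<rightarrow> bar r M2\<close>: with them cochains extend from \<open>M1\<close> to
  \<open>M\<close>, and a cochain on \<open>M\<close> that vanishes on \<open>M1\<close> descends to \<open>M2\<close>.
\<close>

locale bar_split_sequence =
  fixes M1 M :: "('h::group_add \<Rightarrow>\<^sub>0 int, 'm::ab_group_add) lmod"
    and M2 :: "('h \<Rightarrow>\<^sub>0 int, 'n::ab_group_add) lmod" and e :: "'m \<Rightarrow> 'n"
    and A :: "('h \<Rightarrow>\<^sub>0 int, 'a::ab_group_add) lmod"
  assumes M1: "left_module M1" and M: "left_module M" and M2: "left_module M2" and A: "left_module A"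
    and M1_carr: "carr M1 = {x \<in> carr M. e x = 0}" and M1_smul: "smul M1 = smul M"
    and e: "module_map M M2 e"
    and bar_section: "\<And>r. \<exists>s\<in>lhom (bar r M2) (bar r M). \<forall>x\<in>carr (bar r M2). Poly_Mapping.map e (s x) = x"
begin

lemma inclusion: "module_map M1 M id"
  by (simp add: module_map_def M1_carr M1_smul)

lemmas e0 = module_map_minus(1)[OF e M]
lemmas e_bar = module_map_bar[OF M M2 e]

lemma bar_M1: "carr (bar r M1) = {x \<in> carr (bar r M). Poly_Mapping.map e x = 0}"
proof -
  have "Poly_Mapping.map e x = 0 \<longleftrightarrow> (\<forall>\<sigma>. e (Poly_Mapping.lookup x \<sigma>) = 0)" for x
    by (simp add: poly_mapping_eq_iff lookup_map_0[of e, OF e0] fun_eq_iff)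
  then show ?thesis by (auto simp: bar_def M1_carr)
qed

lemma bar_M1_smul: "smul (bar r M1) = smul (bar r M)"
  by (simp add: bar_def M1_smul)

lemma pullback_id: "pullback r M1 id \<psi> = restrict0 (carr (bar r M1)) \<psi>"
  by (simp add: pullback_def map_id)

lemma pullback_id_apply: "x \<in> carr (bar r M1) \<Longrightarrow> pullback r M1 id \<psi> x = \<psi> x"
  by (simp add: pullback_id restrict0_def)

lemma pullback_e_apply: "x \<in> carr (bar r M) \<Longrightarrow> pullback r M e \<chi> x = \<chi> (Poly_Mapping.map e x)"
  by (simp add: pullback_def restrict0_def)

lemma extend_cochain:
  assumes \<phi>: "\<phi> \<in> lhom (bar r M1) A"
  obtains \<psi> where "\<psi> \<in> lhom (bar r M) A" "pullback r M1 id \<psi> = \<phi>"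
proof -
  obtain s where s: "s \<in> lhom (bar r M2) (bar r M)" "\<And>x. x \<in> carr (bar r M2) \<Longrightarrow> Poly_Mapping.map e (s x) = x"
    using bar_section by blast
  note sm = lhom_module_map[OF s(1)]
  let ?\<rho> = "\<lambda>x. x - s (Poly_Mapping.map e x)"
  have "module_map (bar r M) (bar r M) (\<lambda>x. x)" by (simp add: module_map_def)
  then have \<rho>: "module_map (bar r M) (bar r M) ?\<rho>"
    using module_map_diff[OF bar_left_module[OF M]] module_map_comp[OF e_bar sm] by blast
  have "Poly_Mapping.map e (?\<rho> x) = 0" if "x \<in> carr (bar r M)" for x
    using that s(2) module_mapD(1)[OF e_bar that] module_mapD(1)[OF sm]
    by (simp add: module_map_minus(3)[OF e_bar bar_left_module[OF M]])
  then have "module_map (bar r M) (bar r M1) ?\<rho>"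
    using \<rho> by (simp add: module_map_def bar_M1 bar_M1_smul)
  then have "restrict0 (carr (bar r M)) (\<lambda>x. \<phi> (?\<rho> x)) \<in> lhom (bar r M) A"
    using module_map_comp[OF _ lhom_module_map[OF \<phi>]]
    by (simp add: module_map_restrict0 bar_left_module M)
  moreover have "pullback r M1 id (restrict0 (carr (bar r M)) (\<lambda>x. \<phi> (?\<rho> x))) = \<phi>"
  proof
    fix x
    have "s 0 = 0" by (rule module_map_minus(1)[OF sm bar_left_module[OF M2]])
    then show "pullback r M1 id (restrict0 (carr (bar r M)) (\<lambda>x. \<phi> (?\<rho> x))) x = \<phi> x"
      using \<phi> by (auto simp: pullback_id restrict0_def bar_M1 lhom_def)
  qed
  ultimately show ?thesis by (rule that)
qed

lemma pullback_e_inject: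
  assumes \<chi>: "\<chi> \<in> lhom (bar r M2) A" and 0: "pullback r M e \<chi> = 0"
  shows "\<chi> = 0"
proof
  fix x show "\<chi> x = 0 x"
  proof (cases "x \<in> carr (bar r M2)")
    case True
    obtain s where s: "s \<in> lhom (bar r M2) (bar r M)" "\<And>x. x \<in> carr (bar r M2) \<Longrightarrow> Poly_Mapping.map e (s x) = x"
      using bar_section by blast
    have "s x \<in> carr (bar r M)" using module_mapD(1)[OF lhom_module_map[OF s(1)] True] .
    from pullback_e_apply[OF this, of \<chi>] show ?thesis using 0 s(2)[OF True] by simp
  qed (use \<chi> in \<open>simp add: lhom_def\<close>)
qed

lemma descend_cochain:
  assumes \<psi>: "\<psi> \<in> lhom (bar r M) A" and 0: "pullback r M1 id \<psi> = 0"
  obtains \<chi> where "\<chi> \<in> lhom (bar r M2) A" "pullback r M e \<chi> = \<psi>"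
proof -
  obtain s where s: "s \<in> lhom (bar r M2) (bar r M)" "\<And>x. x \<in> carr (bar r M2) \<Longrightarrow> Poly_Mapping.map e (s x) = x"
    using bar_section by blast
  note sm = lhom_module_map[OF s(1)] and \<psi>m = lhom_module_map[OF \<psi>]
  let ?\<chi> = "restrict0 (carr (bar r M2)) (\<lambda>x. \<psi> (s x))"
  have "?\<chi> \<in> lhom (bar r M2) A"
    using module_map_comp[OF sm \<psi>m] by (simp add: module_map_restrict0 bar_left_module M2)
  moreover have "pullback r M e ?\<chi> = \<psi>"
  proof
    fix x show "pullback r M e ?\<chi> x = \<psi> x"
    proof (cases "x \<in> carr (bar r M)")
      case True
      let ?y = "s (Poly_Mapping.map e x)"
      have ex: "Poly_Mapping.map e x \<in> carr (bar r M2)" by (rule module_mapD(1)[OF e_bar True])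
      then have y: "?y \<in> carr (bar r M)" by (rule module_mapD(1)[OF sm])
      have "x - ?y \<in> carr (bar r M1)"
        using s(2)[OF ex] True y
        by (simp add: bar_M1 left_module_diff bar_left_module M module_map_minus(3)[OF e_bar bar_left_module[OF M]])
      then have "\<psi> (x - ?y) = 0" using pullback_id_apply[of "x - ?y" r \<psi>] 0 by simp
      then show ?thesis
        using True ex module_map_minus(3)[OF \<psi>m bar_left_module[OF M] True y]
        by (simp add: pullback_e_apply restrict0_def)
    qed (use \<psi> in \<open>simp add: pullback_def restrict0_def lhom_def\<close>)
  qed
  ultimately show ?thesis by (rule that)
qed

lemmas cb_e = pullback_coboundary[OF M M2 e]
lemmas cb_id = pullback_coboundary[OF M1 M inclusion]
lemmas cA = add_subgroupD[OF lhom_subgroup[OF A]]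

lemma pullback_id_e: "pullback r M1 id (pullback r M e \<chi>) = 0" if "\<chi> \<in> lhom (bar r M2) A"
proof
  fix x
  have "\<chi> 0 = 0" by (rule lhom_apply_zero[OF that bar_left_module[OF M2]])
  then show "pullback r M1 id (pullback r M e \<chi>) x = 0 x"
    by (auto simp: pullback_id restrict0_def bar_M1 pullback_e_apply)
qed

text \<open>
  The zigzag of the snake lemma: \<open>\<psi>\<close> extends \<open>\<phi>\<close>, and its coboundary comes from \<open>\<chi>\<close>.
\<close>

definition lift :: "nat \<Rightarrow> (('h list \<Rightarrow>\<^sub>0 'm) \<Rightarrow> 'a) \<Rightarrow> (('h list \<Rightarrow>\<^sub>0 'm) \<Rightarrow> 'a) \<Rightarrow> (('h list \<Rightarrow>\<^sub>0 'n) \<Rightarrow> 'a) \<Rightarrow> bool" where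
  "lift r \<phi> \<psi> \<chi> \<longleftrightarrow> \<psi> \<in> lhom (bar r M) A \<and> pullback r M1 id \<psi> = \<phi> \<and>
     \<chi> \<in> cocycles (Suc r) M2 A \<and> pullback (Suc r) M e \<chi> = coboundary r M \<psi>"

lemma lift_exists:
  assumes \<phi>: "\<phi> \<in> cocycles r M1 A"
  obtains \<psi> \<chi> where "lift r \<phi> \<psi> \<chi>"
proof -
  have \<phi>': "\<phi> \<in> lhom (bar r M1) A" "coboundary r M1 \<phi> = 0" using \<phi> by (auto simp: cocycles_def)
  obtain \<psi> where \<psi>: "\<psi> \<in> lhom (bar r M) A" "pullback r M1 id \<psi> = \<phi>" by (rule extend_cochain[OF \<phi>'(1)])
  have "pullback (Suc r) M1 id (coboundary r M \<psi>) = 0"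
    by (simp add: cb_id \<psi>(2) \<phi>'(2))
  then obtain \<chi> where \<chi>: "\<chi> \<in> lhom (bar (Suc r) M2) A" "pullback (Suc r) M e \<chi> = coboundary r M \<psi>"
    using descend_cochain[OF coboundary_hom[OF M \<psi>(1)]] by blast
  have "coboundary (Suc r) M2 \<chi> = 0"
    by (rule pullback_e_inject[OF coboundary_hom[OF M2 \<chi>(1)]])
       (simp add: cb_e \<chi>(2) coboundary_coboundary[OF M \<psi>(1)])
  with \<psi> \<chi> that show ?thesis by (simp add: lift_def cocycles_def)
qed

lemma lift_diff: "lift r \<phi> \<psi> \<chi> \<Longrightarrow> lift r \<phi>' \<psi>' \<chi>' \<Longrightarrow> lift r (\<phi> - \<phi>') (\<psi> - \<psi>') (\<chi> - \<chi>')"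
  by (simp add: lift_def cA cocycles_diff[OF A] pullback_diff coboundary_diff)

text \<open>
  A coboundary \<open>\<phi>\<close> also extends to a coboundary \<open>\<psi>'\<close>. Then \<open>\<psi> - \<psi>'\<close> vanishes on \<open>M1\<close> and has the same
  coboundary as \<open>\<psi>\<close>, so it descends to a cochain with coboundary \<open>\<chi>\<close>. Applied to differences of
  zigzags this shows that the connecting homomorphism is well defined.
\<close>

lemma lift_coboundary:
  assumes "\<phi> \<in> coboundaries r M1 A" "lift r \<phi> \<psi> \<chi>"
  shows "\<chi> \<in> coboundaries (Suc r) M2 A"
proof -
  have l: "\<psi> \<in> lhom (bar r M) A" "pullback r M1 id \<psi> = \<phi>" "\<chi> \<in> cocycles (Suc r) M2 A"
    "pullback (Suc r) M e \<chi> = coboundary r M \<psi>" using assms(2) by (auto simp: lift_def)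
  have "\<exists>\<psi>'\<in>lhom (bar r M) A. pullback r M1 id \<psi>' = \<phi> \<and> coboundary r M \<psi>' = 0"
  proof (cases r)
    case 0
    then show ?thesis using assms(1)
      by (intro bexI[of _ 0]) (auto simp: coboundaries_def coboundary_0 pullback_0 cA)
  next
    case (Suc q)
    then obtain \<theta> where \<theta>: "\<theta> \<in> lhom (bar q M1) A" "\<phi> = coboundary q M1 \<theta>"
      using assms(1) by (auto simp: coboundaries_def)
    obtain \<theta>' where "\<theta>' \<in> lhom (bar q M) A" "pullback q M1 id \<theta>' = \<theta>" by (rule extend_cochain[OF \<theta>(1)])
    then show ?thesis using \<theta>(2) Suc
      by (intro bexI[of _ "coboundary q M \<theta>'"]) (auto simp: cb_id coboundary_coboundary[OF M] coboundary_hom[OF M])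
  qed
  then obtain \<psi>' where \<psi>': "\<psi>' \<in> lhom (bar r M) A" "pullback r M1 id \<psi>' = \<phi>" "coboundary r M \<psi>' = 0" by blast
  obtain \<omega> where \<omega>: "\<omega> \<in> lhom (bar r M2) A" "pullback r M e \<omega> = \<psi> - \<psi>'"
    by (rule descend_cochain[of "\<psi> - \<psi>'" r]) (simp_all add: cA l \<psi>' pullback_diff)
  have "\<chi> - coboundary r M2 \<omega> = 0"
    using l(3) by (intro pullback_e_inject[of _ "Suc r"])
      (auto simp: cocycles_def cA coboundary_hom[OF M2 \<omega>(1)] pullback_diff cb_e \<omega>(2) coboundary_diff l(4) \<psi>'(3))
  then show ?thesis using \<omega>(1) by (auto simp: coboundaries_def)
qed

abbreviation conn where "conn r \<equiv> connecting r M1 id M e M2 A"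

lemma connecting_cls:
  assumes l: "lift r \<phi> \<psi> \<chi>"
  shows "conn r (cls r M1 A \<phi>) = cls (Suc r) M2 A \<chi>"
proof -
  have "cls (Suc r) M2 A \<chi>' = cls (Suc r) M2 A \<chi>" if "\<phi>' \<in> cls r M1 A \<phi>" "lift r \<phi>' \<psi>' \<chi>'" for \<phi>' \<psi>' \<chi>'
    using lift_coboundary[OF _ lift_diff[OF that(2) l]] that(1) by (simp add: mem_cls_iff cls_eq_iff[OF A])
  then have "{cls (Suc r) M2 A \<chi>' | \<phi>' \<psi>' \<chi>'. \<phi>' \<in> cls r M1 A \<phi> \<and> \<psi>' \<in> lhom (bar r M) A \<and> pullback r M1 id \<psi>' = \<phi>' \<and>
        \<chi>' \<in> cocycles (Suc r) M2 A \<and> pullback (Suc r) M e \<chi>' = coboundary r M \<psi>'} = {cls (Suc r) M2 A \<chi>}"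
    using cls_self[OF A, of \<phi> r M1] l unfolding lift_def by blast
  then show ?thesis by (simp add: connecting_def)
qed

lemma connecting_hom: "conn r \<in> hom (Ext r M1 A) (Ext (Suc r) M2 A)"
proof (rule homI)
  fix X assume "X \<in> carrier (Ext r M1 A)"
  then obtain \<phi> where \<phi>: "\<phi> \<in> cocycles r M1 A" "X = cls r M1 A \<phi>" by (auto simp: Ext_carrier)
  obtain \<psi> \<chi> where "lift r \<phi> \<psi> \<chi>" by (rule lift_exists[OF \<phi>(1)])
  then show "conn r X \<in> carrier (Ext (Suc r) M2 A)"
    using connecting_cls \<phi>(2) by (auto simp: Ext_carrier lift_def)
next
  fix X Y assume "X \<in> carrier (Ext r M1 A)" "Y \<in> carrier (Ext r M1 A)"
  then obtain \<phi> \<phi>' where \<phi>: "\<phi> \<in> cocycles r M1 A" "X = cls r M1 A \<phi>" "\<phi>' \<in> cocycles r M1 A" "Y = cls r M1 A \<phi>'"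
    by (auto simp: Ext_carrier)
  obtain \<psi> \<chi> where l: "lift r \<phi> \<psi> \<chi>" by (rule lift_exists[OF \<phi>(1)])
  obtain \<psi>' \<chi>' where l': "lift r \<phi>' \<psi>' \<chi>'" by (rule lift_exists[OF \<phi>(3)])
  have "coboundary r M (\<psi> + \<psi>') = coboundary r M \<psi> + coboundary r M \<psi>'"
    using coboundary_diff[of r M \<psi> "- \<psi>'"] by (simp add: coboundary_uminus)
  then have l'': "lift r (\<phi> + \<phi>') (\<psi> + \<psi>') (\<chi> + \<chi>')"
    using l l' by (simp add: lift_def cA cocycles_add[OF A] pullback_add)
  have "\<chi> \<in> cocycles (Suc r) M2 A" "\<chi>' \<in> cocycles (Suc r) M2 A" using l l' by (simp_all add: lift_def)
  then show "conn r (X \<otimes>\<^bsub>Ext r M1 A\<^esub> Y) = conn r X \<otimes>\<^bsub>Ext (Suc r) M2 A\<^esub> conn r Y"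
    using \<phi> by (simp add: Ext_group(4)[OF M1 A] Ext_group(4)[OF M2 A] connecting_cls[OF l] connecting_cls[OF l'] connecting_cls[OF l''])
qed

lemma exact_at_M2:
  assumes \<chi>: "\<chi> \<in> cocycles (Suc r) M2 A"
  shows "pullback (Suc r) M e \<chi> \<in> coboundaries (Suc r) M A \<longleftrightarrow>
    cls (Suc r) M2 A \<chi> \<in> conn r ` carrier (Ext r M1 A)"
proof
  assume "pullback (Suc r) M e \<chi> \<in> coboundaries (Suc r) M A"
  then obtain \<psi> where \<psi>: "\<psi> \<in> lhom (bar r M) A" "pullback (Suc r) M e \<chi> = coboundary r M \<psi>"
    by (auto simp: coboundaries_def)
  let ?\<phi> = "pullback r M1 id \<psi>"
  have "?\<phi> \<in> cocycles r M1 A"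
    using \<chi> by (simp add: cocycles_def pullback_hom[OF M1 M inclusion \<psi>(1)] cb_id[symmetric] \<psi>(2)[symmetric] pullback_id_e)
  moreover have "lift r ?\<phi> \<psi> \<chi>" using \<psi> \<chi> by (simp add: lift_def)
  ultimately show "cls (Suc r) M2 A \<chi> \<in> conn r ` carrier (Ext r M1 A)"
    using connecting_cls by (metis Ext_carrier image_eqI)
next
  assume "cls (Suc r) M2 A \<chi> \<in> conn r ` carrier (Ext r M1 A)"
  then obtain \<phi> where \<phi>: "\<phi> \<in> cocycles r M1 A" "cls (Suc r) M2 A \<chi> = conn r (cls r M1 A \<phi>)" by (auto simp: Ext_carrier)
  obtain \<psi> \<chi>' where l: "lift r \<phi> \<psi> \<chi>'" by (rule lift_exists[OF \<phi>(1)])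
  have "\<chi> - \<chi>' \<in> coboundaries (Suc r) M2 A" using \<phi>(2) by (simp add: connecting_cls[OF l] cls_eq_iff[OF A])
  then have "pullback (Suc r) M e (\<chi> - \<chi>') \<in> coboundaries (Suc r) M A" by (rule pullback_coboundaries[OF M M2 e])
  moreover have "pullback (Suc r) M e \<chi>' \<in> coboundaries (Suc r) M A" using l by (auto simp: lift_def coboundaries_def)
  ultimately show "pullback (Suc r) M e \<chi> \<in> coboundaries (Suc r) M A"
    using coboundaries_add[OF A] by (fastforce simp: pullback_diff)
qed

text \<open>
  No connecting homomorphism ends in degree 0; exactness there is injectivity of the pullback.
\<close>

lemma exact_at_M2_0:
  assumes \<chi>: "\<chi> \<in> cocycles 0 M2 A"
  shows "pullback 0 M e \<chi> \<in> coboundaries 0 M A \<longleftrightarrow> \<chi> \<in> coboundaries 0 M2 A"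
  using pullback_e_inject[of \<chi> 0] \<chi> by (auto simp: coboundaries_def cocycles_def pullback_0)

lemma exact_at_M1:
  assumes \<phi>: "\<phi> \<in> cocycles r M1 A"
  shows "conn r (cls r M1 A \<phi>) = \<one>\<^bsub>Ext (Suc r) M2 A\<^esub> \<longleftrightarrow>
    cls r M1 A \<phi> \<in> Ext_map r M1 id A ` carrier (Ext r M A)"
proof -
  obtain \<psi> \<chi> where l: "lift r \<phi> \<psi> \<chi>" by (rule lift_exists[OF \<phi>])
  then have l': "\<psi> \<in> lhom (bar r M) A" "pullback r M1 id \<psi> = \<phi>" "\<chi> \<in> cocycles (Suc r) M2 A"
    "pullback (Suc r) M e \<chi> = coboundary r M \<psi>" by (auto simp: lift_def)
  have "conn r (cls r M1 A \<phi>) = \<one>\<^bsub>Ext (Suc r) M2 A\<^esub> \<longleftrightarrow> \<chi> \<in> coboundaries (Suc r) M2 A"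
    by (simp add: connecting_cls[OF l] cls_one_iff[OF A])
  also have "\<dots> \<longleftrightarrow> cls r M1 A \<phi> \<in> Ext_map r M1 id A ` carrier (Ext r M A)"
  proof
    assume "\<chi> \<in> coboundaries (Suc r) M2 A"
    then obtain \<omega> where \<omega>: "\<omega> \<in> lhom (bar r M2) A" "\<chi> = coboundary r M2 \<omega>" by (auto simp: coboundaries_def)
    let ?\<psi> = "\<psi> - pullback r M e \<omega>"
    have "?\<psi> \<in> cocycles r M A"
      by (simp add: cocycles_def cA l'(1) pullback_hom[OF M M2 e \<omega>(1)] coboundary_diff l'(4)[symmetric] \<omega>(2) cb_e)
    moreover have "pullback r M1 id ?\<psi> = \<phi>" using \<omega>(1) by (simp add: pullback_diff l'(2) pullback_id_e)
    ultimately show "cls r M1 A \<phi> \<in> Ext_map r M1 id A ` carrier (Ext r M A)"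
      using Ext_map_cls[OF M1 M A inclusion, of r ?\<psi>] by (metis Ext_carrier image_eqI)
  next
    assume "cls r M1 A \<phi> \<in> Ext_map r M1 id A ` carrier (Ext r M A)"
    then obtain \<psi>' where \<psi>': "\<psi>' \<in> cocycles r M A" "cls r M1 A \<phi> = cls r M1 A (pullback r M1 id \<psi>')"
      by (auto simp: Ext_carrier Ext_map_cls[OF M1 M A inclusion])
    have "lift r (pullback r M1 id \<psi>') \<psi>' 0"
      using \<psi>'(1) cocycles_zero[OF A] by (auto simp: lift_def cocycles_def pullback_0)
    from lift_coboundary[OF _ lift_diff[OF l this]] show "\<chi> \<in> coboundaries (Suc r) M2 A"
      using \<psi>'(2) by (simp add: cls_eq_iff[OF A])
  qed
  finally show ?thesis .
qed

end

section \<open>The couple of the augmentation sequences\<close>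

type_synonym 'g tensors = "'g list \<Rightarrow>\<^sub>0 int"
type_synonym ('g, 'm) bimod = "(('g \<times> 'g) \<Rightarrow>\<^sub>0 int, 'm) lmod"

abbreviation "ZI_power s \<equiv> tensor_group UNIV (I_power s)"

lemma eps_tensor_map: "module_map (ZIpow_mod s :: ('g::group_add, _) bimod) (Ipow_mod s) eps_tensor"
proof (rule module_mapI[OF ZIpow_module Ipow_module])
  show "eps_tensor x \<in> carr (Ipow_mod s :: ('g, _) bimod)"
    if "x \<in> carr (ZIpow_mod s :: ('g, _) bimod)" for x
    using that short_exact_sequence(2) by (force simp: Ipow_mod_def ZIpow_mod_def)
  fix h :: "'g \<times> 'g" and x assume "x \<in> carr (ZIpow_mod s :: ('g, _) bimod)"
  then have "x \<in> ZI_power s" by (simp add: ZIpow_mod_def)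
  then have "eps_tensor (perm_smul (\<lambda>gh. map (bact gh)) (frag_of h) x) = perm_smul (\<lambda>gh. map (bact gh)) (frag_of h) (eps_tensor x)"
  proof (induction)
    case zero show ?case by (simp add: eps_tensor_def perm_smul_def)
  next
    case (add a y u)
    have "perm_smul (\<lambda>gh. map (bact gh)) (frag_of h) (frag_cmul c y) = frag_cmul c (perm_smul (\<lambda>gh. map (bact gh)) (frag_of h) y)" for c
      by (simp add: perm_smul_of frag_extend_cmul)
    with add show ?case by (simp add: perm_smul_add_right eps_add perm_tensor eps_tensor aug_perm)
  qed
  then show "eps_tensor (smul (ZIpow_mod s) (frag_of h) x) = smul (Ipow_mod s) (frag_of h) (eps_tensor x)"
    by (simp add: ZIpow_mod_def Ipow_mod_def)
qed (rule eps_add)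

lemma Ipow_sequence:
  fixes A :: "('g::group_add, 'a::ab_group_add) bimod"
  assumes A: "left_module A"
  shows "bar_split_sequence (Ipow_mod (Suc s)) (ZIpow_mod s) (Ipow_mod s) eps_tensor A"
proof
  let ?M = "ZIpow_mod s :: ('g, _) bimod" and ?M2 = "Ipow_mod s :: ('g, _) bimod"
  show "left_module (Ipow_mod (Suc s) :: ('g, _) bimod)" "left_module ?M" "left_module ?M2" "left_module A"
    by (rule Ipow_module ZIpow_module A)+
  show "carr (Ipow_mod (Suc s)) = {x \<in> carr ?M. eps_tensor x = 0}"
    using short_exact_sequence(1)[of s] by (simp add: Ipow_mod_def ZIpow_mod_def)
  show "smul (Ipow_mod (Suc s)) = smul ?M" by (simp add: Ipow_mod_def ZIpow_mod_def)
  show e: "module_map ?M ?M2 eps_tensor" by (rule eps_tensor_map)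
  show "\<exists>t\<in>lhom (bar r ?M2) (bar r ?M). \<forall>x\<in>carr (bar r ?M2). Poly_Mapping.map eps_tensor (t x) = x" for r
  proof -
    let ?q = "restrict0 (carr (bar r ?M)) (Poly_Mapping.map eps_tensor)"
    have q: "?q \<in> lhom (bar r ?M) (bar r ?M2)"
      using module_map_bar[OF ZIpow_module Ipow_module e] by (simp add: module_map_restrict0 bar_left_module ZIpow_module)
    have e0: "eps_tensor 0 = (0 :: 'g tensors)" by (simp add: eps_tensor_def)
    have onto: "?q ` carr (bar r ?M) = carr (bar r ?M2)"
    proof
      show "?q ` carr (bar r ?M) \<subseteq> carr (bar r ?M2)" using q by (auto simp: lhom_def)
      show "carr (bar r ?M2) \<subseteq> ?q ` carr (bar r ?M)"
      proof
        fix x assume x: "x \<in> carr (bar r ?M2)"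
        show "x \<in> ?q ` carr (bar r ?M)" using x Ipow_module
        proof (induction rule: bar_induct)
          case zero
          have "Poly_Mapping.map eps_tensor (0 :: ('g \<times> 'g) list \<Rightarrow>\<^sub>0 'g tensors) = 0"
            by (rule poly_mapping_eqI) (simp add: lookup_map_0 e0)
          then show ?case by (intro image_eqI[of _ _ 0]) (auto simp: restrict0_def bar_carr_0 ZIpow_module)
        next
          case (single \<sigma> m)
          then obtain u where u: "u \<in> carr ?M" "m = eps_tensor u"
            using short_exact_sequence(2)[of s] by (auto simp: Ipow_mod_def ZIpow_mod_def)
          with single show ?case
            by (intro image_eqI[of _ _ "single \<sigma> u"])
               (auto simp: restrict0_def bar_carr_single ZIpow_module map_single_0[of eps_tensor, OF e0])
        next
          case (add u v)
          then obtain u' v' where "u' \<in> carr (bar r ?M)" "u = ?q u'" "v' \<in> carr (bar r ?M)" "v = ?q v'" by blast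
          then show ?case
            by (intro image_eqI[of _ _ "u' + v'"])
               (auto simp: restrict0_def bar_carr_add ZIpow_module map_bar_add[OF ZIpow_module e])
        qed
      qed
    qed
    have id: "restrict0 (carr (bar r ?M2)) (\<lambda>x. x) \<in> lhom (bar r ?M2) (bar r ?M2)"
      by (simp add: module_map_restrict0 bar_left_module Ipow_module) (simp add: module_map_def)
    obtain t where t: "t \<in> lhom (bar r ?M2) (bar r ?M)" "\<forall>x\<in>carr (bar r ?M2). ?q (t x) = restrict0 (carr (bar r ?M2)) (\<lambda>x. x) x"
      using bar_projective_Ipow[OF _ bar_left_module[OF ZIpow_module] bar_left_module[OF Ipow_module] q onto id] by auto
    have "Poly_Mapping.map eps_tensor (t x) = x" if "x \<in> carr (bar r ?M2)" for x
      using t that by (auto simp: restrict0_def lhom_def split: if_splits)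
    with t(1) show ?thesis by blast
  qed
qed

abbreviation trivial_group :: "'b::ab_group_add set monoid" where
  "trivial_group \<equiv> add_group {0} Mod {0}"

lemma trivial_group:
  "comm_group (trivial_group :: 'b::ab_group_add set monoid)"
  "pairwise disjnt (carrier (trivial_group :: 'b set monoid))" "{} \<notin> carrier (trivial_group :: 'b set monoid)"
  "carrier (trivial_group :: 'b set monoid) = {\<one>\<^bsub>trivial_group :: 'b set monoid\<^esub>}"
  using quotient_group(1-3)[of "{0 :: 'b}" "{0}"]
  by (simp_all add: add_subgroup_def carrier_FactGroup coset_add_group) (simp add: add_group_def)

lemma D0_Ext: "D0 A (int r) (int s) = Ext r (Ipow_mod s) A" and E0_Ext: "E0 A (int r) (int s) = Ext r (ZIpow_mod s) A"
  by (simp_all add: D0_def E0_def)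

lemma i0_connecting: "i0 A (int r) (1 + int s) = connecting r (Ipow_mod (Suc s)) id (ZIpow_mod s) eps_tensor (Ipow_mod s) A"
  by (auto simp: i0_def nat_add_distrib)

lemma j0_Ext_map: "j0 A (int r) (int s) = Ext_map r (ZIpow_mod s) eps_tensor A"
  by (auto simp: j0_def)

lemma k0_Ext_map: "k0 A (int r) (int s) = Ext_map r (Ipow_mod (Suc s)) id A"
  by (auto simp: k0_def nat_add_distrib)

lemma negative_or_nat: obtains "r < 0 \<or> s < (0 :: int)" | n m where "r = int n" "s = int m"
  by (meson int_ops(1) linorder_not_less nonneg_int_cases)

text \<open>
  Outside the quadrant \<open>r, s \<ge> 0\<close> all groups are trivial; inside it, the conditions are the long exact
  sequences of the pairs \<open>I^(s+1) \<subseteq> Z[\<pi>] \<otimes> I^s\<close>.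
\<close>

theorem derived_0_partial_exact_couple:
  fixes A :: "('g::group_add, 'a::ab_group_add) bimod"
  assumes A: "left_module A"
  shows "partial_exact_couple 0 (derived A 0)"
proof -
  have Dtriv: "D0 A r s = trivial_group" and Etriv: "E0 A r s = trivial_group" if "r < 0 \<or> s < 0" for r s
    using that by (simp_all add: D0_def E0_def)
  have D: "comm_group (D0 A r s)" for r s
    by (simp add: D0_def trivial_group(1) Ext_group(1)[OF Ipow_module A])
  have E: "comm_group (E0 A r s)" "pairwise disjnt (carrier (E0 A r s))" "{} \<notin> carrier (E0 A r s)" for r s
    by (simp_all add: E0_def trivial_group(1-3) Ext_group(1-3)[OF ZIpow_module A])
  have one_hom: "(\<lambda>x. \<one>\<^bsub>H\<^esub>) \<in> hom G H" if "comm_group G" "comm_group H" for G H :: "('g, 'a) cochain set monoid"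
    using that by (simp add: hom_def comm_group_def comm_monoid_def monoid.one_closed monoid.l_one)
  have one_triv: "carrier (D0 A r s) = {\<one>\<^bsub>D0 A r s\<^esub>}" "carrier (E0 A r s) = {\<one>\<^bsub>E0 A r s\<^esub>}" if "r < 0 \<or> s < 0" for r s
    by (simp_all only: Dtriv[OF that] Etriv[OF that] trivial_group(4))
  note seq = Ipow_sequence[OF A]
  have cocyc: "X \<in> carrier (D0 A (int n) (int m)) \<longleftrightarrow> (\<exists>\<phi>\<in>cocycles n (Ipow_mod m) A. X = cls n (Ipow_mod m) A \<phi>)" for X n m
    by (auto simp: D0_Ext Ext_carrier)
  have j0: "j0 A (int n) (int m) (cls n (Ipow_mod m) A \<phi>) = cls n (ZIpow_mod m) A (pullback n (ZIpow_mod m) eps_tensor \<phi>)" for n m \<phi>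
    unfolding j0_Ext_map by (rule Ext_map_cls[OF ZIpow_module Ipow_module A eps_tensor_map])
  have i_hom: "i0 A r s \<in> hom (D0 A r s) (D0 A (r + 1) (s - 1))" for r s
  proof (rule negative_or_nat[of r "s - 1"])
    assume "r < 0 \<or> s - 1 < 0"
    then have "i0 A r s = (\<lambda>x. \<one>\<^bsub>D0 A (r + 1) (s - 1)\<^esub>)" by (auto simp: i0_def)
    then show ?thesis by (simp add: one_hom D)
  next
    fix n m assume nm: "r = int n" "s - 1 = int m"
    then have s: "s = 1 + int m" by simp
    have "i0 A (int n) (1 + int m) \<in> hom (D0 A (int n) (int (Suc m))) (D0 A (int (Suc n)) (int m))"
      unfolding i0_connecting D0_Ext by (rule bar_split_sequence.connecting_hom[OF seq])
    then show ?thesis unfolding nm(1) s by (simp add: add.commute)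
  qed
  have j_hom: "j0 A r s \<in> hom (D0 A r s) (E0 A r s)" for r s
  proof (rule negative_or_nat[of r s])
    assume "r < 0 \<or> s < 0"
    then have "j0 A r s = (\<lambda>x. \<one>\<^bsub>E0 A r s\<^esub>)" by (auto simp: j0_def)
    then show ?thesis by (simp add: one_hom D E)
  next
    fix n m assume "r = int n" "s = int m"
    then show ?thesis using Ext_map_hom[OF ZIpow_module Ipow_module A eps_tensor_map] by (simp add: D0_Ext E0_Ext j0_Ext_map)
  qed
  have k_hom: "k0 A r s \<in> hom (E0 A r s) (D0 A r (s + 1))" for r s
  proof (rule negative_or_nat[of r s])
    assume "r < 0 \<or> s < 0"
    then have "k0 A r s = (\<lambda>x. \<one>\<^bsub>D0 A r (s + 1)\<^esub>)" by (auto simp: k0_def)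
    then show ?thesis by (simp add: one_hom D E)
  next
    fix n m assume "r = int n" "s = int m"
    moreover have "k0 A (int n) (int m) \<in> hom (E0 A (int n) (int m)) (D0 A (int n) (int (Suc m)))"
      unfolding k0_Ext_map D0_Ext E0_Ext
      by (rule Ext_map_hom[OF Ipow_module ZIpow_module A bar_split_sequence.inclusion[OF seq]])
    ultimately show ?thesis by (simp add: add.commute)
  qed
  have X1: "j0 A r s x = \<one>\<^bsub>E0 A r s\<^esub> \<longleftrightarrow> x \<in> i0 A (r - 1) (s + 1) ` carrier (D0 A (r - 1) (s + 1))"
    if s: "0 \<le> s" and x: "x \<in> carrier (D0 A r s)" for r s x
  proof -
    obtain m where m: "s = int m" using s by (metis nonneg_int_cases)
    consider "r < 0" | "r = 0" | n where "r = int (Suc n)"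
      by (metis int_cases nat.exhaust negative_zless int_ops(1) linorder_neqE_linordered_idom of_nat_less_0_iff)
    then show ?thesis
    proof cases
      case 1
      then have "x = \<one>\<^bsub>D0 A r s\<^esub>" using x one_triv[of r s] by auto
      then show ?thesis using 1 one_triv[of "r - 1" "s + 1"] by (simp add: j0_def i0_def)
    next
      case 2
      then obtain \<chi> where \<chi>: "\<chi> \<in> cocycles 0 (Ipow_mod m) A" "x = cls 0 (Ipow_mod m) A \<chi>"
        using x cocyc[of x 0 m] m by auto
      have "j0 A r s x = \<one>\<^bsub>E0 A r s\<^esub> \<longleftrightarrow> pullback 0 (ZIpow_mod m) eps_tensor \<chi> \<in> coboundaries 0 (ZIpow_mod m) A"
        using j0[of 0 m \<chi>] 2 m \<chi>(2) E0_Ext[of A 0 m] by (simp add: cls_one_iff[OF A])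
      also have "\<dots> \<longleftrightarrow> x = \<one>\<^bsub>D0 A r s\<^esub>"
        using bar_split_sequence.exact_at_M2_0[OF seq \<chi>(1)] 2 m \<chi>(2) D0_Ext[of A 0 m] by (simp add: cls_one_iff[OF A])
      finally show ?thesis using 2 one_triv[of "r - 1" "s + 1"] by (simp add: i0_def)
    next
      case 3
      then obtain \<chi> where \<chi>: "\<chi> \<in> cocycles (Suc n) (Ipow_mod m) A" "x = cls (Suc n) (Ipow_mod m) A \<chi>"
        using x cocyc[of x "Suc n" m] m by auto
      have "j0 A r s x = \<one>\<^bsub>E0 A r s\<^esub> \<longleftrightarrow> pullback (Suc n) (ZIpow_mod m) eps_tensor \<chi> \<in> coboundaries (Suc n) (ZIpow_mod m) A"
        unfolding 3 m \<chi>(2) j0 E0_Ext by (rule cls_one_iff[OF A])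
      also have "\<dots> \<longleftrightarrow> x \<in> i0 A (int n) (1 + int m) ` carrier (D0 A (int n) (int (Suc m)))"
        unfolding i0_connecting D0_Ext \<chi>(2) by (rule bar_split_sequence.exact_at_M2[OF seq \<chi>(1)])
      finally show ?thesis using 3 m by (simp add: add.commute)
    qed
  qed
  have X3: "i0 A r (s + 1) x = \<one>\<^bsub>D0 A (r + 1) s\<^esub> \<longleftrightarrow> x \<in> k0 A r s ` carrier (E0 A r s)"
    if s: "0 \<le> s" and x: "x \<in> carrier (D0 A r (s + 1))" for r s x
  proof (rule negative_or_nat[of r s])
    assume "r < 0 \<or> s < 0"
    then have r: "r < 0" using s by simp
    then have "x = \<one>\<^bsub>D0 A r (s + 1)\<^esub>" using x one_triv[of r "s + 1"] by auto
    then show ?thesis using r one_triv[of r s] by (simp add: i0_def k0_def)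
  next
    fix n m assume nm: "r = int n" "s = int m"
    then obtain \<phi> where \<phi>: "\<phi> \<in> cocycles n (Ipow_mod (Suc m)) A" "x = cls n (Ipow_mod (Suc m)) A \<phi>"
      using x cocyc[of x n "Suc m"] by (auto simp: add.commute)
    show ?thesis
      using bar_split_sequence.exact_at_M1[OF seq \<phi>(1)] nm \<phi>(2)
      by (simp add: i0_connecting k0_Ext_map E0_Ext add.commute[of _ 1] flip: D0_Ext)
  qed
  have KJ: "k0 A r s (j0 A r s x) = \<one>\<^bsub>D0 A r (s + 1)\<^esub>" if s: "0 \<le> s" and x: "x \<in> carrier (D0 A r s)" for r s x
  proof (rule negative_or_nat[of r s])
    assume "r < 0 \<or> s < 0"
    then show ?thesis by (simp add: k0_def)
  next
    fix n m assume nm: "r = int n" "s = int m"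
    then obtain \<chi> where \<chi>: "\<chi> \<in> cocycles n (Ipow_mod m) A" "x = cls n (Ipow_mod m) A \<chi>"
      using x cocyc[of x n m] by auto
    have "pullback n (Ipow_mod (Suc m)) id (pullback n (ZIpow_mod m) eps_tensor \<chi>) \<in> coboundaries n (Ipow_mod (Suc m)) A"
      using bar_split_sequence.pullback_id_e[OF seq, of \<chi> n m] \<chi>(1) coboundaries_zero[OF A]
      by (simp add: cocycles_def)
    then have "k0 A (int n) (int m) (j0 A (int n) (int m) x) = \<one>\<^bsub>D0 A (int n) (int (Suc m))\<^esub>"
      unfolding \<chi>(2) j0 k0_Ext_map Ext_map_cls[OF Ipow_module ZIpow_module A bar_split_sequence.inclusion[OF seq]] D0_Ext
      by (simp add: cls_one_iff[OF A])
    then show ?thesis using nm by (simp add: add.commute)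
  qed
  show ?thesis
    by (rule partial_exact_couple.intro) (simp_all add: D E one_triv i_hom j_hom k_hom X1 X3 KJ)
qed

corollary derived_partial_exact_couple:
  assumes "left_module A" shows "partial_exact_couple (int p) (derived A p)"
proof (induction p)
  case 0
  show ?case using derived_0_partial_exact_couple[OF assms] by simp
next
  case (Suc p)
  then show ?case using partial_exact_couple.derived_partial_exact_couple[OF Suc] by (simp add: add.commute)
qed

lemma D_der_image:
  "carrier (D_der A p r s) = i0_iter A p (r - int p) (s + int p) ` carrier (D0 A (r - int p) (s + int p))"
  and ci_derived: "ci (derived A p) = i0 A"
proof -
  show ci: "ci (derived A p) = i0 A" for p by (induction p) (simp_all add: derived_couple_def)
  show "carrier (D_der A p r s) = i0_iter A p (r - int p) (s + int p) ` carrier (D0 A (r - int p) (s + int p))"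
  proof (induction p arbitrary: r s)
    case (Suc p)
    have iter: "i0_iter A (Suc p) r s x = i0 A (r + int p) (s - int p) (i0_iter A p r s x)" for p r s x
    proof (induction p arbitrary: r s x)
      case (Suc p)
      show ?case using Suc[of "r + 1" "s - 1" "i0 A r s x"] by (simp add: algebra_simps)
    qed simp
    have "carrier (D_der A (Suc p) r s) = i0 A (r - 1) (s + 1) ` carrier (D_der A p (r - 1) (s + 1))"
      using ci[of p] by (simp add: derived_couple_def)
    then show ?case unfolding Suc.IH image_image iter by (simp add: algebra_simps)
  qed simp
qed

section \<open>Alternating face sums\<close>

text \<open>
  The coboundary formula for functions of tuples. The recursion \<open>face_sum_Cons\<close> below replaces the
  manipulation of indexed sums and simplicial identities by inductions over lists.
\<close>

definition face_sum :: "('h list \<Rightarrow> 'b::ab_group_add) \<Rightarrow> 'h list \<Rightarrow> 'b" where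
  "face_sum F \<sigma> = (\<Sum>i<length \<sigma>. if even i then F (face i \<sigma>) else - F (face i \<sigma>))"

lemma face_sum_Nil [simp]: "face_sum F [] = 0"
  by (simp add: face_sum_def)

lemma face_sum_Cons [simp]: "face_sum F (x # \<sigma>) = F \<sigma> - face_sum (\<lambda>\<tau>. F (x # \<tau>)) \<sigma>"
proof -
  have "(\<Sum>i<length \<sigma>. if even (Suc i) then F (face (Suc i) (x # \<sigma>)) else - F (face (Suc i) (x # \<sigma>))) =
     - (\<Sum>i<length \<sigma>. if even i then F (x # face i \<sigma>) else - F (x # face i \<sigma>))"
    by (subst sum_negf[symmetric]) (rule sum.cong, auto simp: face_def)
  then show ?thesis
    by (simp add: face_sum_def sum.lessThan_Suc_shift face_def[of 0] del: sum.lessThan_Suc)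
qed

lemma face_sum_additive:
  assumes "\<And>x y. f (x + y) = f x + (f y :: 'c::ab_group_add)"
  shows "face_sum (\<lambda>\<tau>. f (F \<tau> :: 'b::ab_group_add)) \<sigma> = f (face_sum F \<sigma>)"
proof -
  have 0: "f 0 = 0" using assms[of 0 0] by simp
  have "f (- x) = - f x" for x using assms[of x "- x"] 0 by (simp add: eq_neg_iff_add_eq_0 add.commute)
  then have "f (x - y) = f x - f y" for x y using assms[of x "- y"] by simp
  then show ?thesis by (induction \<sigma> arbitrary: F) (simp_all add: 0)
qed

lemma face_sum_cong:
  "(\<And>\<tau>. Suc (length \<tau>) = length \<sigma> \<Longrightarrow> F \<tau> = G \<tau>) \<Longrightarrow> face_sum F \<sigma> = face_sum G \<sigma>"
  unfolding face_sum_def by (rule sum.cong) (auto simp: face_def)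

lemma coboundary_single:
  assumes M: "left_module M" and \<phi>: "\<phi> \<in> lhom (bar r M) A" and \<sigma>: "length \<sigma> = Suc (Suc r)" and m: "m \<in> carr M"
  shows "coboundary r M \<phi> (single \<sigma> m) = face_sum (\<lambda>\<tau>. \<phi> (single \<tau> m)) \<sigma>"
proof -
  note \<phi>m = lhom_module_map[OF \<phi>]
  have "\<phi> (\<Sum>i\<in>K. single (face i \<sigma>) (if even i then m else - m)) =
      (\<Sum>i\<in>K. if even i then \<phi> (single (face i \<sigma>) m) else - \<phi> (single (face i \<sigma>) m))
    \<and> (\<Sum>i\<in>K. single (face i \<sigma>) (if even i then m else - m)) \<in> carr (bar r M)"
    if "finite K" "K \<subseteq> {..<length \<sigma>}" for K
    using that
  proof (induction K rule: finite_induct)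
    case empty
    show ?case by (simp add: module_map_minus(1)[OF \<phi>m bar_left_module[OF M]] bar_carr_0[OF M])
  next
    case (insert i K)
    have l: "length (face i \<sigma>) = Suc r" using insert \<sigma> by (auto simp: face_def)
    then have c: "single (face i \<sigma>) m' \<in> carr (bar r M)" if "m' \<in> carr M" for m'
      using that by (simp add: bar_carr_single[OF M])
    have "\<phi> (single (face i \<sigma>) (- m)) = - \<phi> (single (face i \<sigma>) m)"
      using module_map_minus(2)[OF \<phi>m bar_left_module[OF M] c[OF m]] by (simp add: single_uminus)
    then show ?case using insert c m left_moduleD(3)[OF M m]
      by (auto simp: module_mapD[OF \<phi>m] bar_carr_add[OF M])
  qed
  from this[of "{..<length \<sigma>}"] show ?thesis
    by (simp add: coboundary_def restrict0_def bar_carr_single[OF M m] \<sigma> boundary_single[of \<sigma>] face_sum_def)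
qed

section \<open>The cochains of steps\<close>

text \<open>
  The orbit map \<open>(g,h) \<mapsto> g h\<^sup>-\<^sup>1\<close> of the unit of \<open>\<pi>\<close> sends the pairs \<open>x\<close> and \<open>y\<close> to two elements of \<open>\<pi>\<close>;
  \<open>step x y\<close> is the difference of these in the group ring.
\<close>

definition step :: "'g::group_add \<times> 'g \<Rightarrow> 'g \<times> 'g \<Rightarrow> ('g \<Rightarrow>\<^sub>0 int)" where
  "step x y = frag_of (fst y - snd y) - frag_of (fst x - snd x)"

fun steps :: "('g::group_add \<times> 'g) list \<Rightarrow> 'g tensors \<Rightarrow> 'g tensors" where
  "steps (x # y # \<sigma>) m = tensor (step x y) (steps (y # \<sigma>) m)"
| "steps [x] m = m"
| "steps [] m = m"

abbreviation tact :: "'g::group_add \<times> 'g \<Rightarrow> 'g tensors \<Rightarrow> 'g tensors" where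
  "tact h \<equiv> perm_smul (\<lambda>gh. map (bact gh)) (frag_of h)"

lemma step_aug: "step x y \<in> aug_ideal"
  by (simp add: step_def aug_ideal_def aug_diff)

lemma bact_point: "bact h (fst x - snd x) = fst (h + x) - snd (h + x)"
  by (simp add: bact_def diff_conv_add_uminus minus_add add.assoc del: add_uminus_conv_diff)

lemma step_act: "perm_smul bact (frag_of h) (step x y) = step (h + x) (h + y)"
  by (simp add: step_def perm_smul_of frag_extend_diff bact_point)

lemma tensor_diff_left: "tensor (a - b) y = tensor a y - tensor b y"
  using additive_minus_frag(3)[of "\<lambda>a. tensor a y", OF tensor_add_left] by simp

lemma tensor_diff_right: "tensor a (y - z) = tensor a y - tensor a z"
  using additive_minus_frag(3)[of "tensor a", OF tensor_add_right] by simp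

lemma tensor_zero_right: "tensor a 0 = 0"
  using additive_minus_frag(1)[of "tensor a", OF tensor_add_right] by simp

lemma tensor_minus_right: "tensor a (- y) = - tensor a y"
  using additive_minus_frag(2)[of "tensor a", OF tensor_add_right] by simp

lemma steps_add: "steps \<sigma> (m + m') = steps \<sigma> m + steps \<sigma> m'"
  by (induction \<sigma> m rule: steps.induct) (simp_all add: tensor_add_right)

lemma steps_zero: "steps \<sigma> 0 = 0"
  using steps_add[of \<sigma> 0 0] by simp

lemma steps_carr: "length \<sigma> = Suc r \<Longrightarrow> m \<in> I_power s \<Longrightarrow> steps \<sigma> m \<in> I_power (r + s)"
proof (induction \<sigma> m arbitrary: r rule: steps.induct)
  case (1 x y \<sigma> m)
  then obtain q where "r = Suc q" by (cases r) auto
  then show ?case using 1 by (simp add: tensor_in_group step_aug)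
qed auto

lemma steps_act: "tact h (steps \<sigma> m) = steps (map ((+) h) \<sigma>) (tact h m)"
  by (induction \<sigma> m rule: steps.induct) (simp_all add: perm_tensor step_act)

text \<open>
  Deleting an inner vertex replaces two consecutive steps by their sum, so these terms cancel against
  each other. What survives is the dependence of \<open>m\<close> on the last vertex; by hypothesis it contributes
  the one missing step. The constant \<open>m\<close> with \<open>v = 0\<close> gives the cocycle condition for the steps.
\<close>

lemma face_sum_steps:
  assumes m: "\<And>x y. m y - m x = - tensor (step x y) v"
  shows "face_sum (\<lambda>\<tau>. steps \<tau> (m (last \<tau>))) (x # y # \<sigma>) =
    (if even (length \<sigma>) then - steps (x # y # \<sigma>) v else steps (x # y # \<sigma>) v)"
proof (induction \<sigma> arbitrary: x y)
  case Nil
  show ?case using m[of y x] by simp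
next
  case (Cons z \<sigma>)
  let ?F = "\<lambda>\<tau>. steps \<tau> (m (last \<tau>))"
  let ?w = "?F (z # \<sigma>)"
  have "face_sum ?F (x # y # z # \<sigma>) = ?F (y # z # \<sigma>) - ?F (x # z # \<sigma>) + face_sum (\<lambda>\<tau>. ?F (x # y # \<tau>)) (z # \<sigma>)"
    by (simp only: face_sum_Cons) simp
  also have "face_sum (\<lambda>\<tau>. ?F (x # y # \<tau>)) (z # \<sigma>) = face_sum (\<lambda>\<tau>. tensor (step x y) (?F (y # \<tau>))) (z # \<sigma>)"
    by simp
  also have "\<dots> = tensor (step x y) (face_sum (\<lambda>\<tau>. ?F (y # \<tau>)) (z # \<sigma>))"
    by (rule face_sum_additive) (rule tensor_add_right)
  also have "face_sum (\<lambda>\<tau>. ?F (y # \<tau>)) (z # \<sigma>) = ?w - face_sum ?F (y # z # \<sigma>)"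
    by (simp only: face_sum_Cons[of ?F y]) simp
  also have "?F (y # z # \<sigma>) - ?F (x # z # \<sigma>) = - tensor (step x y) ?w"
    by (simp add: tensor_diff_left[symmetric]) (simp add: step_def tensor_diff_left)
  finally show ?case unfolding Cons.IH by (simp add: tensor_diff_right tensor_minus_right)
qed

definition step_cochain :: "nat \<Rightarrow> nat \<Rightarrow> ('g::group_add, 'g tensors) cochain" where
  "step_cochain r s = restrict0 (carr (bar r (Ipow_mod s))) (add_extend steps)"

lemma step_cochain_hom: "step_cochain r s \<in> lhom (bar r (Ipow_mod s)) (Ipow_mod (r + s))"
  unfolding step_cochain_def
  by (rule bar_lift(1)[OF Ipow_module Ipow_module])
     (auto simp: Ipow_mod_def steps_add steps_carr steps_act)

lemma step_cochain_single:
  assumes "length \<sigma> = Suc r" "m \<in> I_power s"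
  shows "step_cochain r s (single \<sigma> m) = steps \<sigma> m"
  unfolding step_cochain_def
  by (rule bar_lift(2)[where N = "Ipow_mod (r + s)", OF Ipow_module Ipow_module])
     (use assms in \<open>auto simp: Ipow_mod_def steps_add steps_carr steps_act\<close>)

lemma tensor_split_carr:
  fixes u :: "'g tensors"
  assumes u: "u \<in> ZI_power s"
  shows "u - tensor (frag_of g) (eps_tensor u) \<in> I_power (Suc s)"
proof -
  have v: "eps_tensor u \<in> I_power s" using short_exact_sequence(2)[of s] u by auto
  have "u - tensor (frag_of g) (eps_tensor u) \<in> ZI_power s"
    by (rule tensor_group_diff[OF UNIV_I u tensor_in_group[OF UNIV_I v]])
  moreover have "eps_tensor (u - tensor (frag_of g) (eps_tensor u)) = 0"
    by (simp add: additive_minus_frag(3)[of eps_tensor, OF eps_add] eps_tensor)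
  ultimately show ?thesis using short_exact_sequence(1)[of s] by auto
qed

text \<open>
  Subtracting \<open>p(x_r) \<otimes> \<epsilon>(u)\<close>, where \<open>x_r\<close> is the last vertex, moves \<open>u\<close> equivariantly into \<open>I^(s+1)\<close>
  and fixes the elements that lie there already. So this extends the step cochain of degree \<open>r\<close> from
  \<open>I^(s+1)\<close> to \<open>Z[\<pi>] \<otimes> I^s\<close>, and telescoping shows that its coboundary comes from the next one.
\<close>

definition split_steps :: "('g::group_add \<times> 'g) list \<Rightarrow> 'g tensors \<Rightarrow> 'g tensors" where
  "split_steps \<sigma> u = steps \<sigma> (u - tensor (frag_of (fst (last \<sigma>) - snd (last \<sigma>))) (eps_tensor u))"

definition split_cochain :: "nat \<Rightarrow> nat \<Rightarrow> ('g::group_add, 'g tensors) cochain" where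
  "split_cochain r s = restrict0 (carr (bar r (ZIpow_mod s))) (add_extend split_steps)"

lemma split_steps_add: "split_steps \<sigma> (u + u') = split_steps \<sigma> u + split_steps \<sigma> u'"
  unfolding split_steps_def steps_add[symmetric] by (simp add: eps_add tensor_add_right algebra_simps)

lemma split_steps_act:
  assumes "length \<sigma> = Suc r" "u \<in> ZI_power s"
  shows "split_steps (map ((+) h) \<sigma>) (tact h u) = tact h (split_steps \<sigma> u)"
proof -
  have "\<sigma> \<noteq> []" using assms(1) by auto
  have e: "eps_tensor (tact h u) = tact h (eps_tensor u)"
    using module_mapD(3)[OF eps_tensor_map, of u s "frag_of h"] assms(2) by (simp add: ZIpow_mod_def Ipow_mod_def)
  have "tact h (u - tensor (frag_of (fst (last \<sigma>) - snd (last \<sigma>))) (eps_tensor u)) =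
    tact h u - tensor (frag_of (fst (h + last \<sigma>) - snd (h + last \<sigma>))) (tact h (eps_tensor u))"
    using additive_minus_frag(3)[of "tact h", OF perm_smul_add_right]
    by (simp add: perm_tensor perm_smul_of[of bact] bact_point)
  then show ?thesis using \<open>\<sigma> \<noteq> []\<close> by (simp add: split_steps_def steps_act last_map e)
qed

lemma split_steps_carr:
  assumes "length \<sigma> = Suc r" "u \<in> ZI_power s"
  shows "split_steps \<sigma> u \<in> I_power (Suc (r + s))"
  using steps_carr[OF assms(1) tensor_split_carr[OF assms(2)]] by (simp add: split_steps_def del: I_power.simps)

lemma split_cochain_hom: "split_cochain r s \<in> lhom (bar r (ZIpow_mod s)) (Ipow_mod (Suc (r + s)))"
  unfolding split_cochain_def
  by (rule bar_lift(1)[OF ZIpow_module Ipow_module])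
     (simp_all add: Ipow_mod_def ZIpow_mod_def split_steps_add split_steps_carr split_steps_act[of _ r _ s] del: I_power.simps)

lemma split_cochain_single:
  assumes "length \<sigma> = Suc r" "u \<in> ZI_power s"
  shows "split_cochain r s (single \<sigma> u) = split_steps \<sigma> u"
  unfolding split_cochain_def
  by (rule bar_lift(2)[where N = "Ipow_mod (Suc (r + s))", OF ZIpow_module Ipow_module])
     (simp_all add: assms Ipow_mod_def ZIpow_mod_def split_steps_add split_steps_carr split_steps_act[of _ r _ s] del: I_power.simps)

lemma split_cochain_restrict:
  "pullback r (Ipow_mod (Suc s)) id (split_cochain r s) = step_cochain r (Suc s)"
proof (rule lhom_bar_eqI[OF Ipow_module])
  have id: "module_map (Ipow_mod (Suc s)) (ZIpow_mod s) id"
    by (rule bar_split_sequence.inclusion[OF Ipow_sequence[OF I_module]])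
  show "pullback r (Ipow_mod (Suc s)) id (split_cochain r s) \<in> lhom (bar r (Ipow_mod (Suc s))) (Ipow_mod (r + Suc s))"
    using pullback_hom[OF Ipow_module ZIpow_module id split_cochain_hom] by simp
  show "step_cochain r (Suc s) \<in> lhom (bar r (Ipow_mod (Suc s))) (Ipow_mod (r + Suc s))"
    by (rule step_cochain_hom)
  fix \<sigma> :: "('a \<times> 'a) list" and m :: "'a tensors"
  assume \<sigma>: "length \<sigma> = Suc r" and m: "m \<in> carr (Ipow_mod (Suc s) :: ('a, _) bimod)"
  have m': "m \<in> I_power (Suc s)" using m by (simp add: Ipow_mod_def)
  then have "m \<in> ZI_power s" "eps_tensor m = 0" using short_exact_sequence(1)[of s] by auto
  then show "pullback r (Ipow_mod (Suc s)) id (split_cochain r s) (single \<sigma> m) =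
    step_cochain r (Suc s) (single \<sigma> m)"
    using \<sigma> m' by (simp add: pullback_def map_id restrict0_def bar_carr_single[OF Ipow_module m \<sigma>]
      split_cochain_single step_cochain_single split_steps_def tensor_zero_right del: I_power.simps)
qed

lemma split_cochain_coboundary:
  "coboundary r (ZIpow_mod s) (split_cochain r s) =
    pullback (Suc r) (ZIpow_mod s) eps_tensor (if even r then - step_cochain (Suc r) s else step_cochain (Suc r) s)"
  (is "_ = pullback _ _ _ ?z")
proof (rule lhom_bar_eqI[OF ZIpow_module])
  show "coboundary r (ZIpow_mod s) (split_cochain r s) \<in> lhom (bar (Suc r) (ZIpow_mod s)) (Ipow_mod (Suc (r + s)))"
    by (rule coboundary_hom[OF ZIpow_module split_cochain_hom])
  have "?z \<in> lhom (bar (Suc r) (Ipow_mod s)) (Ipow_mod (Suc (r + s)))"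
    using step_cochain_hom[of "Suc r" s] lhom_uminus[OF Ipow_module] by auto
  then show "pullback (Suc r) (ZIpow_mod s) eps_tensor ?z \<in> lhom (bar (Suc r) (ZIpow_mod s)) (Ipow_mod (Suc (r + s)))"
    by (rule pullback_hom[OF ZIpow_module Ipow_module eps_tensor_map])
  fix \<sigma> :: "('a \<times> 'a) list" and u :: "'a tensors"
  assume \<sigma>: "length \<sigma> = Suc (Suc r)" and u: "u \<in> carr (ZIpow_mod s :: ('a, _) bimod)"
  have u': "u \<in> ZI_power s" using u by (simp add: ZIpow_mod_def)
  then have v: "eps_tensor u \<in> I_power s" using short_exact_sequence(2)[of s] by auto
  obtain x y \<tau> where xy: "\<sigma> = x # y # \<tau>" using \<sigma> by (metis length_Suc_conv)
  have "coboundary r (ZIpow_mod s) (split_cochain r s) (single \<sigma> u) =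
    face_sum (\<lambda>\<tau>. split_cochain r s (single \<tau> u)) \<sigma>"
    by (rule coboundary_single[OF ZIpow_module split_cochain_hom \<sigma> u])
  also have "\<dots> = face_sum (\<lambda>\<tau>. steps \<tau> (u - tensor (frag_of (fst (last \<tau>) - snd (last \<tau>))) (eps_tensor u))) \<sigma>"
    using \<sigma> u' by (intro face_sum_cong) (simp add: split_cochain_single split_steps_def)
  also have "\<dots> = (if even r then - steps \<sigma> (eps_tensor u) else steps \<sigma> (eps_tensor u))"
    using \<sigma> unfolding xy
    by (subst face_sum_steps[where v = "eps_tensor u"]) (simp_all add: step_def tensor_diff_left)
  also have "\<dots> = pullback (Suc r) (ZIpow_mod s) eps_tensor ?z (single \<sigma> u)"
    using \<sigma> v by (simp add: pullback_def restrict0_def bar_carr_single[OF ZIpow_module u] step_cochain_single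
      map_single_0[of eps_tensor, OF additive_minus_frag(1)[OF eps_add]])
  finally show "coboundary r (ZIpow_mod s) (split_cochain r s) (single \<sigma> u) =
    pullback (Suc r) (ZIpow_mod s) eps_tensor ?z (single \<sigma> u)" .
qed

section \<open>The iterated connecting homomorphism\<close>

lemma coefficient_hom: 
  assumes A: "left_module A" and \<mu>: "\<mu> \<in> lhom A B" and \<phi>: "\<phi> \<in> lhom M A"
  shows "\<mu> \<circ> \<phi> \<in> lhom M B"
  using module_map_comp[OF lhom_module_map[OF \<phi>] lhom_module_map[OF \<mu>]] \<phi>
    lhom_apply_zero[OF \<mu> A] by (simp add: lhom_iff comp_def)

lemma coefficient_coboundary:
  assumes "\<mu> 0 = 0" shows "coboundary r M (\<mu> \<circ> \<phi>) = \<mu> \<circ> coboundary r M \<phi>"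
  using assms by (auto simp: coboundary_def restrict0_def)

lemma coefficient_pullback:
  assumes "\<mu> 0 = 0" shows "pullback r M f (\<mu> \<circ> \<phi>) = \<mu> \<circ> pullback r M f \<phi>"
  using assms by (auto simp: pullback_def restrict0_def)

text \<open>
  For \<open>r = 0\<close> these are all of \<open>Ext^0(I^s, A)\<close>, for \<open>s = 0\<close> they are the essential classes; the
  connecting homomorphism leads from one case to the other.
\<close>

definition step_classes :: "('g::group_add, 'a::ab_group_add) bimod \<Rightarrow> nat \<Rightarrow> nat \<Rightarrow> ('g, 'a) cochain set set" where
  "step_classes A r s = (\<lambda>\<mu>. cls r (Ipow_mod s) A (\<mu> \<circ> step_cochain r s)) ` lhom (Ipow_mod (r + s)) A"

lemma step_cochain_cocycle:
  fixes A :: "('g::group_add, 'a::ab_group_add) bimod"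
  assumes A: "left_module A" and \<mu>: "\<mu> \<in> lhom (Ipow_mod (r + s)) A"
  shows "\<mu> \<circ> step_cochain r s \<in> cocycles r (Ipow_mod s) A"
proof -
  have "coboundary r (Ipow_mod s) (step_cochain r s) = (0 :: ('g, 'g tensors) cochain)"
  proof (rule lhom_bar_eqI[OF Ipow_module])
    show "coboundary r (Ipow_mod s) (step_cochain r s) \<in> lhom (bar (Suc r) (Ipow_mod s)) (Ipow_mod (r + s))"
      by (rule coboundary_hom[OF Ipow_module step_cochain_hom])
    show "0 \<in> lhom (bar (Suc r) (Ipow_mod s)) (Ipow_mod (r + s))"
      by (rule lhom_zero[OF Ipow_module])
    fix \<sigma> :: "('g \<times> 'g) list" and m :: "'g tensors"
    assume \<sigma>: "length \<sigma> = Suc (Suc r)" and m: "m \<in> carr (Ipow_mod s :: ('g, _) bimod)"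
    obtain x y \<tau> where xy: "\<sigma> = x # y # \<tau>" using \<sigma> by (metis length_Suc_conv)
    have "coboundary r (Ipow_mod s) (step_cochain r s) (single \<sigma> m) = face_sum (\<lambda>\<tau>. steps \<tau> m) \<sigma>"
      using coboundary_single[OF Ipow_module step_cochain_hom \<sigma> m] m \<sigma>
      by (simp add: Ipow_mod_def step_cochain_single cong: face_sum_cong)
    also have "\<dots> = 0"
      using face_sum_steps[of "\<lambda>_. m" 0 x y \<tau>] unfolding xy by (simp add: tensor_zero_right steps_zero)
    finally show "coboundary r (Ipow_mod s) (step_cochain r s) (single \<sigma> m) = 0 (single \<sigma> m)" by simp
  qed
  moreover have "\<mu> 0 = 0" by (rule lhom_apply_zero[OF \<mu> Ipow_module])
  moreover from this have "\<mu> \<circ> 0 = 0" by auto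
  ultimately show ?thesis
    using coefficient_hom[OF Ipow_module \<mu> step_cochain_hom] by (simp add: cocycles_def coefficient_coboundary)
qed

lemma i0_step_cochain:
  fixes A :: "('g::group_add, 'a::ab_group_add) bimod"
  assumes A: "left_module A" and \<mu>: "\<mu> \<in> lhom (Ipow_mod (Suc (r + s))) A"
  shows "i0 A (int r) (1 + int s) (cls r (Ipow_mod (Suc s)) A (\<mu> \<circ> step_cochain r (Suc s))) =
    cls (Suc r) (Ipow_mod s) A ((if even r then - \<mu> else \<mu>) \<circ> step_cochain (Suc r) s)"
proof -
  let ?\<mu> = "if even r then - \<mu> else \<mu>"
  interpret bar_split_sequence "Ipow_mod (Suc s)" "ZIpow_mod s" "Ipow_mod s" eps_tensor A by (rule Ipow_sequence[OF A])
  have \<mu>': "?\<mu> \<in> lhom (Ipow_mod (Suc r + s)) A"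
    using \<mu> lhom_uminus[OF A \<mu>] by simp
  have \<mu>0: "\<mu> 0 = 0" by (rule lhom_apply_zero[OF \<mu> Ipow_module])
  have neg: "\<mu> (- m) = - \<mu> m" if "m \<in> I_power (Suc (r + s))" for m
    by (rule module_map_minus(2)[OF lhom_module_map[OF \<mu>] Ipow_module]) (use that in \<open>simp add: Ipow_mod_def\<close>)
  have "lift r (\<mu> \<circ> step_cochain r (Suc s)) (\<mu> \<circ> split_cochain r s) (?\<mu> \<circ> step_cochain (Suc r) s)"
    unfolding lift_def
  proof (intro conjI)
    show "\<mu> \<circ> split_cochain r s \<in> lhom (bar r (ZIpow_mod s)) A"
      by (rule coefficient_hom[OF Ipow_module \<mu> split_cochain_hom])
    show "pullback r (Ipow_mod (Suc s)) id (\<mu> \<circ> split_cochain r s) = \<mu> \<circ> step_cochain r (Suc s)"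
      by (simp add: coefficient_pullback \<mu>0 split_cochain_restrict)
    show "?\<mu> \<circ> step_cochain (Suc r) s \<in> cocycles (Suc r) (Ipow_mod s) A"
      by (rule step_cochain_cocycle[OF A \<mu>'])
    have "step_cochain (Suc r) s x \<in> I_power (Suc (r + s))" for x :: "('g \<times> 'g) list \<Rightarrow>\<^sub>0 'g tensors"
    proof (cases "x \<in> carr (bar (Suc r) (Ipow_mod s))")
      case True
      then show ?thesis using module_mapD(1)[OF lhom_module_map[OF step_cochain_hom[of "Suc r" s]]] by (simp add: Ipow_mod_def)
    next
      case False
      then show ?thesis using Ipow_0 by (simp add: step_cochain_def restrict0_def del: I_power.simps)
    qed
    then have "?\<mu> \<circ> step_cochain (Suc r) s = \<mu> \<circ> (if even r then - step_cochain (Suc r) s else step_cochain (Suc r) s)"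
      by (auto simp: neg simp del: I_power.simps intro!: ext)
    then show "pullback (Suc r) (ZIpow_mod s) eps_tensor (?\<mu> \<circ> step_cochain (Suc r) s) =
      coboundary r (ZIpow_mod s) (\<mu> \<circ> split_cochain r s)"
      by (simp only: coefficient_pullback[of \<mu>, OF \<mu>0] coefficient_coboundary[of \<mu>, OF \<mu>0] split_cochain_coboundary)
  qed
  from connecting_cls[OF this] show ?thesis by (simp add: i0_connecting)
qed

text \<open>
  Passing to the set of classes removes the sign, since \<open>\<mu>\<close> and \<open>- \<mu>\<close> occur together.
\<close>

lemma i0_step_classes:
  fixes A :: "('g::group_add, 'a::ab_group_add) bimod"
  assumes A: "left_module A"
  shows "i0 A (int r) (1 + int s) ` step_classes A r (Suc s) = step_classes A (Suc r) s"
proof -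
  let ?L = "lhom (Ipow_mod (Suc (r + s))) A"
  let ?sg = "\<lambda>\<mu> :: 'g tensors \<Rightarrow> 'a. if even r then - \<mu> else \<mu>"
  have "?sg ` ?L = ?L"
  proof
    show "?sg ` ?L \<subseteq> ?L" using lhom_uminus[OF A] by auto
    show "?L \<subseteq> ?sg ` ?L"
    proof
      fix \<mu> assume "\<mu> \<in> ?L"
      then show "\<mu> \<in> ?sg ` ?L"
        using lhom_uminus[OF A, of \<mu>] by (intro image_eqI[of _ _ "?sg \<mu>"]) auto
    qed
  qed
  then have "step_classes A (Suc r) s = (\<lambda>\<mu>. cls (Suc r) (Ipow_mod s) A (?sg \<mu> \<circ> step_cochain (Suc r) s)) ` ?L"
    unfolding step_classes_def by (metis (no_types, lifting) add_Suc image_cong image_image)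
  also have "\<dots> = i0 A (int r) (1 + int s) ` step_classes A r (Suc s)"
    unfolding step_classes_def image_image by (intro image_cong) (simp_all add: i0_step_cochain[OF A])
  finally show ?thesis by simp
qed

text \<open>
  The cocycle condition for the edge from \<open>0\<close> to \<open>x\<close> makes a 0-cocycle take the same value at all
  vertices. So it is a homomorphism on \<open>I^n\<close> composed with the augmentation of the bar resolution.
\<close>

lemma step_classes_0:
  fixes A :: "('g::group_add, 'a::ab_group_add) bimod"
  assumes A: "left_module A"
  shows "step_classes A 0 n = carrier (D0 A 0 (int n))"
proof
  show "step_classes A 0 n \<subseteq> carrier (D0 A 0 (int n))"
    using step_cochain_cocycle[OF A, of _ 0 n] D0_Ext[of A 0 n] by (auto simp: step_classes_def Ext_carrier)
  show "carrier (D0 A 0 (int n)) \<subseteq> step_classes A 0 n"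
  proof
    fix X assume "X \<in> carrier (D0 A 0 (int n))"
    then obtain \<phi> where \<phi>: "\<phi> \<in> cocycles 0 (Ipow_mod n) A" "X = cls 0 (Ipow_mod n) A \<phi>"
      using D0_Ext[of A 0 n] by (auto simp: Ext_carrier)
    let ?I = "Ipow_mod n :: ('g, 'g tensors) bimod"
    have \<phi>h: "\<phi> \<in> lhom (bar 0 ?I) A" and d: "coboundary 0 ?I \<phi> = 0" using \<phi> by (auto simp: cocycles_def)
    note \<phi>m = lhom_module_map[OF \<phi>h]
    have c: "single [x] m \<in> carr (bar 0 ?I)" if "m \<in> carr ?I" for x m
      using that by (simp add: bar_carr_single[OF Ipow_module])
    have const: "\<phi> (single [x] m) = \<phi> (single [0] m)" if "m \<in> carr ?I" for x m
      using coboundary_single[OF Ipow_module \<phi>h _ that, of "[0, x]"] d by simp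
    let ?\<mu> = "restrict0 (carr ?I) (\<lambda>m. \<phi> (single [0] m))"
    have \<mu>: "?\<mu> \<in> lhom ?I A"
      unfolding module_map_restrict0[OF Ipow_module]
    proof (rule module_mapI[OF Ipow_module A])
      fix h :: "'g \<times> 'g" and m assume m: "m \<in> carr ?I"
      have "smul (bar 0 ?I) (frag_of h) (single [0] m) = single [h] (smul ?I (frag_of h) m)"
        by (simp add: bar_smul_single[OF Ipow_module m])
      then show "\<phi> (single [0] (smul ?I (frag_of h) m)) = smul A (frag_of h) (\<phi> (single [0] m))"
        using module_mapD(3)[OF \<phi>m c[OF m, of 0], of "frag_of h"] const[OF left_moduleD(4)[OF Ipow_module m], of h "frag_of h"] by simp
    qed (use c module_mapD[OF \<phi>m] in \<open>auto simp: single_add\<close>)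
    have "?\<mu> \<circ> step_cochain 0 n = \<phi>"
    proof (rule lhom_bar_eqI[OF Ipow_module])
      show "?\<mu> \<circ> step_cochain 0 n \<in> lhom (bar 0 ?I) A"
        using coefficient_hom[OF Ipow_module \<mu>] step_cochain_hom[of 0 n] by simp
      fix \<sigma> :: "('g \<times> 'g) list" and m assume \<sigma>: "length \<sigma> = Suc 0" and m: "m \<in> carr ?I"
      from \<sigma> obtain x where "\<sigma> = [x]" by (metis length_0_conv length_Suc_conv)
      then show "(?\<mu> \<circ> step_cochain 0 n) (single \<sigma> m) = \<phi> (single \<sigma> m)"
        using m const[OF m, of x] step_cochain_single[of "[x]" 0 m n] by (simp add: restrict0_def Ipow_mod_def)
    qed (rule \<phi>h)
    then show "X \<in> step_classes A 0 n" using \<mu> \<phi>(2) by (auto simp: step_classes_def image_iff intro!: bexI[of _ ?\<mu>])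
  qed
qed

theorem iterate_step_classes:
  assumes A: "left_module A"
  shows "i0_iter A k (int r) (int (k + s)) ` step_classes A r (k + s) = step_classes A (r + k) s"
proof (induction k arbitrary: r)
  case (Suc k)
  have "i0_iter A (Suc k) (int r) (int (Suc k + s)) ` step_classes A r (Suc k + s) =
    i0_iter A k (int (Suc r)) (int (k + s)) ` (i0 A (int r) (1 + int (k + s)) ` step_classes A r (Suc (k + s)))"
    unfolding image_image by (simp add: add.commute)
  also have "\<dots> = step_classes A (r + Suc k) s"
    unfolding i0_step_classes[OF A] Suc.IH by simp
  finally show ?case .
qed simp

section \<open>Powers of the canonical class\<close>

abbreviation triv :: "('g::group_add, 'g tensors) bimod" where
  "triv \<equiv> Ipow_mod 0"

lemma lhom_trivial_eqI:
  fixes f g :: "(('g::group_add \<times> 'g) list \<Rightarrow>\<^sub>0 'g tensors) \<Rightarrow> 'n::ab_group_add"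
  assumes f: "f \<in> lhom (bar r triv) N" and g: "g \<in> lhom (bar r triv) N"
    and eq: "\<And>\<sigma>. length \<sigma> = Suc r \<Longrightarrow> f (single \<sigma> (frag_of [])) = g (single \<sigma> (frag_of []))"
  shows "f = g"
  by (rule lhom_bar_free_eqI[OF Ipow_module _ f g, of "{[]}"]) (use eq in \<open>auto simp: Ipow_mod_def\<close>)

text \<open>
  The generators of the standard resolution: as \<open>I^0\<close> is spanned by the empty word, a cochain with
  trivial first variable is determined by its values on them.
\<close>

abbreviation pt :: "('g::group_add \<times> 'g) list \<Rightarrow> ('g \<times> 'g) list \<Rightarrow>\<^sub>0 'g tensors" where
  "pt \<sigma> \<equiv> single \<sigma> (frag_of [])"

lemma pt_carr: "length \<sigma> = Suc r \<Longrightarrow> pt \<sigma> \<in> carr (bar r triv)"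
  by (intro bar_carr_single[OF Ipow_module]) (auto simp: Ipow_mod_def)

lemma Ipow_0_act: "m \<in> I_power 0 \<Longrightarrow> tact h m = m"
proof -
  assume "m \<in> I_power 0"
  then have "frag_extend (\<lambda>w. frag_of (map (bact h) w)) m = frag_extend frag_of m"
    by (intro frag_extend_eq) auto
  then show ?thesis by (simp add: perm_smul_of frag_expansion[symmetric])
qed

lemma pt_equivariant:
  assumes f: "f \<in> lhom (bar r triv) N" and \<sigma>: "length \<sigma> = Suc r"
  shows "f (pt (map ((+) h) \<sigma>)) = smul N (frag_of h) (f (pt \<sigma>))"
proof -
  have "smul (bar r triv) (frag_of h) (pt \<sigma>) = pt (map ((+) h) \<sigma>)"
    by (subst bar_smul_single[OF Ipow_module]) (simp_all add: Ipow_mod_def Ipow_0_act)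
  then show ?thesis using module_mapD(3)[OF lhom_module_map[OF f] pt_carr[OF \<sigma>], of "frag_of h"] by simp
qed

lemma coboundary_pt:
  assumes "f \<in> lhom (bar r triv) N" "length \<sigma> = Suc (Suc r)"
  shows "coboundary r triv f (pt \<sigma>) = face_sum (\<lambda>\<tau>. f (pt \<tau>)) \<sigma>"
  using assms by (intro coboundary_single[OF Ipow_module]) (auto simp: Ipow_mod_def)

lemma tact_cmul: "tact h (frag_cmul c y) = frag_cmul c (tact h y)"
  by (simp add: perm_smul_of frag_extend_cmul)

lemma cup_cochain_hom:
  assumes f: "f \<in> lhom (bar p triv) I_mod" and f': "f' \<in> lhom (bar q triv) (Ipow_mod s)"
  shows "cup_cochain p q f f' \<in> lhom (bar (p + q) triv) (Ipow_mod (Suc s))"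
    and "length \<sigma> = Suc (p + q) \<Longrightarrow> cup_cochain p q f f' (pt \<sigma>) =
      tensor (f (pt (take (Suc p) \<sigma>))) (f' (pt (drop p \<sigma>)))"
proof -
  define F where "F \<sigma> z = frag_cmul (Poly_Mapping.lookup z ([] :: 'a list))
     (tensor (f (pt (take (Suc p) \<sigma>))) (f' (pt (drop p \<sigma>))))" for \<sigma> z
  have c: "F \<sigma> m \<in> carr (Ipow_mod (Suc s) :: ('a, _) bimod)" if "length \<sigma> = Suc (p + q)" for \<sigma> m
  proof -
    have "f (pt (take (Suc p) \<sigma>)) \<in> aug_ideal" "f' (pt (drop p \<sigma>)) \<in> I_power s"
      using module_mapD(1)[OF lhom_module_map[OF f] pt_carr] module_mapD(1)[OF lhom_module_map[OF f'] pt_carr] that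
      by (auto simp: I_mod_def Ipow_mod_def)
    then have "tensor (f (pt (take (Suc p) \<sigma>))) (f' (pt (drop p \<sigma>))) \<in> I_power (Suc s)" by (simp add: tensor_in_group)
    then have "F \<sigma> m \<in> I_power (Suc s)" unfolding F_def by (rule Ipow_cmul)
    then show ?thesis by (simp add: Ipow_mod_def)
  qed
  have a: "F \<sigma> (m + m') = F \<sigma> m + F \<sigma> m'" for \<sigma> m m' by (simp add: F_def lookup_add frag_cmul_distrib)
  have e: "F (map ((+) h) \<sigma>) (smul triv (frag_of h) m) = smul (Ipow_mod (Suc s)) (frag_of h) (F \<sigma> m)"
    if "length \<sigma> = Suc (p + q)" "m \<in> carr (Ipow_mod 0 :: ('a, _) bimod)" for h \<sigma> m
  proof -
    have "tact h m = m" using that(2) by (intro Ipow_0_act) (simp add: Ipow_mod_def)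
    then show ?thesis using that pt_equivariant[OF f, of "take (Suc p) \<sigma>" h] pt_equivariant[OF f', of "drop p \<sigma>" h]
      by (simp add: F_def Ipow_mod_def I_mod_def take_map drop_map tact_cmul perm_tensor)
  qed
  have u: "cup_cochain p q f f' = restrict0 (carr (bar (p + q) triv)) (add_extend F)"
    by (simp add: cup_cochain_def F_def[abs_def])
  show "cup_cochain p q f f' \<in> lhom (bar (p + q) triv) (Ipow_mod (Suc s))"
    unfolding u by (rule bar_lift(1)[OF Ipow_module Ipow_module a]) (erule c, erule (1) e)
  show "cup_cochain p q f f' (pt \<sigma>) = tensor (f (pt (take (Suc p) \<sigma>))) (f' (pt (drop p \<sigma>)))" if "length \<sigma> = Suc (p + q)"
  proof -
    have "cup_cochain p q f f' (pt \<sigma>) = F \<sigma> (frag_of [])"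
      unfolding u by (rule bar_lift(2)[where N = "Ipow_mod (Suc s)", OF Ipow_module Ipow_module a _ _ that])
        (erule c, erule (1) e, simp add: Ipow_mod_def)
    then show ?thesis by (simp add: F_def)
  qed
qed

text \<open>
  This and the next lemma are the cases of the Leibniz rule in which the first factor has degree 0
  or 1 and one factor is a cocycle. They show that cup multiplication by a 1-class is well defined.
\<close>

lemma cup_0_coboundary:
  assumes g: "g \<in> lhom (bar 0 triv) I_mod" and f': "f' \<in> cocycles q triv (Ipow_mod s)"
  shows "coboundary q triv (cup_cochain 0 q g f') = cup_cochain 1 q (coboundary 0 triv g) f'"
proof (rule lhom_trivial_eqI)
  have f'h: "f' \<in> lhom (bar q triv) (Ipow_mod s)" and d: "coboundary q triv f' = 0"
    using f' by (auto simp: cocycles_def)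
  have dg: "coboundary 0 triv g \<in> lhom (bar 1 triv) I_mod"
    using coboundary_hom[OF Ipow_module g] by simp
  note c0 = cup_cochain_hom[OF g f'h, simplified] and c1 = cup_cochain_hom[OF dg f'h, simplified]
  show "coboundary q triv (cup_cochain 0 q g f') \<in> lhom (bar (Suc q) triv) (Ipow_mod (Suc s))"
    by (rule coboundary_hom[OF Ipow_module c0(1)])
  show "cup_cochain 1 q (coboundary 0 triv g) f' \<in> lhom (bar (Suc q) triv) (Ipow_mod (Suc s))"
    using c1(1) by simp
  fix \<sigma> :: "('a \<times> 'a) list" assume \<sigma>: "length \<sigma> = Suc (Suc q)"
  obtain x y \<tau> where xy: "\<sigma> = x # y # \<tau>" using \<sigma> by (metis length_Suc_conv)
  let ?G = "\<lambda>\<tau>. f' (pt \<tau>)" and ?F = "\<lambda>\<tau>. tensor (g (pt (take 1 \<tau>))) (f' (pt \<tau>))"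
  have "face_sum ?G \<sigma> = 0" using coboundary_pt[OF f'h \<sigma>] d by simp
  then have G: "face_sum (\<lambda>\<tau>. ?G (x # \<tau>)) (y # \<tau>) = ?G (y # \<tau>)"
    using face_sum_Cons[of ?G x "y # \<tau>"] by (simp add: xy del: face_sum_Cons)
  have "coboundary q triv (cup_cochain 0 q g f') (pt \<sigma>) = face_sum ?F \<sigma>"
    using coboundary_pt[OF c0(1) \<sigma>] \<sigma> by (simp add: c0(2) cong: face_sum_cong)
  also have "\<dots> = ?F (y # \<tau>) - face_sum (\<lambda>\<tau>. tensor (g (pt [x])) (?G (x # \<tau>))) (y # \<tau>)"
    unfolding xy by (subst face_sum_Cons) simp
  also have "\<dots> = tensor (g (pt [y]) - g (pt [x])) (?G (y # \<tau>))"
    by (subst face_sum_additive[of "tensor (g (pt [x]))", OF tensor_add_right]) (simp only: G, simp add: tensor_diff_left)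
  also have "g (pt [y]) - g (pt [x]) = coboundary 0 triv g (pt [x, y])"
    by (subst coboundary_pt[OF g]) simp_all
  also have "tensor \<dots> (?G (y # \<tau>)) = cup_cochain 1 q (coboundary 0 triv g) f' (pt \<sigma>)"
    using c1(2)[of \<sigma>] \<sigma> unfolding xy by simp
  finally show "coboundary q triv (cup_cochain 0 q g f') (pt \<sigma>) =
    cup_cochain 1 q (coboundary 0 triv g) f' (pt \<sigma>)" .
qed

lemma cup_1_coboundary:
  assumes f: "f \<in> cocycles 1 triv I_mod" and g: "g \<in> lhom (bar q triv) (Ipow_mod s)"
  shows "coboundary (Suc q) triv (cup_cochain 1 q f g) = - cup_cochain 1 (Suc q) f (coboundary q triv g)"
proof (rule lhom_trivial_eqI)
  have fh: "f \<in> lhom (bar 1 triv) I_mod" and d: "coboundary 1 triv f = 0"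
    using f by (auto simp: cocycles_def)
  note c0 = cup_cochain_hom[OF fh g, simplified] and c1 = cup_cochain_hom[OF fh coboundary_hom[OF Ipow_module g], simplified]
  show "coboundary (Suc q) triv (cup_cochain 1 q f g) \<in> lhom (bar (Suc (Suc q)) triv) (Ipow_mod (Suc s))"
    by (rule coboundary_hom[OF Ipow_module]) (use c0(1) in simp)
  show "- cup_cochain 1 (Suc q) f (coboundary q triv g) \<in> lhom (bar (Suc (Suc q)) triv) (Ipow_mod (Suc s))"
    by (rule lhom_uminus[OF Ipow_module]) (use c1(1) in simp)
  fix \<sigma> :: "('a \<times> 'a) list" assume \<sigma>: "length \<sigma> = Suc (Suc (Suc q))"
  obtain x y z \<tau> where xy: "\<sigma> = x # y # z # \<tau>" using \<sigma> by (metis length_Suc_conv)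
  let ?G = "\<lambda>\<tau>. g (pt \<tau>)" and ?F = "\<lambda>\<tau>. tensor (f (pt (take 2 \<tau>))) (g (pt (drop 1 \<tau>)))"
  have "face_sum (\<lambda>\<tau>. f (pt \<tau>)) [x, y, z] = 0"
    using coboundary_pt[OF fh, of "[x, y, z]"] d by simp
  then have fz: "f (pt [x, y]) = f (pt [x, z]) - f (pt [y, z])" by (simp add: algebra_simps)
  have c0': "cup_cochain 1 q f g (pt \<tau>) = ?F \<tau>" if "Suc (length \<tau>) = length \<sigma>" for \<tau>
    using c0(2)[of \<tau>] that \<sigma> by (simp add: numeral_2_eq_2)
  have "coboundary (Suc q) triv (cup_cochain 1 q f g) (pt \<sigma>) = face_sum (\<lambda>\<tau>. cup_cochain 1 q f g (pt \<tau>)) \<sigma>"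
    by (rule coboundary_pt[OF _ \<sigma>]) (use c0(1) in simp)
  also have "\<dots> = face_sum ?F \<sigma>" by (rule face_sum_cong) (rule c0')
  also have "\<dots> = ?F (y # z # \<tau>) - (?F (x # z # \<tau>) - face_sum (\<lambda>\<tau>. tensor (f (pt [x, y])) (?G (y # \<tau>))) (z # \<tau>))"
    unfolding xy by (subst face_sum_Cons, subst face_sum_Cons) (simp add: numeral_2_eq_2)
  also have "\<dots> = - tensor (f (pt [x, y])) (?G (z # \<tau>) - face_sum (\<lambda>\<tau>. ?G (y # \<tau>)) (z # \<tau>))"
    by (subst face_sum_additive[of "tensor (f (pt [x, y]))", OF tensor_add_right])
       (simp add: tensor_diff_right fz tensor_diff_left numeral_2_eq_2)
  also have "?G (z # \<tau>) - face_sum (\<lambda>\<tau>. ?G (y # \<tau>)) (z # \<tau>) = face_sum ?G (y # z # \<tau>)"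
    by (rule face_sum_Cons[symmetric])
  also have "face_sum ?G (y # z # \<tau>) = coboundary q triv g (pt (y # z # \<tau>))"
    using \<sigma> xy by (subst coboundary_pt[OF g]) simp_all
  also have "- tensor (f (pt [x, y])) \<dots> = (- cup_cochain 1 (Suc q) f (coboundary q triv g)) (pt \<sigma>)"
    using c1(2)[of \<sigma>] \<sigma> unfolding xy by simp
  finally show "coboundary (Suc q) triv (cup_cochain 1 q f g) (pt \<sigma>) =
    (- cup_cochain 1 (Suc q) f (coboundary q triv g)) (pt \<sigma>)" .
qed

lemma cup_cochain_diff:
  assumes f: "f \<in> lhom (bar p triv) I_mod" "f2 \<in> lhom (bar p triv) I_mod"
    and f': "f' \<in> lhom (bar q triv) (Ipow_mod s)" "f2' \<in> lhom (bar q triv) (Ipow_mod s)"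
  shows "cup_cochain p q f f' - cup_cochain p q f2 f2' = cup_cochain p q (f - f2) f' + cup_cochain p q f2 (f' - f2')"
proof (rule lhom_trivial_eqI)
  note I = add_subgroupD[OF lhom_subgroup[OF I_module]] and P = add_subgroupD[OF lhom_subgroup[OF Ipow_module]]
  note c = cup_cochain_hom[OF f(1) f'(1)] cup_cochain_hom[OF f(2) f'(2)] cup_cochain_hom[OF I(2)[OF f] f'(1)]
    cup_cochain_hom[OF f(2) P(2)[OF f']]
  show "cup_cochain p q f f' - cup_cochain p q f2 f2' \<in> lhom (bar (p + q) triv) (Ipow_mod (Suc s))"
    "cup_cochain p q (f - f2) f' + cup_cochain p q f2 (f' - f2') \<in> lhom (bar (p + q) triv) (Ipow_mod (Suc s))"
    by (intro P c)+
qed (simp add: cup_cochain_hom[OF f(1) f'(1)] cup_cochain_hom[OF f(2) f'(2)]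
    cup_cochain_hom[OF lhom_diff[OF I_module f] f'(1)]
    cup_cochain_hom[OF f(2) lhom_diff[OF Ipow_module f']] tensor_diff_left tensor_diff_right)

lemma cup_cls:
  assumes f: "f \<in> cocycles 1 triv I_mod" and f': "f' \<in> cocycles n triv (Ipow_mod s)"
  shows "cup 1 n s (cls 1 triv I_mod f) (cls n triv (Ipow_mod s) f') =
    cls (Suc n) triv (Ipow_mod (Suc s)) (cup_cochain 1 n f f')"
proof -
  have "cup_cochain 1 n f2 f2' - cup_cochain 1 n f f' \<in> coboundaries (Suc n) triv (Ipow_mod (Suc s))"
    if f2: "f2 \<in> cls 1 triv I_mod f" and f2': "f2' \<in> cls n triv (Ipow_mod s) f'" for f2 f2'
  proof -
    have df: "f2 - f \<in> coboundaries 1 triv I_mod" and df': "f2' - f' \<in> coboundaries n triv (Ipow_mod s)"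
      using f2 f2' by (simp_all add: mem_cls_iff)
    have "f2 - f + f \<in> cocycles 1 triv I_mod"
      by (rule cocycles_add[OF I_module _ f]) (use df coboundaries_cocycles[OF Ipow_module I_module] in blast)
    then have f2c: "f2 \<in> cocycles 1 triv I_mod" by simp
    have "f2' - f' + f' \<in> cocycles n triv (Ipow_mod s)"
      by (rule cocycles_add[OF Ipow_module _ f']) (use df' coboundaries_cocycles[OF Ipow_module Ipow_module] in blast)
    then have f2c': "f2' \<in> cocycles n triv (Ipow_mod s)" by simp
    have h: "f \<in> lhom (bar 1 triv) I_mod" "f2 \<in> lhom (bar 1 triv) I_mod"
      "f' \<in> lhom (bar n triv) (Ipow_mod s)" "f2' \<in> lhom (bar n triv) (Ipow_mod s)"
      using f f' f2c f2c' by (auto simp: cocycles_def)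
    obtain g where g: "g \<in> lhom (bar 0 triv) I_mod" "f2 - f = coboundary 0 triv g"
      using df by (auto simp: coboundaries_def)
    have 1: "cup_cochain 1 n (f2 - f) f2' \<in> coboundaries (Suc n) triv (Ipow_mod (Suc s))"
      using cup_0_coboundary[OF g(1) f2c'] cup_cochain_hom(1)[OF g(1) h(4)]
      by (simp add: coboundaries_def g(2)) (metis image_eqI)
    have 2: "cup_cochain 1 n f (f2' - f') \<in> coboundaries (Suc n) triv (Ipow_mod (Suc s))"
    proof (cases n)
      case 0
      then have "f2' - f' = 0" using df' by (simp add: coboundaries_def)
      moreover have "cup_cochain 1 n f 0 = 0"
        unfolding cup_cochain_def by (auto simp: restrict0_def add_extend_def tensor_zero_right)
      ultimately show ?thesis using coboundaries_zero[OF Ipow_module] by simp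
    next
      case (Suc q)
      then obtain g' where g': "g' \<in> lhom (bar q triv) (Ipow_mod s)" "f2' - f' = coboundary q triv g'"
        using df' by (auto simp: coboundaries_def)
      have "- cup_cochain 1 q f g' \<in> lhom (bar (Suc q) triv) (Ipow_mod (Suc s))"
        using lhom_uminus[OF Ipow_module cup_cochain_hom(1)[OF h(1) g'(1)]] by simp
      moreover have "cup_cochain 1 n f (f2' - f') = coboundary (Suc q) triv (- cup_cochain 1 q f g')"
        by (simp only: coboundary_uminus cup_1_coboundary[OF f g'(1)] g'(2) Suc minus_minus)
      ultimately show ?thesis by (simp add: coboundaries_def Suc)
    qed
    show ?thesis
      unfolding cup_cochain_diff[OF h(2,1) h(4,3)]
      by (rule coboundaries_add[OF Ipow_module 1 2])
  qed
  then have "cls (Suc n) triv (Ipow_mod (Suc s)) (cup_cochain 1 n f2 f2') = cls (Suc n) triv (Ipow_mod (Suc s)) (cup_cochain 1 n f f')"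
    if "f2 \<in> cls 1 triv I_mod f" "f2' \<in> cls n triv (Ipow_mod s) f'" for f2 f2'
    using that unfolding cls_eq_iff[OF Ipow_module] by blast
  then have "{cls (Suc n) triv (Ipow_mod (Suc s)) (cup_cochain 1 n f2 f2') | f2 f2'.
      f2 \<in> cls 1 triv I_mod f \<and> f2' \<in> cls n triv (Ipow_mod s) f'} =
    {cls (Suc n) triv (Ipow_mod (Suc s)) (cup_cochain 1 n f f')}"
    using cls_self[OF I_module, of f 1 "Ipow_mod 0"] cls_self[OF Ipow_module, of f' n "Ipow_mod 0" s]
    by blast
  then show ?thesis unfolding cup_def by simp
qed

definition step_cocycle :: "('g::group_add, 'g \<Rightarrow>\<^sub>0 int) cochain" where
  "step_cocycle = crossed_cocycle I_mod (\<lambda>(g, h). frag_of (g - h) - frag_of 0)"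

lemma step_cocycle_hom_pt:
  fixes x y :: "'g::group_add \<times> 'g"
  shows "(step_cocycle :: ('g, 'g \<Rightarrow>\<^sub>0 int) cochain) \<in> lhom (bar 1 triv) I_mod"
    and "step_cocycle (pt [x, y]) = step x y"
proof -
  define F :: "('g \<times> 'g) list \<Rightarrow> 'g tensors \<Rightarrow> ('g \<Rightarrow>\<^sub>0 int)" where
    "F \<sigma> z = smul I_mod (single (\<sigma> ! 0) (Poly_Mapping.lookup z [])) (step 0 (- (\<sigma> ! 0) + \<sigma> ! 1))" for \<sigma> z
  have "(case - x + y of (g, h) \<Rightarrow> frag_of (g - h) - frag_of 0) = step 0 (- x + y)" for x y :: "'g \<times> 'g"
    by (cases "- x + y") (simp add: step_def)
  then have u: "step_cocycle = restrict0 (carr (bar 1 triv)) (add_extend F)"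
    by (simp add: step_cocycle_def crossed_cocycle_def F_def[abs_def])
  have I: "step 0 v \<in> carr I_mod" for v :: "'g \<times> 'g" by (simp add: I_mod_def step_aug)
  have c: "F \<sigma> m \<in> carr I_mod" for \<sigma> m unfolding F_def by (rule left_moduleD(4)[OF I_module I])
  have a: "F \<sigma> (m + m') = F \<sigma> m + F \<sigma> m'" for \<sigma> m m'
    by (simp add: F_def lookup_add single_add left_moduleD(6)[OF I_module I])
  have e: "F (map ((+) h) \<sigma>) (smul triv (frag_of h) m) = smul I_mod (frag_of h) (F \<sigma> m)"
    if l: "length \<sigma> = Suc 1" and m0: "m \<in> carr (Ipow_mod 0 :: ('g, _) bimod)" for h \<sigma> m
  proof -
    obtain x y where xy: "\<sigma> = [x, y]" using l unfolding One_nat_def length_Suc_conv length_0_conv by blast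
    have m: "smul triv (frag_of h) m = m" using m0 by (simp add: Ipow_mod_def Ipow_0_act)
    have F2: "F [x, y] z = smul I_mod (single x (Poly_Mapping.lookup z [])) (step 0 (- x + y))" for x y z
      by (simp add: F_def)
    have d: "- (h + x) + (h + y) = - x + y" by (simp only: minus_add add.assoc minus_add_cancel)
    have "F (map ((+) h) \<sigma>) (smul triv (frag_of h) m) =
      smul I_mod (single (h + x) (Poly_Mapping.lookup m [])) (step 0 (- x + y))"
      by (simp only: xy list.map F2 m d)
    also have "single (h + x) (Poly_Mapping.lookup m []) = frag_of h * single x (Poly_Mapping.lookup m [])"
      by (simp add: mult_single)
    finally show ?thesis by (simp only: left_moduleD(7)[OF I_module I] xy F2)
  qed
  show "(step_cocycle :: ('g, 'g \<Rightarrow>\<^sub>0 int) cochain) \<in> lhom (bar 1 triv) I_mod"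
    unfolding u by (rule bar_lift(1)[OF Ipow_module I_module a c]) (erule (1) e)
  show "step_cocycle (pt [x, y]) = step x y" for x y :: "'g \<times> 'g"
  proof -
    have "step_cocycle (pt [x, y]) = F [x, y] (frag_of [])"
      unfolding u by (rule bar_lift(2)[where N = I_mod, OF Ipow_module I_module a c])
        (erule (1) e, simp_all add: Ipow_mod_def)
    also have "\<dots> = perm_smul bact (frag_of x) (step 0 (- x + y))" by (simp add: F_def I_mod_def)
    also have "\<dots> = step x y" by (simp add: step_act add.assoc[symmetric])
    finally show ?thesis .
  qed
qed

lemmas step_cocycle_hom = step_cocycle_hom_pt(1) and step_cocycle_pt = step_cocycle_hom_pt(2)

lemma step_cocycle: "(step_cocycle :: ('g::group_add, 'g \<Rightarrow>\<^sub>0 int) cochain) \<in> cocycles 1 triv I_mod"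
proof -
  have "coboundary 1 triv (step_cocycle :: ('g, 'g \<Rightarrow>\<^sub>0 int) cochain) = 0"
  proof (rule lhom_trivial_eqI)
    show "coboundary 1 triv step_cocycle \<in> lhom (bar (Suc 1) triv) I_mod"
      by (rule coboundary_hom[OF Ipow_module step_cocycle_hom])
    show "0 \<in> lhom (bar (Suc 1) triv) I_mod" by (rule lhom_zero[OF I_module])
    fix \<sigma> :: "('g \<times> 'g) list" assume \<sigma>: "length \<sigma> = Suc (Suc 1)"
    then obtain x y z where xyz: "\<sigma> = [x, y, z]" unfolding One_nat_def length_Suc_conv length_0_conv by blast
    show "coboundary 1 triv step_cocycle (pt \<sigma>) = 0 (pt \<sigma>)"
      using coboundary_pt[OF step_cocycle_hom \<sigma>] unfolding xyz by (simp add: step_cocycle_pt) (simp add: step_def)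
  qed
  then show ?thesis using step_cocycle_hom by (simp add: cocycles_def)
qed

lemma step_cochain_0_cocycle:
  "(step_cochain n 0 :: ('g::group_add, 'g tensors) cochain) \<in> cocycles n triv (Ipow_mod n)"
proof -
  have "module_map (Ipow_mod n :: ('g, _) bimod) (Ipow_mod n) (\<lambda>x. x)" by (simp add: module_map_def)
  then have id: "restrict0 (carr (Ipow_mod n)) (\<lambda>x. x) \<in> lhom (Ipow_mod n :: ('g, _) bimod) (Ipow_mod n)"
    by (simp add: module_map_restrict0 Ipow_module)
  have "step_cochain n 0 x \<in> carr (Ipow_mod n)" if "x \<in> carr (bar n triv)" for x :: "('g \<times> 'g) list \<Rightarrow>\<^sub>0 _"
    using module_mapD(1)[OF lhom_module_map[OF step_cochain_hom[of n 0]] that] by simp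
  then have "restrict0 (carr (Ipow_mod n)) (\<lambda>x. x) \<circ> step_cochain n 0 = (step_cochain n 0 :: ('g, 'g tensors) cochain)"
    by (auto simp: restrict0_def fun_eq_iff step_cochain_def)
  then show "(step_cochain n 0 :: ('g, 'g tensors) cochain) \<in> cocycles n triv (Ipow_mod n)"
    using step_cochain_cocycle[OF Ipow_module, of _ n 0 n] id by (metis add.right_neutral)
qed

text \<open>
  Cupping on the left with the canonical cocycle puts one step in front of the given ones.
\<close>

theorem canonical_power_eq:
  "canonical_power n = cls n triv (Ipow_mod n) (step_cochain n 0)"
proof (induction n)
  case 0
  have "add_extend (\<lambda>\<sigma> z. z) x = add_extend steps x" if "x \<in> carr (bar 0 triv)"
    for x :: "('a \<times> 'a) list \<Rightarrow>\<^sub>0 'a tensors"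
    unfolding add_extend_def
  proof (rule sum.cong)
    fix \<sigma> assume "\<sigma> \<in> Poly_Mapping.keys x"
    then have "length \<sigma> = Suc 0" using that by (simp add: bar_def)
    then obtain a where "\<sigma> = [a]" by (metis length_0_conv length_Suc_conv)
    then show "Poly_Mapping.lookup x \<sigma> = steps \<sigma> (Poly_Mapping.lookup x \<sigma>)" by simp
  qed simp
  then have "restrict0 (carr (bar 0 triv)) (add_extend (\<lambda>\<sigma> z. z)) = (step_cochain 0 0 :: ('a, 'a tensors) cochain)"
    by (auto simp: step_cochain_def restrict0_def)
  then show ?case by simp
next
  case (Suc n)
  have "cup_cochain 1 n step_cocycle (step_cochain n 0) = (step_cochain (Suc n) 0 :: ('a, 'a tensors) cochain)"
  proof (rule lhom_trivial_eqI)
    have h: "step_cochain n 0 \<in> lhom (bar n triv) (Ipow_mod n)" using step_cochain_hom[of n 0] by simp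
    note cc = cup_cochain_hom[OF step_cocycle_hom h]
    show "cup_cochain 1 n step_cocycle (step_cochain n 0) \<in> lhom (bar (Suc n) triv) (Ipow_mod (Suc n))"
      using cc(1) by simp
    show "step_cochain (Suc n) 0 \<in> lhom (bar (Suc n) triv) (Ipow_mod (Suc n))"
      using step_cochain_hom[of "Suc n" 0] by simp
    fix \<sigma> :: "('a \<times> 'a) list" assume \<sigma>: "length \<sigma> = Suc (Suc n)"
    obtain x y \<tau> where xy: "\<sigma> = x # y # \<tau>" using \<sigma> by (metis length_Suc_conv)
    show "cup_cochain 1 n step_cocycle (step_cochain n 0) (pt \<sigma>) = step_cochain (Suc n) 0 (pt \<sigma>)"
      using cc(2)[of \<sigma>] \<sigma> unfolding xy by (simp add: step_cocycle_pt step_cochain_single)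
  qed
  then show ?case
    unfolding canonical_power.simps Suc.IH canonical_class_def step_cocycle_def[symmetric]
    by (simp only: cup_cls[OF step_cocycle step_cochain_0_cocycle])
qed

lemma coeff_map_canonical_power:
  fixes A :: "('g::group_add, 'a::ab_group_add) bimod"
  assumes A: "left_module A" and \<mu>: "\<mu> \<in> lhom (Ipow_mod n) A"
  shows "coeff_map n A \<mu> (canonical_power n) = cls n triv A (\<mu> \<circ> step_cochain n 0)"
  unfolding coeff_map_def canonical_power_eq
proof (rule the_elem_image_cls[where f = "\<lambda>\<phi>. \<mu> \<circ> \<phi>", OF Ipow_module A])
  fix \<psi> :: "('g, 'g tensors) cochain" assume d: "\<psi> - step_cochain n 0 \<in> coboundaries n triv (Ipow_mod n)"
  let ?\<delta> = "\<psi> - step_cochain n 0" and ?M = "Ipow_mod 0 :: ('g, _) bimod" and ?N = "Ipow_mod n :: ('g, _) bimod"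
  note \<mu>m = lhom_module_map[OF \<mu>]
  have \<mu>0: "\<mu> 0 = 0" by (rule module_map_minus(1)[OF \<mu>m Ipow_module])
  have N: "f x \<in> carr ?N" if "f \<in> lhom (bar n ?M) ?N" for f x
    using that left_moduleD(1)[OF Ipow_module, of n] by (cases "x \<in> carr (bar n ?M)") (auto simp: lhom_def)
  have dh: "?\<delta> \<in> lhom (bar n ?M) ?N" using d coboundaries_cocycles[OF Ipow_module Ipow_module] by (auto simp: cocycles_def)
  have sh: "step_cochain n 0 \<in> lhom (bar n ?M) ?N" using step_cochain_hom[of n 0] by simp
  have "\<mu> (\<psi> x) - \<mu> (step_cochain n 0 x) = \<mu> (?\<delta> x)" for x
    using module_mapD(2)[OF \<mu>m N[OF dh, of x] N[OF sh, of x]] by simp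
  then have eq: "(\<mu> \<circ> \<psi>) - (\<mu> \<circ> step_cochain n 0) = (\<mu> \<circ> ?\<delta>)" by (auto simp: fun_eq_iff)
  show "(\<mu> \<circ> \<psi>) - (\<mu> \<circ> step_cochain n 0) \<in> coboundaries n triv A"
  proof (cases n)
    case 0
    then have "\<mu> \<circ> ?\<delta> = 0" using d \<mu>0 by (simp add: coboundaries_def) (auto simp: comp_def)
    then show ?thesis unfolding eq using coboundaries_zero[OF A] by simp
  next
    case (Suc q)
    then obtain \<theta> where \<theta>: "\<theta> \<in> lhom (bar q ?M) ?N" "?\<delta> = coboundary q ?M \<theta>" using d by (auto simp: coboundaries_def)
    then show ?thesis unfolding eq using Suc coefficient_hom[OF Ipow_module \<mu> \<theta>(1)]
      by (simp add: coboundaries_def flip: coefficient_coboundary[of \<mu>, OF \<mu>0])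
  qed
qed

corollary essential_iff:
  fixes A :: "('g::group_add, 'a::ab_group_add) bimod"
  assumes A: "left_module A"
  shows "essential n A \<alpha> \<longleftrightarrow> \<alpha> \<in> step_classes A n 0"
  by (auto simp: essential_def step_classes_def coeff_map_canonical_power[OF A])

theorem essential_iff_iterated_image:
  fixes A :: "('g::group_add, 'a::ab_group_add) bimod"
  assumes A: "left_module A"
  shows "essential n A \<alpha> \<longleftrightarrow> \<alpha> \<in> carrier (D_der A n (int n) 0)"
  using iterate_step_classes[OF A, of n 0 0] step_classes_0[OF A, of n]
  by (simp add: essential_iff[OF A] D_der_image)

section \<open>Restriction to the diagonal\<close>

lemma ZIpow_0_carr: "carr (ZIpow_mod 0 :: ('g::group_add, _) bimod) = {u. Poly_Mapping.keys u \<subseteq> {[g] | g. True}}"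
proof -
  let ?W = "{[g] | g. True} :: 'g list set"
  have gen: "tensor (frag_of g) (frag_of []) = frag_of [g]" for g :: 'g by (simp add: tensor_def)
  have t: "Poly_Mapping.keys (tensor a y) \<subseteq> ?W" if "Poly_Mapping.keys y \<subseteq> {[]}" for a :: "'g \<Rightarrow>\<^sub>0 int" and y
  proof -
    have "Poly_Mapping.keys (frag_extend (\<lambda>w. frag_of (g # w)) y) \<subseteq> {[g]}" for g :: 'g
      using keys_frag_extend[of "\<lambda>w. frag_of (g # w)" y] that by auto
    then show ?thesis
      using keys_frag_extend[of "\<lambda>g. frag_extend (\<lambda>w. frag_of (g # w)) y" a] unfolding tensor_def by blast
  qed
  have "Poly_Mapping.keys u \<subseteq> ?W" if "u \<in> ZI_power 0" for u
    using that
  proof induction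
    case (add a y u)
    then show ?case using t[of y a] Poly_Mapping.keys_add[of "tensor a y" u] by auto
  qed simp
  moreover have "u \<in> ZI_power 0" if "Poly_Mapping.keys u \<subseteq> ?W" for u
  proof (rule frag_induction[OF that])
    show "0 \<in> ZI_power 0" by (rule tensor_group.zero)
    show "frag_of w \<in> ZI_power 0" if w: "w \<in> ?W" for w
    proof -
      obtain g where "w = [g]" using w by auto
      moreover have "tensor (frag_of g) (frag_of []) \<in> ZI_power 0" by (rule tensor_in_group) simp_all
      ultimately show ?thesis by (simp only: gen)
    qed
  qed (rule tensor_group_diff[OF UNIV_I])
  ultimately show ?thesis by (auto simp: ZIpow_mod_def simp del: I_power.simps)
qed

abbreviation diag :: "'g list \<Rightarrow> ('g \<times> 'g) list" where
  "diag \<equiv> map (\<lambda>g. (g, g))"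

lemma conj_module:
  fixes A :: "('g::group_add, 'a::ab_group_add) bimod"
  assumes A: "left_module A" shows "left_module (conj_mod A)"
proof -
  let ?\<Delta> = "frag_extend (\<lambda>g :: 'g. frag_of (g, g))"
  have "?\<Delta> (c * d) = ?\<Delta> c * ?\<Delta> d" for c d
    by (rule biadditive_frag_eq[of "\<lambda>c d. ?\<Delta> (c * d)" "\<lambda>c d. ?\<Delta> c * ?\<Delta> d"])
       (simp_all add: frag_extend_add distrib_left distrib_right mult_single)
  moreover have "?\<Delta> 1 = 1" by (simp add: single_one[symmetric] del: single_one) (simp add: zero_prod_def)
  ultimately show ?thesis
    using left_moduleD(1-8)[OF A] unfolding left_module_def conj_mod_def by (simp add: frag_extend_add)
qed

lemma conj_smul: "smul (conj_mod A) (frag_of h) = smul A (frag_of (h, h))"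
  by (simp add: conj_mod_def)

lemma trivial_module: "left_module (trivial_mod :: ('g::group_add \<Rightarrow>\<^sub>0 int, 'g tensors) lmod)"
proof -
  have "aug (c * d) = aug c * aug d" for c d :: "'g \<Rightarrow>\<^sub>0 int"
    by (rule biadditive_frag_eq[of "\<lambda>c d. aug (c * d)" "\<lambda>c d. aug c * aug d"])
       (simp_all add: aug_add distrib_left distrib_right mult_single)
  moreover have "aug (1 :: 'g \<Rightarrow>\<^sub>0 int) = 1" by (simp add: single_one[symmetric] del: single_one)
  ultimately show ?thesis
    unfolding left_module_def trivial_mod_def
    by (auto simp: aug_add frag_cmul_distrib frag_cmul_distrib2 dest: set_mp[OF Poly_Mapping.keys_add])
qed

abbreviation dpt :: "'g list \<Rightarrow> 'g list \<Rightarrow>\<^sub>0 'g tensors" where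
  "dpt \<sigma> \<equiv> single \<sigma> (frag_of [])"

text \<open>
  As for \<open>\<pi> \<times> \<pi>\<close>, the elements \<open>dpt \<sigma>\<close> generate the standard resolution, here of the group \<open>\<pi>\<close> that is
  identified with the diagonal.
\<close>

lemma lhom_trivial_mod_eqI:
  fixes f g :: "('g::group_add list \<Rightarrow>\<^sub>0 'g tensors) \<Rightarrow> 'n::ab_group_add"
  assumes "f \<in> lhom (bar r trivial_mod) N" "g \<in> lhom (bar r trivial_mod) N"
    and "\<And>\<sigma>. length \<sigma> = Suc r \<Longrightarrow> f (dpt \<sigma>) = g (dpt \<sigma>)"
  shows "f = g"
  by (rule lhom_bar_free_eqI[OF trivial_module _ assms(1,2), of "{[]}"]) (use assms(3) in \<open>auto simp: trivial_mod_def\<close>)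

lemma trivial_mod_pt: "frag_of [] \<in> carr trivial_mod" and Ipow_mod_pt: "frag_of [] \<in> carr triv"
  by (simp_all add: trivial_mod_def Ipow_mod_def)

lemma diag_chain_add:
  fixes x y :: "'g list \<Rightarrow>\<^sub>0 'm::ab_group_add"
  shows "add_extend (\<lambda>\<sigma> z. single (diag \<sigma>) z) (x + y) =
   add_extend (\<lambda>\<sigma> z. single (diag \<sigma>) z) x + add_extend (\<lambda>\<sigma> z. single (diag \<sigma>) z) y"
  by (rule add_extend_add) (simp add: single_add)

lemma diag_chain_single: "add_extend (\<lambda>\<sigma> z. single (diag \<sigma>) z) (single \<sigma> z) = single (diag \<sigma>) z"
  by (rule add_extend_single) simp

lemma diag_chain_carr:
  assumes "x \<in> carr (bar r trivial_mod)"
  shows "add_extend (\<lambda>\<sigma> z. single (diag \<sigma>) z) x \<in> carr (bar r triv)"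
  using assms trivial_module
proof (induction rule: bar_induct)
  case zero show ?case by (simp add: bar_carr_0[OF Ipow_module])
next
  case (single \<sigma> m)
  then show ?case unfolding diag_chain_single
    by (intro bar_carr_single[OF Ipow_module]) (simp_all add: trivial_mod_def Ipow_mod_def)
qed (simp add: diag_chain_add bar_carr_add[OF Ipow_module])

lemma diag_restrict_dpt:
  "length \<sigma> = Suc n \<Longrightarrow> diag_restrict n \<phi> (dpt \<sigma>) = \<phi> (pt (diag \<sigma>))"
  by (simp add: diag_restrict_def restrict0_def diag_chain_single bar_carr_single[OF trivial_module trivial_mod_pt])

lemma diag_restrict_diff: "diag_restrict n (\<phi> - \<psi>) = diag_restrict n \<phi> - diag_restrict n \<psi>"
  by (auto simp: diag_restrict_def restrict0_def)

lemma diag_restrict_hom: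
  fixes A :: "('g::group_add, 'a::ab_group_add) bimod"
  assumes A: "left_module A" and \<phi>: "\<phi> \<in> lhom (bar n triv) A"
  shows "diag_restrict n \<phi> \<in> lhom (bar n trivial_mod) (conj_mod A)"
  unfolding diag_restrict_def module_map_restrict0[OF bar_left_module[OF trivial_module]]
proof (rule bar_module_mapI[OF trivial_module conj_module[OF A]])
  note \<phi>m = module_mapD[OF lhom_module_map[OF \<phi>]]
  fix x y :: "'g list \<Rightarrow>\<^sub>0 'g tensors"
  assume "x \<in> carr (bar n trivial_mod)" "y \<in> carr (bar n trivial_mod)"
  then show "\<phi> (add_extend (\<lambda>\<sigma>. single (diag \<sigma>)) (x + y)) =
     \<phi> (add_extend (\<lambda>\<sigma>. single (diag \<sigma>)) x) + \<phi> (add_extend (\<lambda>\<sigma>. single (diag \<sigma>)) y)"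
    by (simp add: diag_chain_add \<phi>m(2) diag_chain_carr)
next
  fix \<sigma> :: "'g list" and m :: "'g tensors"
  show "\<phi> (add_extend (\<lambda>\<sigma>. single (diag \<sigma>)) (single \<sigma> m)) \<in> carr (conj_mod A)"
    using lhom_range[OF A \<phi>] by (simp add: conj_mod_def)
next
  note \<phi>m = module_mapD[OF lhom_module_map[OF \<phi>]]
  fix h :: 'g and \<sigma> :: "'g list" and m :: "'g tensors"
  assume \<sigma>: "length \<sigma> = Suc n" and m: "m \<in> carr trivial_mod"
  then have m': "m \<in> carr (Ipow_mod 0 :: ('g, _) bimod)" by (simp add: trivial_mod_def Ipow_mod_def)
  have "smul (bar n triv) (frag_of (h, h)) (single (diag \<sigma>) m) = single (diag (map ((+) h) \<sigma>)) m"
  proof -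
    have "smul triv (frag_of (h, h)) m = m" using m' by (simp add: Ipow_mod_def Ipow_0_act)
    then show ?thesis by (simp add: bar_smul_single[OF Ipow_module m'] comp_def)
  qed
  then show "\<phi> (add_extend (\<lambda>\<sigma>. single (diag \<sigma>)) (single (map ((+) h) \<sigma>) (smul trivial_mod (frag_of h) m))) =
    smul (conj_mod A) (frag_of h) (\<phi> (add_extend (\<lambda>\<sigma>. single (diag \<sigma>)) (single \<sigma> m)))"
    using \<phi>m(3)[of "single (diag \<sigma>) m" "frag_of (h, h)"] bar_carr_single[OF Ipow_module m', of "diag \<sigma>" n] \<sigma>
    by (simp add: diag_chain_single conj_smul trivial_mod_def)
qed

lemma coboundary_dpt:
  assumes "f \<in> lhom (bar r trivial_mod) N" "length \<sigma> = Suc (Suc r)"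
  shows "coboundary r trivial_mod f (dpt \<sigma>) = face_sum (\<lambda>\<tau>. f (dpt \<tau>)) \<sigma>"
  using assms by (intro coboundary_single[OF trivial_module] trivial_mod_pt)

lemma face_sum_map: "face_sum F (map f \<sigma>) = face_sum (\<lambda>\<tau>. F (map f \<tau>)) \<sigma>"
  by (induction \<sigma> arbitrary: F) simp_all

lemma diag_restrict_coboundary:
  assumes A: "left_module A" and \<theta>: "\<theta> \<in> lhom (bar q triv) A"
  shows "diag_restrict (Suc q) (coboundary q triv \<theta>) = coboundary q trivial_mod (diag_restrict q \<theta>)"
proof (rule lhom_trivial_mod_eqI)
  show "diag_restrict (Suc q) (coboundary q triv \<theta>) \<in> lhom (bar (Suc q) trivial_mod) (conj_mod A)"
    by (rule diag_restrict_hom[OF A coboundary_hom[OF Ipow_module \<theta>]])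
  show "coboundary q trivial_mod (diag_restrict q \<theta>) \<in> lhom (bar (Suc q) trivial_mod) (conj_mod A)"
    by (rule coboundary_hom[OF trivial_module diag_restrict_hom[OF A \<theta>]])
  fix \<sigma> :: "'a list" assume \<sigma>: "length \<sigma> = Suc (Suc q)"
  show "diag_restrict (Suc q) (coboundary q triv \<theta>) (dpt \<sigma>) = coboundary q trivial_mod (diag_restrict q \<theta>) (dpt \<sigma>)"
    using \<sigma> coboundary_pt[OF \<theta>, of "diag \<sigma>"] coboundary_dpt[OF diag_restrict_hom[OF A \<theta>] \<sigma>]
    by (simp add: diag_restrict_dpt face_sum_map cong: face_sum_cong)
qed

lemma zero_divisor_cls:
  assumes A: "left_module A" and n: "n = Suc q"
  shows "zero_divisor n A (cls n triv A \<phi>) \<longleftrightarrow> diag_restrict n \<phi> \<in> coboundaries n trivial_mod (conj_mod A)"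
proof -
  have "the_elem ((\<lambda>\<phi>. cls n trivial_mod (conj_mod A) (diag_restrict n \<phi>)) ` cls n triv A \<phi>) =
    cls n trivial_mod (conj_mod A) (diag_restrict n \<phi>)"
  proof (rule the_elem_image_cls[OF A conj_module[OF A]])
    fix \<psi> assume "\<psi> - \<phi> \<in> coboundaries n triv A"
    then obtain \<theta> where \<theta>: "\<theta> \<in> lhom (bar q triv) A" "\<psi> - \<phi> = coboundary q triv \<theta>"
      by (auto simp: coboundaries_def n)
    then show "diag_restrict n \<psi> - diag_restrict n \<phi> \<in> coboundaries n trivial_mod (conj_mod A)"
      using diag_restrict_coboundary[OF A \<theta>(1)] diag_restrict_hom[OF A \<theta>(1)]
      by (simp add: coboundaries_def n diag_restrict_diff[symmetric])
  qed
  then show ?thesis by (simp add: zero_divisor_def cls_one_iff[OF conj_module[OF A]])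
qed

section \<open>The prism operator\<close>

text \<open>
  The alternating sum of the values of \<open>G\<close> at \<open>(f x_0, ..., f x_i, x_i, ..., x_r)\<close>. It is the dual of
  the prism operator, which compares the identity of the standard resolution with the map induced by
  \<open>f\<close>.
\<close>

fun prism :: "('h \<Rightarrow> 'h) \<Rightarrow> ('h list \<Rightarrow> 'b::ab_group_add) \<Rightarrow> 'h list \<Rightarrow> 'b" where
  "prism f G [] = 0"
| "prism f G (x # \<sigma>) = G (f x # x # \<sigma>) - prism f (\<lambda>\<tau>. G (f x # \<tau>)) \<sigma>"

lemma face_sum_diff: "face_sum (\<lambda>\<tau>. F \<tau> - G \<tau>) \<sigma> = face_sum F \<sigma> - face_sum G \<sigma>"
  by (induction \<sigma> arbitrary: F G) simp_all

lemma face_sum_add: "face_sum (\<lambda>\<tau>. F \<tau> + G \<tau>) \<sigma> = face_sum F \<sigma> + face_sum G \<sigma>"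
  by (induction \<sigma> arbitrary: F G) simp_all

lemma prism_diff: "prism f (\<lambda>\<tau>. F \<tau> - G \<tau>) \<sigma> = prism f F \<sigma> - prism f G \<sigma>"
  by (induction \<sigma> arbitrary: F G) simp_all

lemma prism_zero: "prism f (\<lambda>_. 0) \<sigma> = 0"
  by (induction \<sigma>) simp_all

text \<open>
  Since the face sum of \<open>[x]\<close> includes the empty tuple, this is the homotopy formula for the augmented
  complex; it needs no separate treatment of degree 0, and the induction can start at the empty tuple.
\<close>

lemma prism_homotopy:
  "face_sum (prism f G) \<sigma> + prism f (face_sum G) \<sigma> = G \<sigma> - G (map f \<sigma>)"
proof (induction \<sigma> arbitrary: G)
  case (Cons x \<sigma>)
  let ?G = "\<lambda>\<tau>. G (f x # \<tau>)"
  have "face_sum (prism f G) (x # \<sigma>) = prism f G \<sigma> - (face_sum (\<lambda>\<tau>. G (f x # x # \<tau>)) \<sigma> - face_sum (prism f ?G) \<sigma>)"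
    by (simp add: face_sum_diff)
  moreover have "prism f (face_sum G) (x # \<sigma>) =
     (G (x # \<sigma>) - (?G \<sigma> - face_sum (\<lambda>\<tau>. G (f x # x # \<tau>)) \<sigma>)) - (prism f G \<sigma> - prism f (face_sum ?G) \<sigma>)"
    by (simp add: prism_diff)
  ultimately show ?case using Cons.IH[of ?G] by (simp add: algebra_simps)
qed simp

lemma prism_carr:
  assumes A: "left_module A" and G: "\<And>\<tau>. G \<tau> \<in> carr A"
  shows "prism f G \<sigma> \<in> carr A"
  using G by (induction \<sigma> arbitrary: G) (simp_all add: left_moduleD(1)[OF A] left_module_diff[OF A])

lemma prism_act:
  fixes A :: "('h::group_add \<Rightarrow>\<^sub>0 int, 'a::ab_group_add) lmod"
  assumes A: "left_module A" and f: "\<And>x. f' (h + x) = h + f x" and c: "\<And>\<tau>. G \<tau> \<in> carr A"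
    and G: "\<And>\<tau>. G' (map ((+) h) \<tau>) = smul A (frag_of h) (G \<tau>)"
  shows "prism f' G' (map ((+) h) \<sigma>) = smul A (frag_of h) (prism f G \<sigma>)"
  using c G
proof (induction \<sigma> arbitrary: G G')
  case Nil show ?case by (simp add: left_moduleD(9)[OF A])
next
  case (Cons x \<sigma>)
  have "prism f' (\<lambda>\<tau>. G' (f' (h + x) # \<tau>)) (map ((+) h) \<sigma>) = smul A (frag_of h) (prism f (\<lambda>\<tau>. G (f x # \<tau>)) \<sigma>)"
    by (rule Cons.IH) (simp_all add: Cons.prems f flip: Cons.prems(2))
  moreover have "G' (f' (h + x) # (h + x) # map ((+) h) \<sigma>) = smul A (frag_of h) (G (f x # x # \<sigma>))"
    by (simp add: f flip: Cons.prems(2))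
  ultimately show ?case by (simp add: smul_diff[OF A] prism_carr[OF A] Cons.prems(1))
qed

lemma face_sum_smul:
  assumes A: "left_module A" and F: "\<And>\<tau>. F \<tau> \<in> carr A"
  shows "face_sum (\<lambda>\<tau>. smul A c (F \<tau>)) \<sigma> = smul A c (face_sum F \<sigma>) \<and> face_sum F \<sigma> \<in> carr A"
  using F
proof (induction \<sigma> arbitrary: F)
  case (Cons x \<sigma>) then show ?case
    by (simp add: smul_diff[OF A] left_module_diff[OF A])
qed (simp add: left_moduleD[OF A])

lemma pullback_eps_single:
  assumes "length \<sigma> = Suc n"
  shows "pullback n (ZIpow_mod 0) eps_tensor \<phi> (single \<sigma> (frag_of [g])) = \<phi> (pt \<sigma>)"
proof -
  have "frag_of [g] \<in> carr (ZIpow_mod 0)" by (simp add: ZIpow_0_carr)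
  moreover have "eps_tensor (frag_of [g]) = frag_of []" by (simp add: eps_tensor_def)
  ultimately show ?thesis
    using assms by (simp add: pullback_def restrict0_def bar_carr_single[OF ZIpow_module]
      map_single_0[of eps_tensor, OF additive_minus_frag(1)[OF eps_add]])
qed

section \<open>Zero-divisors\<close>

text \<open>
  The diagonal is the stabilizer of the unit of \<open>\<pi>\<close>, so a cochain on \<open>Z[\<pi>]\<close> restricts, at the unit, to
  a cochain of the diagonal. In the other direction, let the restriction of \<open>\<phi>\<close> be the coboundary of
  \<open>\<chi>\<close>. For \<open>g\<close> in \<open>\<pi>\<close> the map \<open>f(x,y) = (g y, y)\<close> is equivariant for the stabilizer of \<open>g\<close> and retracts
  \<open>\<pi> \<times> \<pi>\<close> onto the coset \<open>(g,1) \<Delta>\<close>. The prism operator of \<open>f\<close> applied to \<open>\<phi>\<close> is a cochain whose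
  coboundary is \<open>\<phi>\<close> minus the pullback of \<open>\<phi>\<close> along \<open>f\<close>. That pullback depends only on the restriction
  to the diagonal, hence is the coboundary of \<open>(g,1) \<cdot> \<chi>(y_0, ..., y_q)\<close>. The sum of the two cochains is
  equivariant when \<open>g\<close> varies, so it is a cochain on \<open>Z[\<pi>]\<close>.
\<close>

theorem pullback_eps_coboundary_iff:
  fixes A :: "('g::group_add, 'a::ab_group_add) bimod"
  assumes A: "left_module A" and \<phi>: "\<phi> \<in> cocycles (Suc q) triv A"
  shows "pullback (Suc q) (ZIpow_mod 0) eps_tensor \<phi> \<in> coboundaries (Suc q) (ZIpow_mod 0) A \<longleftrightarrow>
    diag_restrict (Suc q) \<phi> \<in> coboundaries (Suc q) trivial_mod (conj_mod A)" (is "?L \<longleftrightarrow> ?R")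
proof -
  let ?I = "Ipow_mod 0 :: ('g, 'g tensors) bimod"
  let ?Z = "ZIpow_mod 0 :: ('g, 'g tensors) bimod"
  have \<phi>h: "\<phi> \<in> lhom (bar (Suc q) ?I) A" and \<phi>d: "coboundary (Suc q) ?I \<phi> = 0" using \<phi> by (auto simp: cocycles_def)
  have e\<phi>: "pullback (Suc q) ?Z eps_tensor \<phi> \<in> lhom (bar (Suc q) ?Z) A"
    by (rule pullback_hom[OF ZIpow_module Ipow_module eps_tensor_map \<phi>h])
  have gZ: "frag_of [g] \<in> carr ?Z" for g by (simp add: ZIpow_0_carr)
  note conjA = conj_module[OF A]
  show ?thesis
  proof
    assume ?L
    then obtain \<psi> where \<psi>: "\<psi> \<in> lhom (bar q ?Z) A" "pullback (Suc q) ?Z eps_tensor \<phi> = coboundary q ?Z \<psi>"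
      by (auto simp: coboundaries_def)
    \<comment> \<open>Otherwise the group element \<open>frag_of 0\<close> is rewritten to the unit \<open>1\<close> of the ring, which hides pure tensors.\<close>
    note single_one [simp del]
    note \<psi>m = module_mapD[OF lhom_module_map[OF \<psi>(1)]]
    define F where "F \<tau> z = \<psi> (single (diag \<tau>) (tensor (frag_of 0) z))" for \<tau> and z :: "'g tensors"
    have Z: "tensor (frag_of 0) z \<in> carr ?Z" if "z \<in> carr trivial_mod" for z :: "'g tensors"
      using that by (simp add: ZIpow_mod_def trivial_mod_def tensor_in_group)
    have F: "F \<tau> (z + z') = F \<tau> z + F \<tau> z'" if "length \<tau> = Suc q" "z \<in> carr trivial_mod" "z' \<in> carr trivial_mod" for \<tau> z z'
      using that by (simp add: F_def tensor_add_right single_add \<psi>m(2) bar_carr_single[OF ZIpow_module Z])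
    have Fc: "F \<tau> z \<in> carr (conj_mod A)" for \<tau> z
      using lhom_range[OF A \<psi>(1)] by (simp add: F_def conj_mod_def)
    have Fe: "F (map ((+) h) \<tau>) (smul trivial_mod (frag_of h) z) = smul (conj_mod A) (frag_of h) (F \<tau> z)"
      if \<tau>: "length \<tau> = Suc q" and z: "z \<in> carr trivial_mod" for h \<tau> z
    proof -
      have "bact (h, h) 0 = 0" by (simp add: bact_def)
      then have "tact (h, h) (tensor (frag_of 0) z) = tensor (frag_of 0) z"
        using z by (simp add: perm_tensor Ipow_0_act trivial_mod_def perm_smul_of[of bact])
      then have "smul (bar q ?Z) (frag_of (h, h)) (single (diag \<tau>) (tensor (frag_of 0) z)) =
        single (diag (map ((+) h) \<tau>)) (tensor (frag_of 0) z)"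
        using bar_smul_single[OF ZIpow_module Z[OF z]] by (simp add: ZIpow_mod_def comp_def)
      then show ?thesis
        using \<psi>m(3)[of "single (diag \<tau>) (tensor (frag_of 0) z)" "frag_of (h, h)"]
          bar_carr_single[OF ZIpow_module Z[OF z], of "diag \<tau>" q] \<tau>
        by (simp add: F_def conj_smul trivial_mod_def)
    qed
    define \<chi> where "\<chi> = restrict0 (carr (bar q trivial_mod)) (add_extend F)"
    have \<chi>: "\<chi> \<in> lhom (bar q trivial_mod) (conj_mod A)"
      unfolding \<chi>_def by (rule bar_lift(1)[OF trivial_module conjA]) (simp_all add: F Fc Fe)
    have \<chi>1: "\<chi> (dpt \<tau>) = \<psi> (single (diag \<tau>) (frag_of [0]))" if "length \<tau> = Suc q" for \<tau>
    proof -
      have "\<chi> (dpt \<tau>) = F \<tau> (frag_of [])"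
        unfolding \<chi>_def by (rule bar_lift(2)[where N = "conj_mod A", OF trivial_module conjA])
          (simp_all add: F Fc Fe that trivial_mod_pt)
      then show ?thesis by (simp add: F_def tensor_def)
    qed
    have "diag_restrict (Suc q) \<phi> = coboundary q trivial_mod \<chi>"
    proof (rule lhom_trivial_mod_eqI)
      show "diag_restrict (Suc q) \<phi> \<in> lhom (bar (Suc q) trivial_mod) (conj_mod A)" by (rule diag_restrict_hom[OF A \<phi>h])
      show "coboundary q trivial_mod \<chi> \<in> lhom (bar (Suc q) trivial_mod) (conj_mod A)" by (rule coboundary_hom[OF trivial_module \<chi>])
      fix \<sigma> :: "'g list" assume \<sigma>: "length \<sigma> = Suc (Suc q)"
      have "coboundary q trivial_mod \<chi> (dpt \<sigma>) = face_sum (\<lambda>\<tau>. \<psi> (single (diag \<tau>) (frag_of [0]))) \<sigma>"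
        using coboundary_dpt[OF \<chi> \<sigma>] \<sigma> by (simp add: \<chi>1 cong: face_sum_cong)
      also have "\<dots> = coboundary q ?Z \<psi> (single (diag \<sigma>) (frag_of [0]))"
        using coboundary_single[OF ZIpow_module \<psi>(1) _ gZ, of "diag \<sigma>" 0] \<sigma> by (simp add: face_sum_map)
      also have "\<dots> = \<phi> (pt (diag \<sigma>))" using \<sigma> by (simp add: \<psi>(2)[symmetric] pullback_eps_single)
      finally show "diag_restrict (Suc q) \<phi> (dpt \<sigma>) = coboundary q trivial_mod \<chi> (dpt \<sigma>)"
        using \<sigma> by (simp add: diag_restrict_dpt)
    qed
    then show ?R using \<chi> by (simp add: coboundaries_def)
  next
    assume ?R
    then obtain \<chi> where \<chi>: "\<chi> \<in> lhom (bar q trivial_mod) (conj_mod A)" "diag_restrict (Suc q) \<phi> = coboundary q trivial_mod \<chi>"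
      by (auto simp: coboundaries_def)
    define G where "G \<tau> = \<phi> (pt \<tau>)" for \<tau>
    define X where "X \<tau> = \<chi> (dpt (map snd \<tau>))" for \<tau> :: "('g \<times> 'g) list"
    define f where "f g x = (g + snd x, snd x)" for g and x :: "'g \<times> 'g"
    define T where "T \<sigma> g = prism (f g) G \<sigma> + smul A (frag_of (g, 0)) (X \<sigma>)" for \<sigma> g
    have Gc: "G \<tau> \<in> carr A" for \<tau> unfolding G_def by (rule lhom_range[OF A \<phi>h])
    have Xc: "X \<tau> \<in> carr A" for \<tau> using lhom_range[OF conjA \<chi>(1)] by (simp add: X_def conj_mod_def)
    \<comment> \<open>Cochains vanish outside their carrier, so equivariance and the cocycle condition for \<open>G\<close> hold on tuples of every length.\<close>
    have G_out: "G \<tau> = 0" if "length \<tau> \<noteq> Suc (Suc q)" for \<tau>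
    proof -
      have "pt \<tau> \<notin> carr (bar (Suc q) ?I)" using that by (simp add: bar_def)
      then show ?thesis using \<phi>h by (simp add: G_def lhom_def)
    qed
    have Ge: "G (map ((+) h) \<tau>) = smul A (frag_of h) (G \<tau>)" for h \<tau>
    proof (cases "length \<tau> = Suc (Suc q)")
      case True then show ?thesis unfolding G_def by (rule pt_equivariant[OF \<phi>h])
    next
      case False then show ?thesis by (simp add: G_out left_moduleD(9)[OF A])
    qed
    have Gd: "face_sum G \<tau> = 0" for \<tau>
    proof (cases "length \<tau> = Suc (Suc (Suc q))")
      case True then show ?thesis using coboundary_pt[OF \<phi>h True] \<phi>d by (simp add: G_def[abs_def])
    next
      case False
      then have "face_sum G \<tau> = face_sum (\<lambda>_. 0) \<tau>" by (intro face_sum_cong G_out) auto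
      also have "face_sum (\<lambda>_. 0 :: 'a) \<tau> = 0" by (induction \<tau>) simp_all
      finally show ?thesis .
    qed
    have Tc: "T \<sigma> g \<in> carr A" for \<sigma> g
      unfolding T_def by (intro left_moduleD(2,4)[OF A] prism_carr[OF A] Gc Xc)
    have Te: "T (map ((+) h) \<sigma>) (bact h g) = smul A (frag_of h) (T \<sigma> g)" if \<sigma>: "length \<sigma> = Suc q" for h \<sigma> g
    proof -
      have fe: "f (bact h g) (h + x) = h + f g x" for x
        by (cases h) (simp add: f_def bact_def diff_conv_add_uminus add.assoc del: add_uminus_conv_diff)
      have 1: "prism (f (bact h g)) G (map ((+) h) \<sigma>) = smul A (frag_of h) (prism (f g) G \<sigma>)"
        by (rule prism_act[of A _ _ _ G, OF A]) (rule fe Gc Ge)+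
      have "X (map ((+) h) \<sigma>) = smul A (frag_of (snd h, snd h)) (X \<sigma>)"
      proof -
        have "smul trivial_mod (frag_of (snd h)) (frag_of []) = frag_of []" by (simp add: trivial_mod_def)
        then have "smul (bar q trivial_mod) (frag_of (snd h)) (dpt (map snd \<sigma>)) = dpt (map snd (map ((+) h) \<sigma>))"
          by (simp add: bar_smul_single[OF trivial_module trivial_mod_pt] comp_def)
        then show ?thesis
          using module_mapD(3)[OF lhom_module_map[OF \<chi>(1)], of "dpt (map snd \<sigma>)" "frag_of (snd h)"] \<sigma>
          by (simp add: X_def conj_smul bar_carr_single[OF trivial_module trivial_mod_pt])
      qed
      then have "smul A (frag_of (bact h g, 0)) (X (map ((+) h) \<sigma>)) = smul A (frag_of (bact h g, 0) * frag_of (snd h, snd h)) (X \<sigma>)"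
        by (simp add: left_moduleD(7)[OF A Xc])
      also have "frag_of (bact h g, 0) * frag_of (snd h, snd h) = frag_of h * frag_of (g, 0)"
        by (cases h) (simp add: mult_single bact_def)
      finally have 2: "smul A (frag_of (bact h g, 0)) (X (map ((+) h) \<sigma>)) = smul A (frag_of h) (smul A (frag_of (g, 0)) (X \<sigma>))"
        by (simp add: left_moduleD(7)[OF A Xc])
      show ?thesis unfolding T_def 1 2
        by (intro left_moduleD(5)[OF A, symmetric] prism_carr[OF A] Gc left_moduleD(4)[OF A] Xc)
    qed
    define F where "F \<sigma> = add_extend (\<lambda>w c. smul A (single 0 c) (T \<sigma> (hd w)))" for \<sigma>
    have Fa: "F \<sigma> (u + u') = F \<sigma> u + F \<sigma> u'" for \<sigma> u u'
      unfolding F_def by (rule add_extend_add) (simp add: single_add left_moduleD(6)[OF A Tc])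
    have F1: "F \<sigma> (frag_of w) = T \<sigma> (hd w)" for \<sigma> w
      unfolding F_def by (subst add_extend_single) (simp_all add: left_moduleD(8,10)[OF A Tc])
    have Fc: "F \<sigma> u \<in> carr A" for \<sigma> u
      unfolding F_def add_extend_def by (rule sum_induct_carr[OF A]) (simp add: left_moduleD(4)[OF A Tc])
    note Fd = additive_minus_frag[of "F _", OF Fa]
    have Fe: "F (map ((+) h) \<sigma>) (smul ?Z (frag_of h) u) = smul A (frag_of h) (F \<sigma> u)"
      if \<sigma>: "length \<sigma> = Suc q" and u: "u \<in> carr ?Z" for h \<sigma> u
    proof -
      have "Poly_Mapping.keys u \<subseteq> {[g] | g. True}" using u by (simp add: ZIpow_0_carr)
      then have "F (map ((+) h) \<sigma>) (tact h u) = smul A (frag_of h) (F \<sigma> u)"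
      proof (induction u rule: frag_induction[consumes 1, case_names zero one diff])
        case zero show ?case by (simp add: Fd perm_smul_of left_moduleD(9)[OF A])
      next
        case (one w) then show ?case by (auto simp: perm_smul_of F1 Te[OF \<sigma>])
      next
        case (diff a b) then show ?case
          by (simp add: Fd(3) additive_minus_frag(3)[of "tact h", OF perm_smul_add_right] smul_diff[OF A Fc Fc])
      qed
      then show ?thesis by (simp add: ZIpow_mod_def)
    qed
    define \<psi> where "\<psi> = restrict0 (carr (bar q ?Z)) (add_extend F)"
    have \<psi>: "\<psi> \<in> lhom (bar q ?Z) A"
      unfolding \<psi>_def by (rule bar_lift(1)[OF ZIpow_module A]) (simp_all add: Fa Fc Fe)
    have \<psi>1: "\<psi> (single \<tau> (frag_of [g])) = T \<tau> g" if "length \<tau> = Suc q" for \<tau> g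
    proof -
      have "\<psi> (single \<tau> (frag_of [g])) = F \<tau> (frag_of [g])"
        unfolding \<psi>_def by (rule bar_lift(2)[where N = A, OF ZIpow_module A]) (simp_all add: Fa Fc Fe that gZ)
      then show ?thesis by (simp add: F1)
    qed
    have "pullback (Suc q) ?Z eps_tensor \<phi> = coboundary q ?Z \<psi>"
    proof (rule lhom_bar_free_eqI[OF ZIpow_module ZIpow_0_carr e\<phi> coboundary_hom[OF ZIpow_module \<psi>]])
      fix \<sigma> :: "('g \<times> 'g) list" and w :: "'g list"
      assume \<sigma>: "length \<sigma> = Suc (Suc q)" and "w \<in> {[g] | g. True}"
      then obtain g where w: "w = [g]" by auto
      have "coboundary q ?Z \<psi> (single \<sigma> (frag_of [g])) = face_sum (\<lambda>\<tau>. T \<tau> g) \<sigma>"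
        using coboundary_single[OF ZIpow_module \<psi> \<sigma> gZ] \<sigma> by (simp add: \<psi>1 cong: face_sum_cong)
      also have "\<dots> = face_sum (prism (f g) G) \<sigma> + smul A (frag_of (g, 0)) (face_sum X \<sigma>)"
        unfolding T_def face_sum_add using face_sum_smul[of A X, OF A Xc] by simp
      also have "face_sum X \<sigma> = G (diag (map snd \<sigma>))"
        using coboundary_dpt[OF \<chi>(1), of "map snd \<sigma>"] \<sigma>
        by (simp add: X_def[abs_def] face_sum_map \<chi>(2)[symmetric] diag_restrict_dpt G_def)
      also have "smul A (frag_of (g, 0)) \<dots> = G (map (f g) \<sigma>)"
        by (simp add: Ge[symmetric] f_def[abs_def] comp_def)
      also have "face_sum (prism (f g) G) \<sigma> + G (map (f g) \<sigma>) = G \<sigma>"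
      proof -
        have "face_sum G = (\<lambda>_. 0)" using Gd by auto
        then show ?thesis using prism_homotopy[of "f g" G \<sigma>] by (simp add: prism_zero)
      qed
      finally show "pullback (Suc q) ?Z eps_tensor \<phi> (single \<sigma> (frag_of w)) =
        coboundary q ?Z \<psi> (single \<sigma> (frag_of w))"
        using \<sigma> by (simp add: w pullback_eps_single G_def)
    qed
    then show ?L using \<psi> by (simp add: coboundaries_def)
  qed
qed

section \<open>The obstructions\<close>

lemma zero_divisor_iff:
  fixes A :: "('g::group_add, 'a::ab_group_add) bimod"
  assumes A: "left_module A" and n: "0 < n" and \<alpha>: "\<alpha> \<in> carrier (coho n A)"
  shows "j0 A (int n) 0 \<alpha> = \<one>\<^bsub>E0 A (int n) 0\<^esub> \<longleftrightarrow> zero_divisor n A \<alpha>"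
proof -
  obtain q where q: "n = Suc q" using n by (metis gr0_implies_Suc)
  obtain \<phi> where \<phi>: "\<phi> \<in> cocycles n triv A" "\<alpha> = cls n triv A \<phi>" using \<alpha> by (auto simp: Ext_carrier)
  have "j0 A (int n) (int 0) \<alpha> = cls n (ZIpow_mod 0) A (pullback n (ZIpow_mod 0) eps_tensor \<phi>)"
    unfolding j0_Ext_map \<phi>(2) by (rule Ext_map_cls[OF ZIpow_module Ipow_module A eps_tensor_map])
  then have "j0 A (int n) 0 \<alpha> = \<one>\<^bsub>E0 A (int n) 0\<^esub> \<longleftrightarrow> pullback n (ZIpow_mod 0) eps_tensor \<phi> \<in> coboundaries n (ZIpow_mod 0) A"
    using E0_Ext[of A n 0] by (simp add: cls_one_iff[OF A])
  also have "\<dots> \<longleftrightarrow> zero_divisor n A \<alpha>"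
    unfolding \<phi>(2) zero_divisor_cls[OF A q] using pullback_eps_coboundary_iff[OF A] \<phi>(1) q by simp
  finally show ?thesis .
qed

lemma obstruction_iff:
  assumes A: "left_module A" and \<alpha>: "\<alpha> \<in> carrier (D_der A s (int n) 0)"
  shows "j_der A s (int n) 0 \<alpha> = \<one>\<^bsub>E_der A s (int n - int s) (int s)\<^esub> \<longleftrightarrow> \<alpha> \<in> carrier (D_der A (Suc s) (int n) 0)"
  using partial_exact_couple.exact_j[OF derived_partial_exact_couple[OF A, of s], of 0 \<alpha> "int n"] \<alpha>
  by (simp add: derived_couple_def)

lemma D_der_mono:
  assumes A: "left_module A" shows "carrier (D_der A (Suc s) r t) \<subseteq> carrier (D_der A s r t)"
proof -
  interpret partial_exact_couple "int s" "derived A s" by (rule derived_partial_exact_couple[OF A])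
  show ?thesis using subgroup.subset[OF derived_D_subgroup] by simp
qed

lemma obstructions_iff:
  assumes A: "left_module A" and \<alpha>: "\<alpha> \<in> carrier (coho n A)"
  shows "\<alpha> \<in> carrier (D_der A k (int n) 0) \<longleftrightarrow>
    (\<forall>s<k. \<alpha> \<in> carrier (D_der A s (int n) 0) \<and> j_der A s (int n) 0 \<alpha> = \<one>\<^bsub>E_der A s (int n - int s) (int s)\<^esub>)"
proof (induction k)
  case 0
  then show ?case using \<alpha> D0_Ext[of A n 0] by simp
next
  case (Suc k)
  have "\<alpha> \<in> carrier (D_der A (Suc k) (int n) 0) \<longleftrightarrow> \<alpha> \<in> carrier (D_der A k (int n) 0) \<and>
    j_der A k (int n) 0 \<alpha> = \<one>\<^bsub>E_der A k (int n - int k) (int k)\<^esub>"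
    using obstruction_iff[OF A, of \<alpha> k n] D_der_mono[OF A, of k "int n" 0] by blast
  with Suc show ?case unfolding less_Suc_eq by blast
qed

theorem corollary7p6:
  fixes A :: "(('g::group_add \<times> 'g) \<Rightarrow>\<^sub>0 int, 'a::ab_group_add) lmod"
    and k n :: nat
    and \<alpha> :: "('g, 'a) cochain set"
  assumes "left_module A"
    and "0 < k" and "k \<le> n"
    and "\<alpha> \<in> carrier (coho n A)"
  shows
    "carrier (D_der A k (int n) 0) =
       i0_iter A k (int n - int k) (int k) ` carrier (D0 A (int n - int k) (int k)) \<and>
     (\<alpha> \<in> carrier (D_der A k (int n) 0) \<longleftrightarrow>
       (\<forall>s<k. \<alpha> \<in> carrier (D_der A s (int n) 0) \<and>
          j_der A s (int n) 0 \<alpha> = \<one>\<^bsub>E_der A s (int n - int s) (int s)\<^esub>)) \<and>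
     (j_der A 0 (int n) 0 \<alpha> = \<one>\<^bsub>E_der A 0 (int n) 0\<^esub> \<longleftrightarrow> zero_divisor n A \<alpha>) \<and>
     (\<forall>s\<ge>1. \<alpha> \<in> carrier (D_der A (s - 1) (int n) 0) \<and>
          j_der A (s - 1) (int n) 0 \<alpha> = \<one>\<^bsub>E_der A (s - 1) (int n - int (s - 1)) (int (s - 1))\<^esub> \<longrightarrow>
        \<alpha> \<in> carrier (D_der A s (int n) 0)) \<and>
     ((\<forall>s<n. \<alpha> \<in> carrier (D_der A s (int n) 0) \<and>
          j_der A s (int n) 0 \<alpha> = \<one>\<^bsub>E_der A s (int n - int s) (int s)\<^esub>) \<longleftrightarrow>
        essential n A \<alpha>)"
proof (intro conjI)
  note A = assms(1) and \<alpha> = assms(4)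
  show "carrier (D_der A k (int n) 0) = i0_iter A k (int n - int k) (int k) ` carrier (D0 A (int n - int k) (int k))"
    by (simp add: D_der_image)
  show "\<alpha> \<in> carrier (D_der A k (int n) 0) \<longleftrightarrow>
       (\<forall>s<k. \<alpha> \<in> carrier (D_der A s (int n) 0) \<and>
          j_der A s (int n) 0 \<alpha> = \<one>\<^bsub>E_der A s (int n - int s) (int s)\<^esub>)"
    by (rule obstructions_iff[OF A \<alpha>])
  show "j_der A 0 (int n) 0 \<alpha> = \<one>\<^bsub>E_der A 0 (int n) 0\<^esub> \<longleftrightarrow> zero_divisor n A \<alpha>"
    using zero_divisor_iff[OF A _ \<alpha>] assms(2,3) by simp
  show "\<forall>s\<ge>1. \<alpha> \<in> carrier (D_der A (s - 1) (int n) 0) \<and>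
          j_der A (s - 1) (int n) 0 \<alpha> = \<one>\<^bsub>E_der A (s - 1) (int n - int (s - 1)) (int (s - 1))\<^esub> \<longrightarrow>
        \<alpha> \<in> carrier (D_der A s (int n) 0)"
  proof (intro allI impI, elim conjE)
    fix s :: nat assume s: "1 \<le> s" and d: "\<alpha> \<in> carrier (D_der A (s - 1) (int n) 0)"
      and j: "j_der A (s - 1) (int n) 0 \<alpha> = \<one>\<^bsub>E_der A (s - 1) (int n - int (s - 1)) (int (s - 1))\<^esub>"
    have "\<alpha> \<in> carrier (D_der A (Suc (s - 1)) (int n) 0)" using obstruction_iff[OF A d] j by blast
    then show "\<alpha> \<in> carrier (D_der A s (int n) 0)" using s by simp
  qed
  show "(\<forall>s<n. \<alpha> \<in> carrier (D_der A s (int n) 0) \<and>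
          j_der A s (int n) 0 \<alpha> = \<one>\<^bsub>E_der A s (int n - int s) (int s)\<^esub>) \<longleftrightarrow> essential n A \<alpha>"
    unfolding essential_iff_iterated_image[OF A] by (rule obstructions_iff[OF A \<alpha>, symmetric])
qed

end
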